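(* Let $\phi$ be a faithful finite-dimensional complex representation of a compact semisimple Lie algebra $\mathfrak{g}$ such that the symmetric square $\mathrm{Sym}^2\phi$ is irreducible. Then, up to isomorphism of $\mathfrak{g}$ and outer automorphisms of $\mathfrak{g}$ (and equivalence of representations), one of the following holds: (1) $\mathfrak{g}=\mathfrak{sp}(\ell)$ with $\ell\ge1$, $\phi$ has highest weight $(1,0,\ldots,0)$ (dimension $2\ell$), and $\mathrm{Sym}^2\phi$ has highest weight $(2,0,\ldots,0)$ (dimension $(2\ell+1)\ell$); or (2) $\mathfrak{g}=\mathfrak{su}(\ell+1)$ with $\ell\ge1$, $\phi$ has highest weight $(1,0,\ldots,0)$ (dimension $\ell+1$), and $\mathrm{Sym}^2\phi$ has highest weight $(2,0,\ldots,0)$ (dimension $(\ell+1)(\ell+2)/2$).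
   Context: $\mathfrak{sp}(\ell)=\mathfrak{sp}(2\ell,\mathbb C)\cap\mathfrak{su}(2\ell)$. Irreducible representations of compact simple Lie algebras are labeled by highest weights $(x_1,\ldots,x_\ell)$, $x_j\in\mathbb Z_{\ge0}$ the coefficient of the $j$-th fundamental weight, with Bourbaki's ordering of simple roots. For a representation $\phi$ on $V=\mathbb C^d$, $\phi\otimes\phi$ acts on $V\otimes V$ by $\phi(g)\otimes\mathbb 1+\mathbb 1\otimes\phi(g)$, and $\mathrm{Sym}^2\phi$ is its restriction to the symmetric subspace $\mathrm{Sym}^2V$ spanned by $v_i\otimes v_j+v_j\otimes v_i$. *)

theory Defs
  imports "HOL-Analysis.Analysis" "Jordan_Normal_Form.Matrix"
begin

definition lie_algebra :: "('a::euclidean_space \<Rightarrow> 'a \<Rightarrow> 'a) \<Rightarrow> bool" where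
  "lie_algebra br \<longleftrightarrow>
     (\<forall>y. linear (\<lambda>x. br x y)) \<and> (\<forall>x. linear (\<lambda>y. br x y)) \<and>
     (\<forall>x. br x x = 0) \<and>
     (\<forall>x y z. br x (br y z) + br y (br z x) + br z (br x y) = 0)"

definition killing_form :: "('a::euclidean_space \<Rightarrow> 'a \<Rightarrow> 'a) \<Rightarrow> 'a \<Rightarrow> 'a \<Rightarrow> real" where
  "killing_form br x y = (\<Sum>b\<in>Basis. (br x (br y b)) \<bullet> b)"

text \<open>Compact semisimple Lie algebra: (nonzero, which is automatic for a euclidean_space
  type) real Lie algebra with negative definite Killing form.\<close>
definition compact_semisimple :: "('a::euclidean_space \<Rightarrow> 'a \<Rightarrow> 'a) \<Rightarrow> bool" where
  "compact_semisimple br \<longleftrightarrow> lie_algebra br \<and> (\<forall>x. x \<noteq> 0 \<longrightarrow> killing_form br x x < 0)"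

definition mcomm :: "complex mat \<Rightarrow> complex mat \<Rightarrow> complex mat" where
  "mcomm A B = A * B - B * A"

definition mtrace :: "complex mat \<Rightarrow> complex" where
  "mtrace A = (\<Sum>i<dim_row A. A $$ (i, i))"

definition cadj :: "complex mat \<Rightarrow> complex mat" where
  "cadj A = mat (dim_col A) (dim_row A) (\<lambda>(i, j). cnj (A $$ (j, i)))"

definition su_alg :: "nat \<Rightarrow> complex mat set" where
  "su_alg n = {A \<in> carrier_mat n n. cadj A = - A \<and> mtrace A = 0}"

definition symp_J :: "nat \<Rightarrow> complex mat" where
  "symp_J l = mat (2*l) (2*l) (\<lambda>(i, j).
      if i < l \<and> j = i + l then 1 else if l \<le> i \<and> j + l = i then -1 else 0)"

definition sp_alg :: "nat \<Rightarrow> complex mat set" where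
  "sp_alg l = {A \<in> carrier_mat (2*l) (2*l). transpose_mat A * symp_J l + symp_J l * A = 0\<^sub>m (2*l) (2*l)}
              \<inter> su_alg (2*l)"

definition lie_rep :: "('a::euclidean_space \<Rightarrow> 'a \<Rightarrow> 'a) \<Rightarrow> nat \<Rightarrow> ('a \<Rightarrow> complex mat) \<Rightarrow> bool" where
  "lie_rep br d \<phi> \<longleftrightarrow>
     (\<forall>x. \<phi> x \<in> carrier_mat d d) \<and>
     (\<forall>x y. \<phi> (x + y) = \<phi> x + \<phi> y) \<and>
     (\<forall>r x. \<phi> (r *\<^sub>R x) = complex_of_real r \<cdot>\<^sub>m \<phi> x) \<and>
     (\<forall>x y. \<phi> (br x y) = mcomm (\<phi> x) (\<phi> y))"

text \<open>V \<otimes> V is identified with d x d matrices (v \<otimes> w \<mapsto> v w^T); then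
  (\<phi> \<otimes> \<phi>)(x) acts by M \<mapsto> \<phi>(x) M + M \<phi>(x)^T, and Sym^2 V (spanned by
  v\<otimes>w + w\<otimes>v) is the space of symmetric matrices.\<close>
definition sym2_space :: "nat \<Rightarrow> complex mat set" where
  "sym2_space d = {M \<in> carrier_mat d d. transpose_mat M = M}"

definition tensor_action :: "complex mat \<Rightarrow> complex mat \<Rightarrow> complex mat" where
  "tensor_action A M = A * M + M * transpose_mat A"

definition csubspace_mat :: "nat \<Rightarrow> complex mat set \<Rightarrow> bool" where
  "csubspace_mat d W \<longleftrightarrow> W \<subseteq> carrier_mat d d \<and> 0\<^sub>m d d \<in> W \<and>
     (\<forall>M\<in>W. \<forall>N\<in>W. M + N \<in> W) \<and> (\<forall>c. \<forall>M\<in>W. c \<cdot>\<^sub>m M \<in> W)"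

definition sym2_irreducible :: "nat \<Rightarrow> ('a \<Rightarrow> complex mat) \<Rightarrow> bool" where
  "sym2_irreducible d \<phi> \<longleftrightarrow>
     sym2_space d \<noteq> {0\<^sub>m d d} \<and>
     (\<forall>W. csubspace_mat d W \<and> W \<subseteq> sym2_space d \<and>
          (\<forall>x. \<forall>M\<in>W. tensor_action (\<phi> x) M \<in> W)
          \<longrightarrow> W = {0\<^sub>m d d} \<or> W = sym2_space d)"

definition lie_iso_onto :: "('a::euclidean_space \<Rightarrow> 'a \<Rightarrow> 'a) \<Rightarrow> ('a \<Rightarrow> complex mat) \<Rightarrow> complex mat set \<Rightarrow> bool" where
  "lie_iso_onto br \<psi> L \<longleftrightarrow> bij_betw \<psi> UNIV L \<and>
     (\<forall>x y. \<psi> (x + y) = \<psi> x + \<psi> y) \<and>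
     (\<forall>r x. \<psi> (r *\<^sub>R x) = complex_of_real r \<cdot>\<^sub>m \<psi> x) \<and>
     (\<forall>x y. \<psi> (br x y) = mcomm (\<psi> x) (\<psi> y))"

text \<open>\<phi> is equivalent to the defining representation of L composed with a
  Lie algebra isomorphism g \<cong> L (this absorbs isomorphisms and outer automorphisms).\<close>
definition equiv_to_standard :: "('a::euclidean_space \<Rightarrow> 'a \<Rightarrow> 'a) \<Rightarrow> nat \<Rightarrow> ('a \<Rightarrow> complex mat) \<Rightarrow> complex mat set \<Rightarrow> bool" where
  "equiv_to_standard br d \<phi> L \<longleftrightarrow>
     (\<exists>\<psi> P. lie_iso_onto br \<psi> L \<and> P \<in> carrier_mat d d \<and> invertible_mat P \<and>
            (\<forall>x. \<phi> x * P = P * \<psi> x))"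

end

theory Submission
  imports Defs "HOL-Computational_Algebra.Fundamental_Theorem_Algebra" "Jordan_Normal_Form.Determinant"
begin

text \<open>The proof avoids the classification of simple Lie algebras.

  Unitarity: minimise \<open>\<Sum>\<bar>g \<phi>(e\<^sub>b) g\<^sup>-\<^sup>1\<bar>\<^sup>2\<close> over \<open>g\<close>, for a Killing-orthonormal basis \<open>e\<^sub>b\<close>. A limit of a
  minimising sequence has vanishing moment map, which forces it to be skew-Hermitian, and it is
  equivalent to \<open>\<phi>\<close> because \<open>\<phi>\<close> is irreducible.

  Let \<open>A\<^sub>k\<close> be an orthonormal basis of the image for the trace form and \<open>\<pi>\<close> the orthogonal projection of
  \<open>gl(V)\<close> onto its complex span. By Schur's lemma \<open>\<Sum>A\<^sub>k \<otimes> A\<^sub>k\<close> is a scalar \<open>- \<kappa>\<close> on \<open>Sym\<^sup>2 V\<close>, that is,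
  \<open>\<pi>(u w\<^sup>*) x + \<pi>(x w\<^sup>*) u = \<kappa> (\<langle>w, x\<rangle> u + \<langle>w, u\<rangle> x)\<close>. So every line of \<open>V\<close> behaves like a highest weight line:
  for a unit vector \<open>v\<close>, \<open>Q(v) = \<pi>(v v\<^sup>*)\<close> has \<open>v\<close> as a simple eigenvector of eigenvalue \<open>\<kappa>\<close>, and each
  orthogonal eigenvector \<open>y\<close>, of eigenvalue \<open>\<kappa> - \<delta>\<close>, spans with \<open>v\<close> a doublet of an \<open>sl\<^sub>2\<close> whose semisimple
  element is \<open>(Q(v) - Q(y)) / \<delta>\<close>. Integrality of the eigenvalues of these elements, together with the
  idempotence of the Gram matrix of commuting \<open>Q(v\<^sub>i)\<close> for an orthonormal basis \<open>v\<^sub>i\<close>, leaves two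
  cases: all \<open>\<delta>\<^sub>i\<^sub>j = 1\<close>, where \<open>\<pi>\<close> is the identity on traceless matrices, or the basis is paired with
  \<open>\<delta> = 1\<close> on pairs and \<open>1/2\<close> elsewhere, where the zero weight space of \<open>V \<otimes> V\<close> contains an invariant
  symplectic form and \<open>\<pi>\<close> is the projection onto its Lie algebra.\<close>

text \<open>Schur's lemma on Sym^2 V fixes \<open>\<Sum>A\<^sub>k \<otimes> A\<^sub>k\<close> only
  on the symmetric half of V \<otimes> V; the exterior square may be reducible, and nothing is known
  there. This is the obstacle: the identity for \<pi> is symmetrised in u and x, and the missing
  half is recovered from numbers (norms, traces, integrality) rather than from a second
  irreducibility. In the first case the operator is 1/d minus the flip, so \<kappa> = 1 - 1/d; in
  the second it is -1/2 times the flip plus a term supported on the zero weight space, so \<kappa> =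
  1/2. For d = 2 both cases hold, reflecting su(2) = sp(1). No Cartan subalgebra is chosen in
  advance: the span of the commuting Q(v_i) takes its place and is grown one basis vector at a time.
  Two invariant forms share the work: the Killing form supplies the Casimir identities behind
  unitarity, the trace form on V makes \<pi> an orthogonal projection.\<close>

section \<open>Finitely supported matrices\<close>

text \<open>Infinite matrices of finite support form a single ring type containing \<open>gl(d)\<close> for every \<open>d\<close>.\<close>

typedef fmat = "{f :: nat \<Rightarrow> nat \<Rightarrow> complex. \<exists>N. \<forall>i j. f i j \<noteq> 0 \<longrightarrow> i < N \<and> j < N}"
  morphisms ent Fmat
  by (rule exI[of _ "\<lambda>_ _. 0"]) simp

setup_lifting type_definition_fmat

lemma fmat_eqI: "(\<And>i j. ent A i j = ent B i j) \<Longrightarrow> A = B"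
  by (metis ent_inject ext)

definition gl :: "nat \<Rightarrow> fmat set" where
  "gl N = {A. \<forall>i j. ent A i j \<noteq> 0 \<longrightarrow> i < N \<and> j < N}"

lemma ex_gl: "\<exists>N. A \<in> gl N"
  using ent[of A] by (simp add: gl_def)

lemma gl_mono: "A \<in> gl N \<Longrightarrow> N \<le> M \<Longrightarrow> A \<in> gl M"
  by (auto simp: gl_def intro: less_le_trans)

lemma gl_ent: "A \<in> gl N \<Longrightarrow> N \<le> i \<or> N \<le> j \<Longrightarrow> ent A i j = 0"
  by (auto simp: gl_def not_less[symmetric])

lemma ex_gl3: "\<exists>N. A \<in> gl N \<and> B \<in> gl N \<and> C \<in> gl N"
proof -
  obtain a b c where "A \<in> gl a" "B \<in> gl b" "C \<in> gl c" using ex_gl by metis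
  then show ?thesis by (intro exI[of _ "a + b + c"]) (auto intro: gl_mono)
qed

instantiation fmat :: ab_group_add
begin

lift_definition zero_fmat :: fmat is "\<lambda>_ _. 0" by simp

lift_definition plus_fmat :: "fmat \<Rightarrow> fmat \<Rightarrow> fmat" is "\<lambda>A B i j. A i j + B i j"
proof -
  fix A B :: "nat \<Rightarrow> nat \<Rightarrow> complex"
  assume "\<exists>N. \<forall>i j. A i j \<noteq> 0 \<longrightarrow> i < N \<and> j < N" "\<exists>N. \<forall>i j. B i j \<noteq> 0 \<longrightarrow> i < N \<and> j < N"
  then obtain N M where "\<forall>i j. A i j \<noteq> 0 \<longrightarrow> i < N \<and> j < N" "\<forall>i j. B i j \<noteq> 0 \<longrightarrow> i < M \<and> j < M"
    by auto
  then have "A i j + B i j \<noteq> 0 \<Longrightarrow> i < N + M \<and> j < N + M" for i j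
    by (cases "A i j = 0") (auto simp: trans_less_add1 trans_less_add2)
  then show "\<exists>N. \<forall>i j. A i j + B i j \<noteq> 0 \<longrightarrow> i < N \<and> j < N" by blast
qed

lift_definition uminus_fmat :: "fmat \<Rightarrow> fmat" is "\<lambda>A i j. - A i j" by simp

definition minus_fmat :: "fmat \<Rightarrow> fmat \<Rightarrow> fmat" where "minus_fmat A B = A + - B"

instance
proof
  fix a b c :: fmat
  show "a + b + c = a + (b + c)" "a + b = b + a" "0 + a = a" "- a + a = 0"
    by (transfer, simp add: algebra_simps)+
  show "a - b = a + - b" by (rule minus_fmat_def)
qed

end

lemma ent_simps [simp]:
  "ent 0 i j = 0" "ent (A + B) i j = ent A i j + ent B i j" "ent (- A) i j = - ent A i j"
  "ent (A - B) i j = ent A i j - ent B i j"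
  unfolding minus_fmat_def by (transfer, simp)+

lemma ent_sum [simp]: "ent (sum f S) i j = (\<Sum>s\<in>S. ent (f s) i j)"
  by (induction S rule: infinite_finite_induct) auto

text \<open>Row \<open>i\<close> of \<open>A\<close> has finite support, so summing over that
  support defines the product without choosing a matrix size.\<close>

lift_definition mmul :: "fmat \<Rightarrow> fmat \<Rightarrow> fmat" is
  "\<lambda>A B i j. \<Sum>k | A i k \<noteq> 0. A i k * B k j"
proof -
  fix A B :: "nat \<Rightarrow> nat \<Rightarrow> complex"
  assume "\<exists>N. \<forall>i j. A i j \<noteq> 0 \<longrightarrow> i < N \<and> j < N" "\<exists>N. \<forall>i j. B i j \<noteq> 0 \<longrightarrow> i < N \<and> j < N"
  then obtain N M where *: "\<forall>i j. A i j \<noteq> 0 \<longrightarrow> i < N \<and> j < N" "\<forall>i j. B i j \<noteq> 0 \<longrightarrow> i < M \<and> j < M"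
    by auto
  have "i < N + M \<and> j < N + M" if nz: "(\<Sum>k | A i k \<noteq> 0. A i k * B k j) \<noteq> 0" for i j
  proof -
    obtain k where "A i k * B k j \<noteq> 0" using sum.not_neutral_contains_not_neutral[OF nz] by blast
    then have "A i k \<noteq> 0" "B k j \<noteq> 0" by auto
    then show ?thesis using *(1)[rule_format, of i k] *(2)[rule_format, of k j] by simp
  qed
  then show "\<exists>N. \<forall>i j. (\<Sum>k | A i k \<noteq> 0. A i k * B k j) \<noteq> 0 \<longrightarrow> i < N \<and> j < N" by blast
qed

lemma ent_mmul:
  assumes "A \<in> gl N \<or> B \<in> gl N"
  shows "ent (mmul A B) i j = (\<Sum>k<N. ent A i k * ent B k j)"
proof -
  obtain M where M: "A \<in> gl M" using ex_gl by blast
  have fin: "finite {k. ent A i k \<noteq> 0}"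
    using M unfolding gl_def by (auto intro: finite_subset[of _ "{..<M}"])
  have "ent (mmul A B) i j = (\<Sum>k | ent A i k \<noteq> 0. ent A i k * ent B k j)"
    by transfer simp
  also have "\<dots> = (\<Sum>k\<in>{..<N} \<union> {k. ent A i k \<noteq> 0}. ent A i k * ent B k j)"
    using fin by (intro sum.mono_neutral_left) auto
  also have "\<dots> = (\<Sum>k<N. ent A i k * ent B k j)"
    using fin assms by (intro sum.mono_neutral_right) (auto simp: gl_ent)
  finally show ?thesis .
qed

instantiation fmat :: ring
begin

definition times_fmat :: "fmat \<Rightarrow> fmat \<Rightarrow> fmat" where "times_fmat = mmul"

instance
proof
  fix A B C :: fmat
  obtain N where N: "A \<in> gl N" "B \<in> gl N" "C \<in> gl N" using ex_gl3 by blast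
  note m = ent_mmul[of _ N]
  show "A * B * C = A * (B * C)"
  proof (rule fmat_eqI)
    fix i j
    have "ent (A * B * C) i j = (\<Sum>k<N. \<Sum>l<N. ent A i l * ent B l k * ent C k j)"
      using N by (simp add: times_fmat_def m sum_distrib_right)
    also have "\<dots> = (\<Sum>l<N. \<Sum>k<N. ent A i l * ent B l k * ent C k j)"
      by (rule sum.swap)
    also have "\<dots> = ent (A * (B * C)) i j"
      using N by (simp add: times_fmat_def m sum_distrib_left mult.assoc)
    finally show "ent (A * B * C) i j = ent (A * (B * C)) i j" .
  qed
  show "(A + B) * C = A * C + B * C" "A * (B + C) = A * B + A * C"
    using N by (auto intro!: fmat_eqI simp: times_fmat_def m algebra_simps sum.distrib)
qed

end

lemma ent_mult: "A \<in> gl N \<or> B \<in> gl N \<Longrightarrow> ent (A * B) i j = (\<Sum>k<N. ent A i k * ent B k j)"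
  by (simp add: times_fmat_def ent_mmul)

section \<open>Scalar multiples, adjoints, transposes and matrix units\<close>

lift_definition cs :: "complex \<Rightarrow> fmat \<Rightarrow> fmat" is "\<lambda>c A i j. c * A i j" by auto

lift_definition adj :: "fmat \<Rightarrow> fmat" is "\<lambda>A i j. cnj (A j i)" by auto

lift_definition tp :: "fmat \<Rightarrow> fmat" is "\<lambda>A i j. A j i" by auto

lift_definition unit_mat :: "nat \<Rightarrow> nat \<Rightarrow> fmat" is "\<lambda>k l i j. if i = k \<and> j = l then 1 else 0"
proof -
  fix k l :: nat
  show "\<exists>N. \<forall>i j. (if i = k \<and> j = l then 1 else (0::complex)) \<noteq> 0 \<longrightarrow> i < N \<and> j < N"
    by (intro exI[of _ "Suc (k + l)"]) auto
qed

text \<open>The ring has no unit, as an identity matrix of all sizes would have infinite support;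
  \<open>Idm d\<close> is the unit of the corner \<open>gl d\<close> only.\<close>

lift_definition Idm :: "nat \<Rightarrow> fmat" is "\<lambda>d i j. if i = j \<and> i < d then 1 else 0" by auto

lemma ent_more [simp]:
  "ent (cs c A) i j = c * ent A i j" "ent (adj A) i j = cnj (ent A j i)" "ent (tp A) i j = ent A j i"
  "ent (unit_mat k l) i j = (if i = k \<and> j = l then 1 else 0)"
  "ent (Idm d) i j = (if i = j \<and> i < d then 1 else 0)"
  by (transfer, simp)+

lemma cs_simps [simp]:
  "cs c (A + B) = cs c A + cs c B" "cs c (A - B) = cs c A - cs c B" "cs c (- A) = - cs c A"
  "cs c (cs e A) = cs (c * e) A" "cs 0 A = 0" "cs 1 A = A" "cs c 0 = 0"
  "cs (- c) A = - cs c A"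
  by (auto intro!: fmat_eqI simp: algebra_simps)

lemma cs_add: "cs (c + e) A = cs c A + cs e A"
  and cs_diff: "cs (c - e) A = cs c A - cs e A"
  by (auto intro!: fmat_eqI simp: algebra_simps)

lemma cs_eq_0_iff [simp]: "cs c A = 0 \<longleftrightarrow> c = 0 \<or> A = 0"
proof
  assume "cs c A = 0"
  then have "\<And>i j. c * ent A i j = 0" by (metis ent_more(1) ent_simps(1))
  then show "c = 0 \<or> A = 0" by (auto intro: fmat_eqI)
qed auto

lemma cs_sum: "cs c (sum f S) = (\<Sum>s\<in>S. cs c (f s))"
  by (auto intro!: fmat_eqI simp: sum_distrib_left)

lemma cs_sum_left: "cs (sum f S) A = (\<Sum>s\<in>S. cs (f s) A)"
  by (auto intro!: fmat_eqI simp: sum_distrib_right)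

lemma mult_cs [simp]: "cs c A * B = cs c (A * B)" "A * cs c B = cs c (A * B)"
proof -
  obtain N where N: "A \<in> gl N" "B \<in> gl N" using ex_gl3 by blast
  moreover have "cs c A \<in> gl N" "cs c B \<in> gl N" using N by (auto simp: gl_def)
  ultimately show "cs c A * B = cs c (A * B)" "A * cs c B = cs c (A * B)"
    by (auto intro!: fmat_eqI simp: ent_mult[of _ N] sum_distrib_left algebra_simps)
qed

lemma adj_simps [simp]:
  "adj (A + B) = adj A + adj B" "adj (A - B) = adj A - adj B" "adj (- A) = - adj A"
  "adj (cs c A) = cs (cnj c) (adj A)" "adj (adj A) = A" "adj 0 = 0"
  by (auto intro!: fmat_eqI)

lemma tp_simps [simp]:
  "tp (A + B) = tp A + tp B" "tp (A - B) = tp A - tp B" "tp (- A) = - tp A"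
  "tp (cs c A) = cs c (tp A)" "tp (tp A) = A" "tp 0 = 0" "tp (adj A) = adj (tp A)"
  by (auto intro!: fmat_eqI)

lemma adj_sum: "adj (sum f S) = (\<Sum>s\<in>S. adj (f s))"
  and tp_sum: "tp (sum f S) = (\<Sum>s\<in>S. tp (f s))"
  by (auto intro!: fmat_eqI)

lemma gl_adj_iff [simp]: "adj A \<in> gl N \<longleftrightarrow> A \<in> gl N"
  and gl_tp_iff [simp]: "tp A \<in> gl N \<longleftrightarrow> A \<in> gl N"
  by (auto simp: gl_def)

lemma adj_mult [simp]: "adj (A * B) = adj B * adj A"
  and tp_mult [simp]: "tp (A * B) = tp B * tp A"
proof -
  obtain N where N: "A \<in> gl N" "B \<in> gl N" using ex_gl3 by blast
  then show "adj (A * B) = adj B * adj A" "tp (A * B) = tp B * tp A"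
    by (auto intro!: fmat_eqI simp: ent_mult[of _ N] algebra_simps)
qed

lemma gl_closed [simp]:
  "0 \<in> gl N" "A \<in> gl N \<Longrightarrow> B \<in> gl N \<Longrightarrow> A + B \<in> gl N" "A \<in> gl N \<Longrightarrow> B \<in> gl N \<Longrightarrow> A - B \<in> gl N"
  "A \<in> gl N \<Longrightarrow> - A \<in> gl N" "A \<in> gl N \<Longrightarrow> cs c A \<in> gl N" "Idm N \<in> gl N"
  "A \<in> gl N \<Longrightarrow> B \<in> gl N \<Longrightarrow> A * B \<in> gl N"
proof -
  show "A * B \<in> gl N" if "A \<in> gl N" "B \<in> gl N"
  proof -
    have "i < N \<and> j < N" if nz: "ent (A * B) i j \<noteq> 0" for i j
    proof -
      obtain k where "ent A i k * ent B k j \<noteq> 0"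
        using sum.not_neutral_contains_not_neutral[OF nz[unfolded ent_mult[OF disjI1[OF \<open>A \<in> gl N\<close>]]]]
        by blast
      then show ?thesis using \<open>A \<in> gl N\<close> \<open>B \<in> gl N\<close> by (auto simp: gl_def)
    qed
    then show ?thesis by (auto simp: gl_def)
  qed
qed (auto simp: gl_def, (metis add.right_neutral diff_zero add_0 minus_zero diff_0)+)

lemma gl_sum: "(\<And>s. s \<in> S \<Longrightarrow> f s \<in> gl N) \<Longrightarrow> sum f S \<in> gl N"
  by (induction S rule: infinite_finite_induct) auto

lemma Idm_mult [simp]: "A \<in> gl d \<Longrightarrow> Idm d * A = A" "A \<in> gl d \<Longrightarrow> A * Idm d = A"
proof -
  assume A: "A \<in> gl d"
  show "Idm d * A = A"
  proof (rule fmat_eqI)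
    fix i j
    have "ent (Idm d * A) i j = (\<Sum>k<d. if i = k then ent A k j else 0)"
      unfolding ent_mult[OF disjI2[OF A]] by (rule sum.cong) auto
    then show "ent (Idm d * A) i j = ent A i j" using A gl_ent[of A d i j] by (simp add: not_less)
  qed
  show "A * Idm d = A"
  proof (rule fmat_eqI)
    fix i j
    have "ent (A * Idm d) i j = (\<Sum>k<d. if k = j then ent A i k else 0)"
      unfolding ent_mult[OF disjI1[OF A]] by (rule sum.cong) auto
    then show "ent (A * Idm d) i j = ent A i j" using A gl_ent[of A d i j] by (simp add: not_less)
  qed
qed

lemma adj_Idm [simp]: "adj (Idm d) = Idm d" and tp_Idm [simp]: "tp (Idm d) = Idm d"
  by (auto intro!: fmat_eqI)

section \<open>Trace and Hilbert-Schmidt product\<close>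

definition tr :: "fmat \<Rightarrow> complex" where "tr A = (\<Sum>i | ent A i i \<noteq> 0. ent A i i)"

lemma tr_gl: "A \<in> gl N \<Longrightarrow> tr A = (\<Sum>i<N. ent A i i)"
  unfolding tr_def by (rule sum.mono_neutral_left) (auto simp: gl_def)

lemma tr_simps [simp]:
  "tr (A + B) = tr A + tr B" "tr (A - B) = tr A - tr B" "tr (- A) = - tr A"
  "tr (cs c A) = c * tr A" "tr (adj A) = cnj (tr A)" "tr (tp A) = tr A" "tr 0 = 0"
  "tr (Idm d) = of_nat d"
proof -
  obtain N where N: "A \<in> gl N" "B \<in> gl N" using ex_gl3 by blast
  show "tr (A + B) = tr A + tr B" "tr (A - B) = tr A - tr B" "tr (- A) = - tr A"
    "tr (cs c A) = c * tr A" "tr (adj A) = cnj (tr A)" "tr (tp A) = tr A"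
    using N by (simp_all add: tr_gl[of _ N] sum.distrib sum_subtractf sum_negf sum_distrib_left)
  show "tr 0 = 0" by (simp add: tr_gl[of _ 0])
  show "tr (Idm d) = of_nat d" by (simp add: tr_gl[of _ d])
qed

lemma tr_sum: "tr (sum f S) = (\<Sum>s\<in>S. tr (f s))"
  by (induction S rule: infinite_finite_induct) auto

lemma tr_comm: "tr (A * B) = tr (B * A)"
proof -
  obtain N where N: "A \<in> gl N" "B \<in> gl N" using ex_gl3 by blast
  have "tr (A * B) = (\<Sum>i<N. \<Sum>k<N. ent A i k * ent B k i)"
    using N by (simp add: tr_gl[of _ N] ent_mult[of _ N])
  also have "\<dots> = (\<Sum>k<N. \<Sum>i<N. ent A i k * ent B k i)" by (rule sum.swap)
  also have "\<dots> = tr (B * A)"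
    using N by (simp add: tr_gl[of _ N] ent_mult[of _ N] mult.commute)
  finally show ?thesis .
qed

text \<open>The Hilbert-Schmidt product, conjugate linear in its first argument; on column vectors
  it is the standard Hermitian product.\<close>

definition ip :: "fmat \<Rightarrow> fmat \<Rightarrow> complex" where "ip X Y = tr (adj X * Y)"

lemma ip_gl: "X \<in> gl N \<Longrightarrow> Y \<in> gl N \<Longrightarrow> ip X Y = (\<Sum>i<N. \<Sum>j<N. cnj (ent X j i) * ent Y j i)"
  by (simp add: ip_def tr_gl[of _ N] ent_mult[of _ N])

lemma ip_simps [simp]:
  "ip (X + Y) Z = ip X Z + ip Y Z" "ip X (Y + Z) = ip X Y + ip X Z"
  "ip (X - Y) Z = ip X Z - ip Y Z" "ip X (Y - Z) = ip X Y - ip X Z"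
  "ip (- X) Z = - ip X Z" "ip X (- Z) = - ip X Z" "ip 0 Z = 0" "ip X 0 = 0"
  "ip (cs c X) Z = cnj c * ip X Z" "ip X (cs c Z) = c * ip X Z"
  by (simp_all add: ip_def algebra_simps)

lemma ip_sum: "ip (sum f S) Z = (\<Sum>s\<in>S. ip (f s) Z)" "ip X (sum f S) = (\<Sum>s\<in>S. ip X (f s))"
  by (simp_all add: ip_def adj_sum sum_distrib_left sum_distrib_right tr_sum)

lemma ip_cnj: "cnj (ip X Y) = ip Y X"
proof -
  have "cnj (tr (adj X * Y)) = tr (adj (adj X * Y))" by (rule tr_simps(5)[symmetric])
  then show ?thesis by (simp add: ip_def)
qed

lemma ip_mult_left: "ip (A * X) Y = ip X (adj A * Y)"
  by (simp add: ip_def mult.assoc)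

lemma ip_mult_right: "ip (X * A) Y = ip X (Y * adj A)"
proof -
  have "ip (X * A) Y = tr (adj A * (adj X * Y))" by (simp add: ip_def mult.assoc)
  also have "\<dots> = tr (adj X * Y * adj A)" by (rule tr_comm)
  finally show ?thesis by (simp add: ip_def mult.assoc)
qed

lemma ip_adj: "ip (adj X) (adj Y) = ip Y X"
  by (simp add: ip_def tr_comm)

lemma ip_self_gl:
  assumes "X \<in> gl N" shows "ip X X = of_real (\<Sum>i<N. \<Sum>j<N. (cmod (ent X j i))\<^sup>2)"
  using assms by (simp add: ip_gl[of _ N] complex_norm_square mult.commute del: of_real_power)

definition nsq :: "fmat \<Rightarrow> real" where "nsq X = Re (ip X X)"

lemma nsq_gl: "X \<in> gl N \<Longrightarrow> nsq X = (\<Sum>i<N. \<Sum>j<N. (cmod (ent X j i))\<^sup>2)"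
  by (simp add: nsq_def ip_self_gl del: of_real_sum)

lemma ip_self: "ip X X = of_real (nsq X)"
  using ex_gl[of X] by (auto simp: nsq_def ip_self_gl simp del: of_real_sum)

lemma nsq_nonneg [simp]: "0 \<le> nsq X"
  using ex_gl[of X] by (auto simp: nsq_gl intro!: sum_nonneg)

lemma nsq_eq_0_iff [simp]: "nsq X = 0 \<longleftrightarrow> X = 0"
proof
  assume z: "nsq X = 0"
  obtain N where N: "X \<in> gl N" using ex_gl by blast
  then have "(\<Sum>i<N. \<Sum>j<N. (cmod (ent X j i))\<^sup>2) = 0" using z by (simp add: nsq_gl)
  then have "\<forall>i<N. \<forall>j<N. ent X j i = 0"
    by (subst (asm) sum_nonneg_eq_0_iff) (auto intro!: sum_nonneg simp: sum_nonneg_eq_0_iff)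
  then show "X = 0" using N by (intro fmat_eqI) (metis ent_simps(1) gl_ent not_le)
qed (simp add: nsq_def)

lemma ip_self_eq_0_iff [simp]: "ip X X = 0 \<longleftrightarrow> X = 0"
  by (simp add: ip_self)

lemma ip_eqI: "(\<And>Y. ip Y A = ip Y B) \<Longrightarrow> A = B"
proof -
  assume "\<And>Y. ip Y A = ip Y B"
  then have "ip (A - B) (A - B) = 0" by simp
  then show ?thesis unfolding ip_self_eq_0_iff by simp
qed

lemma nsq_cs: "nsq (cs c X) = (cmod c)\<^sup>2 * nsq X"
proof -
  have "ip (cs c X) (cs c X) = of_real ((cmod c)\<^sup>2) * ip X X"
    by (simp add: complex_norm_square mult_ac del: of_real_power)
  then have "complex_of_real (nsq (cs c X)) = of_real ((cmod c)\<^sup>2 * nsq X)"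
    unfolding ip_self by simp
  then show ?thesis using of_real_eq_iff by blast
qed

definition comm :: "fmat \<Rightarrow> fmat \<Rightarrow> fmat" where "comm A B = A * B - B * A"

lemma comm_simps [simp]:
  "comm (A + B) C = comm A C + comm B C" "comm C (A + B) = comm C A + comm C B"
  "comm (A - B) C = comm A C - comm B C" "comm C (A - B) = comm C A - comm C B"
  "comm (- B) C = - comm B C" "comm C (- B) = - comm C B"
  "comm (cs c B) C = cs c (comm B C)" "comm C (cs c B) = cs c (comm C B)"
  "comm 0 C = 0" "comm C 0 = 0" "comm C C = 0"
  by (simp_all add: comm_def algebra_simps)

lemma comm_sum: "comm (sum f S) C = (\<Sum>s\<in>S. comm (f s) C)" "comm C (sum f S) = (\<Sum>s\<in>S. comm C (f s))"
  by (simp_all add: comm_def sum_distrib_left sum_distrib_right sum_subtractf)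

lemma comm_swap: "comm A B = - comm B A"
  by (simp add: comm_def)

lemma adj_comm: "adj (comm A B) = comm (adj B) (adj A)"
  by (simp add: comm_def)

lemma tr_comm_0 [simp]: "tr (comm A B) = 0"
  by (simp add: comm_def tr_comm)

lemma ip_comm: "ip (comm A X) Y = ip X (comm (adj A) Y)"
  by (simp add: comm_def ip_mult_left[of A X Y] ip_mult_right[of X A Y])

lemma gl_comm [simp]: "A \<in> gl N \<Longrightarrow> B \<in> gl N \<Longrightarrow> comm A B \<in> gl N"
  by (simp add: comm_def)

text \<open>Vectors are encoded as matrices supported in column 0.\<close>

definition vecs :: "nat \<Rightarrow> fmat set" where
  "vecs d = {x. \<forall>i j. ent x i j \<noteq> 0 \<longrightarrow> i < d \<and> j = 0}"

lemma vecs_closed [simp]: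
  "0 \<in> vecs d" "x \<in> vecs d \<Longrightarrow> y \<in> vecs d \<Longrightarrow> x + y \<in> vecs d"
  "x \<in> vecs d \<Longrightarrow> y \<in> vecs d \<Longrightarrow> x - y \<in> vecs d" "x \<in> vecs d \<Longrightarrow> - x \<in> vecs d"
  "x \<in> vecs d \<Longrightarrow> cs c x \<in> vecs d"
  by (auto simp: vecs_def, (metis add.right_neutral diff_zero add_0 minus_zero diff_0)+)

lemma vecs_sum: "(\<And>s. s \<in> S \<Longrightarrow> f s \<in> vecs d) \<Longrightarrow> sum f S \<in> vecs d"
  by (induction S rule: infinite_finite_induct) auto

lemma vecs_gl: "x \<in> vecs d \<Longrightarrow> x \<in> gl d"
  by (auto simp: vecs_def gl_def)

lemma vecs_mult [simp]: "A \<in> gl d \<Longrightarrow> x \<in> vecs d \<Longrightarrow> A * x \<in> vecs d"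
proof -
  assume A: "A \<in> gl d" and x: "x \<in> vecs d"
  have "i < d \<and> j = 0" if nz: "ent (A * x) i j \<noteq> 0" for i j
  proof -
    obtain k where "ent A i k * ent x k j \<noteq> 0"
      using sum.not_neutral_contains_not_neutral[OF nz[unfolded ent_mult[OF disjI1[OF A]]]] by blast
    then show ?thesis using A x by (auto simp: gl_def vecs_def)
  qed
  then show ?thesis by (auto simp: vecs_def)
qed

lemma vecs_unit_iff: "unit_mat i 0 \<in> vecs d \<longleftrightarrow> i < d"
  by (auto simp: vecs_def)

text \<open>A row times a column is a matrix with a single entry; \<open>unit_mat 0 0\<close> stands
  for the scalar 1 and acts as such on the right of a vector (\<open>vec_unit\<close>).\<close>

lemma vec_dot:
  assumes "x \<in> vecs d" "w \<in> vecs d"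
  shows "adj w * x = cs (ip w x) (unit_mat 0 0)"
proof (rule fmat_eqI)
  fix i j
  have g: "x \<in> gl d" "w \<in> gl d" using assms by (auto intro: vecs_gl)
  have e: "ent (adj w * x) i j = (if i = 0 \<and> j = 0 then ent (adj w * x) 0 0 else 0)" for i j
  proof -
    have "ent w k i = 0" if "i \<noteq> 0" for k using assms(2) that unfolding vecs_def by blast
    moreover have "ent x k j = 0" if "j \<noteq> 0" for k using assms(1) that unfolding vecs_def by blast
    ultimately show ?thesis using g by (simp add: ent_mult[of _ d])
  qed
  have "ip w x = (\<Sum>i<d. if i = 0 then ent (adj w * x) 0 0 else 0)"
    unfolding ip_def using g by (subst tr_gl[of _ d]) (auto simp: e intro!: sum.cong)
  also have "\<dots> = (if 0 < d then ent (adj w * x) 0 0 else 0)"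
    by simp
  also have "\<dots> = ent (adj w * x) 0 0"
    using g by (auto simp: ent_mult[of _ d])
  finally show "ent (adj w * x) i j = ent (cs (ip w x) (unit_mat 0 0)) i j"
    by (subst e) simp
qed

lemma vec_unit [simp]:
  assumes "x \<in> vecs d" shows "x * unit_mat 0 0 = x"
proof (rule fmat_eqI)
  fix i j
  have "x \<in> gl (Suc d)" using assms by (auto intro: vecs_gl gl_mono)
  then have "ent (x * unit_mat 0 0) i j = (\<Sum>k<Suc d. if k = 0 then (if j = 0 then ent x i 0 else 0) else 0)"
    unfolding ent_mult[OF disjI1[OF \<open>x \<in> gl (Suc d)\<close>]] by (intro sum.cong) auto
  also have "\<dots> = (if j = 0 then ent x i 0 else 0)" by (subst sum.delta) auto
  also have "\<dots> = ent x i j" using assms by (auto simp: vecs_def)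
  finally show "ent (x * unit_mat 0 0) i j = ent x i j" .
qed

lemma outer_app:
  assumes "x \<in> vecs d" "w \<in> vecs d" "u \<in> vecs d"
  shows "u * adj w * x = cs (ip w x) u"
  using assms by (simp add: mult.assoc vec_dot[of x d])

lemma ip_outer:
  assumes "u \<in> vecs d" "w \<in> vecs d" "x \<in> vecs d" "y \<in> vecs d"
  shows "ip (u * adj w) (x * adj y) = ip u x * ip y w"
proof -
  have "ip (u * adj w) (x * adj y) = ip u (x * adj y * w)"
    by (simp add: ip_mult_right)
  then show ?thesis using assms by (simp add: outer_app)
qed

lemma ip_outer_left:
  shows "ip (u * adj w) A = ip u (A * w)" "ip A (u * adj w) = ip (A * w) u"
proof -
  show "ip (u * adj w) A = ip u (A * w)" by (simp add: ip_mult_right)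
  then show "ip A (u * adj w) = ip (A * w) u" by (metis ip_cnj)
qed

lemma tr_outer: "tr (u * adj w) = ip w u"
  by (simp add: ip_def tr_comm)

lemma vec_expand: "x \<in> vecs d \<Longrightarrow> x = (\<Sum>i<d. cs (ent x i 0) (unit_mat i 0))"
proof (rule fmat_eqI)
  fix i j assume x: "x \<in> vecs d"
  have "ent (\<Sum>i<d. cs (ent x i 0) (unit_mat i 0)) i j = (\<Sum>k<d. if k = i then (if j = 0 then ent x k 0 else 0) else 0)"
    unfolding ent_sum by (intro sum.cong) auto
  also have "\<dots> = ent x i j" using x by (auto simp: vecs_def)
  finally show "ent x i j = ent (\<Sum>i<d. cs (ent x i 0) (unit_mat i 0)) i j" ..
qed

lemma gl_eqI:
  assumes "A \<in> gl d" "B \<in> gl d" "\<And>x. x \<in> vecs d \<Longrightarrow> A * x = B * x"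
  shows "A = B"
proof (rule fmat_eqI)
  fix i j
  have e: "ent (C * unit_mat j 0) i 0 = ent C i j" if "C \<in> gl d" "j < d" for C
  proof -
    have "ent (C * unit_mat j 0) i 0 = (\<Sum>k<d. if k = j then ent C i k else 0)"
      unfolding ent_mult[OF disjI1[OF that(1)]] by (intro sum.cong) auto
    then show ?thesis using that by simp
  qed
  show "ent A i j = ent B i j"
  proof (cases "j < d")
    case True
    then show ?thesis using assms(3)[of "unit_mat j 0"] e assms(1,2) by (metis vecs_unit_iff)
  qed (use assms gl_ent in \<open>simp add: not_less\<close>)
qed

section \<open>Eigenvectors and \<open>sl\<^sub>2\<close>-triples\<close>

interpretation fmat: vector_space cs
  by unfold_locales (auto simp: cs_add)

definition clinear_map :: "(fmat \<Rightarrow> fmat) \<Rightarrow> bool" where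
  "clinear_map f \<longleftrightarrow> (\<forall>x y. f (x + y) = f x + f y) \<and> (\<forall>c x. f (cs c x) = cs c (f x))"

definition csubspace :: "fmat set \<Rightarrow> bool" where
  "csubspace U \<longleftrightarrow> 0 \<in> U \<and> (\<forall>x\<in>U. \<forall>y\<in>U. x + y \<in> U) \<and> (\<forall>c. \<forall>x\<in>U. cs c x \<in> U)"

lemma clinear_mapD:
  assumes "clinear_map f"
  shows "f (x + y) = f x + f y" "f (cs c x) = cs c (f x)" "f 0 = 0" "f (- x) = - f x" "f (x - y) = f x - f y"
proof -
  show a: "f (x + y) = f x + f y" and s: "f (cs c x) = cs c (f x)" for x y c
    using assms by (auto simp: clinear_map_def)
  show "f 0 = 0" using s[of 0 0] by simp
  show n: "f (- x) = - f x" for x using s[of "-1" x] by simp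
  show "f (x - y) = f x - f y" using a[of x "- y"] n[of y] by simp
qed

lemma clinear_map_mult: "clinear_map ((*) A)"
  by (simp add: clinear_map_def algebra_simps)

text \<open>This is \<open>p(f)\<close> applied to \<open>u\<close>, computed by Horner's
  scheme.\<close>

definition peval :: "(fmat \<Rightarrow> fmat) \<Rightarrow> fmat \<Rightarrow> complex poly \<Rightarrow> fmat" where
  "peval f u p = fold_coeffs (\<lambda>a y. cs a u + f y) p 0"

lemma peval_0 [simp]: "peval f u 0 = 0"
  by (simp add: peval_def)

lemma peval_pCons: "f 0 = 0 \<Longrightarrow> peval f u (pCons a p) = cs a u + f (peval f u p)"
  \<comment> \<open>\<open>pCons 0 0\<close> collapses to 0, so the formula survives there because
    of \<open>f 0 = 0\<close>.\<close>
  by (cases "p = 0 \<and> a = 0") (auto simp: peval_def)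

context
  fixes f assumes f: "clinear_map f"
begin

lemma peval_add: "peval f u (p + q) = peval f u p + peval f u q"
proof (induction p q rule: poly_induct2)
  case (pCons a p b q)
  then show ?case
    by (simp add: peval_pCons clinear_mapD[OF f] cs_add)
qed simp

lemma peval_smult: "peval f u (Polynomial.smult c p) = cs c (peval f u p)"
proof (induction p)
  case (pCons a p)
  then show ?case by (simp add: peval_pCons clinear_mapD[OF f])
qed simp

lemma peval_monom: "peval f u (monom c n) = cs c ((f ^^ n) u)"
  by (induction n) (simp_all add: monom_0 monom_Suc peval_pCons clinear_mapD[OF f])

lemma peval_sum: "peval f u (sum g S) = (\<Sum>s\<in>S. peval f u (g s))"
  by (induction S rule: infinite_finite_induct) (auto simp: peval_add)

lemma peval_root: "peval f u ([:- l, 1:] * q) = f (peval f u q) - cs l (peval f u q)"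
proof -
  have "[:- l, 1:] * q = Polynomial.smult (- l) q + pCons 0 q" by simp
  then show ?thesis by (simp only: peval_add peval_smult) (simp add: peval_pCons clinear_mapD[OF f])
qed

lemma gl_span: "gl N \<subseteq> fmat.span ((\<lambda>(i, j). unit_mat i j) ` ({..<N} \<times> {..<N}))"
proof
  fix X assume X: "X \<in> gl N"
  have "X = (\<Sum>(i,j)\<in>{..<N} \<times> {..<N}. cs (ent X i j) (unit_mat i j))"
  proof (rule fmat_eqI)
    fix k l
    have "ent (\<Sum>(i,j)\<in>{..<N} \<times> {..<N}. cs (ent X i j) (unit_mat i j)) k l
        = (\<Sum>s\<in>{..<N} \<times> {..<N}. if s = (k, l) then ent X k l else 0)"
      unfolding ent_sum by (intro sum.cong) (auto split: if_split_asm)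
    also have "\<dots> = ent X k l" using X by (auto simp: gl_def)
    finally show "ent X k l = ent (\<Sum>(i,j)\<in>{..<N} \<times> {..<N}. cs (ent X i j) (unit_mat i j)) k l" ..
  qed
  also have "\<dots> \<in> fmat.span ((\<lambda>(i, j). unit_mat i j) ` ({..<N} \<times> {..<N}))"
    by (intro fmat.span_sum) (clarsimp, intro fmat.span_scale fmat.span_base, force)
  finally show "X \<in> fmat.span ((\<lambda>(i, j). unit_mat i j) ` ({..<N} \<times> {..<N}))" .
qed

text \<open>The iterates of \<open>u\<close> stay in a finite-dimensional space, so two of them
  coincide or they form an infinite, hence linearly dependent, set.\<close>

lemma ex_annihilator:
  assumes "\<And>n. (f ^^ n) u \<in> gl N"
  shows "\<exists>p. p \<noteq> 0 \<and> peval f u p = 0"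
proof (cases "inj (\<lambda>n. (f ^^ n) u)")
  case False
  then obtain i j where "i \<noteq> j" and e: "(f ^^ i) u = (f ^^ j) u" by (auto simp: inj_def)
  have "peval f u (monom 1 i + Polynomial.smult (-1) (monom 1 j)) = 0"
    unfolding peval_add peval_smult peval_monom e by simp
  moreover have "coeff (monom 1 i + Polynomial.smult (-1) (monom (1::complex) j)) i \<noteq> 0"
    using \<open>i \<noteq> j\<close> by simp
  ultimately show ?thesis by (metis coeff_0)
next
  case True
  let ?w = "\<lambda>n. (f ^^ n) u"
  let ?T = "(\<lambda>(i, j). unit_mat i j) ` ({..<N} \<times> {..<N})"
  have "infinite (range ?w)" using True by (simp add: finite_image_iff)
  moreover have "range ?w \<subseteq> fmat.span ?T" using assms gl_span by blast
  ultimately have "fmat.dependent (range ?w)"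
    using fmat.independent_span_bound[of ?T "range ?w"] by auto
  then obtain t c where t: "finite t" "t \<subseteq> range ?w" "(\<Sum>v\<in>t. cs (c v) v) = 0" "\<exists>v\<in>t. c v \<noteq> 0"
    unfolding fmat.dependent_explicit by blast
  define J where "J = ?w -` t"
  have J: "finite J" "?w ` J = t" "inj_on ?w J"
    using t True by (auto simp: J_def intro!: finite_vimageI intro: inj_on_subset)
  define p where "p = (\<Sum>i\<in>J. monom (c (?w i)) i)"
  have "peval f u p = (\<Sum>i\<in>J. cs (c (?w i)) (?w i))" by (simp add: p_def peval_sum peval_monom)
  also have "\<dots> = (\<Sum>v\<in>t. cs (c v) v)"
    unfolding J(2)[symmetric] by (subst sum.reindex[OF J(3)]) simp
  finally have "peval f u p = 0" using t by simp
  moreover have "p \<noteq> 0"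
  proof -
    obtain i where i: "i \<in> J" "c (?w i) \<noteq> 0" using t(4) J(2) by blast
    have "coeff p i = (\<Sum>j\<in>J. if j = i then c (?w i) else 0)"
      by (simp add: p_def coeff_sum) (auto intro!: sum.cong)
    then show ?thesis using i J(1) by auto
  qed
  ultimately show ?thesis by blast
qed

text \<open>Take an annihilating polynomial of least degree and split off a root \<open>l\<close>:
  by minimality the cofactor applied to \<open>u\<close> is nonzero, and \<open>f - l\<close> kills
  it. Working with a map on a subspace \<open>U\<close> covers operators on V \<otimes> V without
  choosing a basis there.\<close>

lemma ex_eigenvector:
  assumes U: "csubspace U" "U \<subseteq> gl N" "U \<noteq> {0}" and inv: "\<And>x. x \<in> U \<Longrightarrow> f x \<in> U"
  obtains x l where "x \<in> U" "x \<noteq> 0" "f x = cs l x"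
proof -
  obtain u where u: "u \<in> U" "u \<noteq> 0" using U by (auto simp: csubspace_def)
  have "(f ^^ n) u \<in> U" for n by (induction n) (auto simp: u inv)
  then have "\<exists>p. p \<noteq> 0 \<and> peval f u p = 0" using U by (intro ex_annihilator[of u N]) auto
  then obtain p0 where "p0 \<noteq> 0 \<and> peval f u p0 = 0" by blast
  from ex_has_least_nat[of "\<lambda>p. p \<noteq> 0 \<and> peval f u p = 0", OF this, of degree]
  obtain p where p: "p \<noteq> 0" "peval f u p = 0"
    and min: "\<And>q. q \<noteq> 0 \<Longrightarrow> peval f u q = 0 \<Longrightarrow> degree p \<le> degree q"
    by auto
  have pU: "peval f u q \<in> U" for q
    by (induction q) (use U u inv in \<open>auto simp: peval_pCons clinear_mapD[OF f] csubspace_def\<close>)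
  have "degree p \<noteq> 0"
  proof
    assume "degree p = 0"
    then obtain a where "p = [:a:]" by (metis degree_eq_zeroE)
    then show False using p u by (simp add: peval_pCons clinear_mapD[OF f])
  qed
  then have "\<not> constant (poly p)" by (simp add: constant_degree)
  then obtain l where "poly p l = 0" using fundamental_theorem_of_algebra by blast
  then obtain q where q: "p = [:- l, 1:] * q" by (metis dvdE poly_eq_0_iff_dvd)
  have "q \<noteq> 0" using p q by auto
  then have "degree q < degree p" unfolding q by (subst degree_mult_eq) auto
  then have "peval f u q \<noteq> 0" using min[of q] \<open>q \<noteq> 0\<close> by auto
  moreover have "f (peval f u q) = cs l (peval f u q)"
    using p(2) unfolding q peval_root by simp
  ultimately show ?thesis using that pU by blast
qed

end

text \<open>Compare both sides of the eigenvalue equation at an entry of largest modulus in a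
  nonzero column of \<open>x\<close>. The bound does not depend on \<open>x\<close>, which is what
  stops the ladders below.\<close>

lemma eigenvalue_bound:
  assumes "x \<in> gl N" "h \<in> gl N" "x \<noteq> 0" "h * x = cs l x"
  shows "cmod l \<le> (\<Sum>i<N. \<Sum>k<N. cmod (ent h i k))"
proof -
  have "\<exists>i<N. \<exists>j<N. ent x i j \<noteq> 0"
  proof (rule ccontr)
    assume "\<not> ?thesis"
    then have "x = 0" using assms(1) by (intro fmat_eqI) (metis ent_simps(1) gl_ent not_le)
    then show False using assms by simp
  qed
  then obtain j where j: "j < N" "\<exists>i<N. ent x i j \<noteq> 0" by blast
  define S where "S = (\<lambda>k. cmod (ent x k j)) ` {..<N}"
  have S: "finite S" "S \<noteq> {}" using j by (auto simp: S_def)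
  then have "Max S \<in> S" by (rule Max_in)
  then obtain i where i0: "i < N" "Max S = cmod (ent x i j)" by (auto simp: S_def)
  have "cmod (ent x k j) \<le> cmod (ent x i j)" if "k < N" for k
    unfolding i0(2)[symmetric] using S that by (intro Max_ge) (auto simp: S_def)
  with i0 obtain i where i: "i < N" and mx: "\<And>k. k < N \<Longrightarrow> cmod (ent x k j) \<le> cmod (ent x i j)"
    by blast
  obtain k where "k < N" "ent x k j \<noteq> 0" using j by blast
  then have pos: "cmod (ent x i j) > 0" using mx[of k] by (auto simp flip: zero_less_norm_iff)
  have "l * ent x i j = (\<Sum>k<N. ent h i k * ent x k j)"
    using assms by (metis ent_more(1) ent_mult)
  then have "cmod l * cmod (ent x i j) = cmod (\<Sum>k<N. ent h i k * ent x k j)"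
    by (metis norm_mult)
  also have "\<dots> \<le> (\<Sum>k<N. cmod (ent h i k) * cmod (ent x i j))"
    by (intro sum_norm_le) (auto simp: norm_mult intro!: mult_left_mono mx)
  also have "\<dots> = (\<Sum>k<N. cmod (ent h i k)) * cmod (ent x i j)" by (simp add: sum_distrib_right)
  finally have "cmod l \<le> (\<Sum>k<N. cmod (ent h i k))" using pos by simp
  also have "\<dots> \<le> (\<Sum>i<N. \<Sum>k<N. cmod (ent h i k))"
    using i by (intro member_le_sum) (auto intro!: sum_nonneg)
  finally show ?thesis .
qed

text \<open>Each application of \<open>e\<close> shifts the eigenvalue by \<open>s\<close>, so an
  endless ladder of nonzero vectors would violate \<open>eigenvalue_bound\<close>.\<close>

lemma ladder_terminates:
  assumes h: "comm h e = cs s e" and s: "s = 2 \<or> s = -2" and x: "h * x = cs m x" "x \<noteq> 0"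
  obtains n where "((*) e ^^ n) x \<noteq> 0" "e * ((*) e ^^ n) x = 0"
    "\<And>n. h * ((*) e ^^ n) x = cs (m + of_nat n * s) (((*) e ^^ n) x)"
proof -
  obtain N where N: "h \<in> gl N" "e \<in> gl N" "x \<in> gl N" using ex_gl3 by blast
  let ?y = "\<lambda>n. ((*) e ^^ n) x"
  have eig: "h * ?y n = cs (m + of_nat n * s) (?y n)" for n
  proof (induction n)
    case (Suc n)
    have "h * e = e * h + cs s e" using h by (simp add: comm_def algebra_simps)
    then have "h * (e * ?y n) = e * (h * ?y n) + cs s (e * ?y n)"
      by (metis distrib_right mult.assoc mult_cs(1))
    then show ?case using Suc by (simp add: cs_add algebra_simps)
  qed (use x in simp)
  have gl: "?y n \<in> gl N" for n by (induction n) (auto simp: N)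
  define C where "C = (\<Sum>i<N. \<Sum>k<N. cmod (ent h i k))"
  have "\<exists>n. ?y n = 0"
  proof (rule ccontr)
    assume "\<nexists>n. ?y n = 0"
    then have b: "cmod (m + of_nat n * s) \<le> C" for n
      unfolding C_def using eigenvalue_bound[OF gl N(1) _ eig] by blast
    obtain n :: nat where n: "real n > C + cmod m" using reals_Archimedean2 by blast
    have "2 * real n = cmod (of_nat n * s)" using s by (auto simp: norm_mult)
    also have "\<dots> \<le> cmod (m + of_nat n * s) + cmod m"
      using norm_triangle_ineq4[of "m + of_nat n * s" m] by simp
    also have "\<dots> \<le> C + cmod m" using b by simp
    finally show False using n by simp
  qed
  then obtain M where M: "?y M = 0" "\<And>k. k < M \<Longrightarrow> ?y k \<noteq> 0"
    using exists_least_iff[of "\<lambda>n. ?y n = 0"] by auto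
  then have "M \<noteq> 0" using x by (cases M) auto
  then obtain n where "M = Suc n" by (cases M) auto
  then show ?thesis using that[of n] M eig by simp
qed

text \<open>Climb with \<open>e\<close> to a vector \<open>w\<close> killed by \<open>e\<close>, of
  eigenvalue \<open>l\<close>, then descend with \<open>f\<close> to the last nonzero vector, after
  \<open>k\<close> steps. There \<open>e f^(k+1) w = (k+1)(l-k) f^k w\<close> vanishes, so
  \<open>l = k\<close>, and \<open>m\<close> differs from \<open>l\<close> by an even
  integer.\<close>

lemma sl2_eigenvalue_int:
  assumes e: "comm h e = cs 2 e" and f: "comm h f = cs (- 2) f" and ef: "comm e f = h"
    and x: "h * x = cs m x" "x \<noteq> 0"
  shows "\<exists>n::int. m = of_int n"
proof -
  obtain n where n: "((*) e ^^ n) x \<noteq> 0" "e * ((*) e ^^ n) x = 0"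
      "h * ((*) e ^^ n) x = cs (m + of_nat n * 2) (((*) e ^^ n) x)"
    using ladder_terminates[OF e _ x] by metis
  define w where "w = ((*) e ^^ n) x"
  define l where "l = m + of_nat n * 2"
  have w: "w \<noteq> 0" "e * w = 0" "h * w = cs l w" using n by (simp_all add: w_def l_def)
  obtain k where k: "((*) f ^^ k) w \<noteq> 0" "f * ((*) f ^^ k) w = 0"
     and eig: "\<And>n. h * ((*) f ^^ n) w = cs (l + of_nat n * (-2)) (((*) f ^^ n) w)"
    using ladder_terminates[OF f _ w(3,1)] by metis
  let ?y = "\<lambda>n. ((*) f ^^ n) w"
  have "e * ?y (Suc n) = cs (of_nat (Suc n) * (l - of_nat n)) (?y n)" for n
  proof (induction n)
    case 0
    have "e * f = f * e + h" using ef by (simp add: comm_def algebra_simps)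
    then have "e * (f * w) = f * (e * w) + h * w" by (metis distrib_right mult.assoc)
    then show ?case using w by simp
  next
    case (Suc n)
    have "e * f = f * e + h" using ef by (simp add: comm_def algebra_simps)
    then have "e * (f * ?y (Suc n)) = f * (e * ?y (Suc n)) + h * ?y (Suc n)"
      by (metis distrib_right mult.assoc)
    also have "\<dots> = cs (of_nat (Suc n) * (l - of_nat n)) (?y (Suc n)) + cs (l + of_nat (Suc n) * (-2)) (?y (Suc n))"
      unfolding Suc eig by simp
    also have "\<dots> = cs (of_nat (Suc (Suc n)) * (l - of_nat (Suc n))) (?y (Suc n))"
      unfolding cs_add[symmetric] by (simp add: algebra_simps)
    finally show ?case by simp
  qed
  from this[of k] have "cs (of_nat (Suc k) * (l - of_nat k)) (?y k) = 0" using k by simp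
  then have "l = of_nat k" using k(1) by (auto simp del: of_nat_Suc)
  then have "m = of_int (int k - 2 * int n)" by (simp add: l_def algebra_simps)
  then show ?thesis by blast
qed

section \<open>The orthogonal projection onto the Lie algebra\<close>

definition sym_mats :: "nat \<Rightarrow> fmat set" where "sym_mats d = {M \<in> gl d. tp M = M}"

definition act :: "fmat \<Rightarrow> fmat \<Rightarrow> fmat" where "act A M = A * M + M * tp A"

definition sym_irr :: "nat \<Rightarrow> fmat set \<Rightarrow> bool" where
  "sym_irr d S \<longleftrightarrow> sym_mats d \<noteq> {0} \<and>
     (\<forall>W. csubspace W \<and> W \<subseteq> sym_mats d \<and> (\<forall>X\<in>S. \<forall>M\<in>W. act X M \<in> W) \<longrightarrow> W = {0} \<or> W = sym_mats d)"

lemma csubspace_sym_mats: "csubspace (sym_mats d)"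
  by (auto simp: csubspace_def sym_mats_def)

lemma ip_skew_real:
  assumes "adj X = - X" "adj Y = - Y" shows "cnj (ip X Y) = ip X Y"
proof -
  have "ip X Y = ip (adj Y) (adj X)" by (simp add: ip_adj)
  then show ?thesis using assms by (simp add: ip_cnj)
qed

text \<open>With \<open>u * tp x\<close> encoding u \<otimes> x, right multiplication by
  \<open>adj (tp w)\<close>, the entrywise conjugate of \<open>w\<close>, contracts the second
  factor against \<open>w\<close>.\<close>

lemma vec_tp_app:
  assumes "x \<in> vecs d" "w \<in> vecs d" "u \<in> vecs d"
  shows "u * tp x * adj (tp w) = cs (ip w x) u"
proof -
  have "tp x * adj (tp w) = tp (adj w * x)" by simp
  also have "\<dots> = tp (cs (ip w x) (unit_mat 0 0))" using assms vec_dot by metis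
  also have "\<dots> = cs (ip w x) (unit_mat 0 0)" by (auto intro!: fmat_eqI)
  finally have "tp x * adj (tp w) = cs (ip w x) (unit_mat 0 0)" .
  then have "u * (tp x * adj (tp w)) = cs (ip w x) u" using assms(3) by simp
  then show ?thesis by (simp add: mult.assoc)
qed

text \<open>A Lie algebra of skew-Hermitian matrices, given by a trace-orthonormal basis;
  \<open>closed\<close> expresses closure under brackets by the Fourier coefficients in that
  basis.\<close>

locale onb_alg =
  fixes d :: nat and I :: "'i set" and A :: "'i \<Rightarrow> fmat"
  assumes fin: "finite I" and ne: "I \<noteq> {}"
    and gl: "i \<in> I \<Longrightarrow> A i \<in> gl d"
    and skew: "i \<in> I \<Longrightarrow> adj (A i) = - A i"
    and orth: "i \<in> I \<Longrightarrow> j \<in> I \<Longrightarrow> ip (A i) (A j) = (if i = j then 1 else 0)"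
    and tr0: "i \<in> I \<Longrightarrow> tr (A i) = 0"
    and closed: "i \<in> I \<Longrightarrow> j \<in> I \<Longrightarrow>
        comm (A i) (A j) = (\<Sum>k\<in>I. cs (ip (A k) (comm (A i) (A j))) (A k))"
    and irr: "sym_irr d (A ` I)"
begin

definition pr :: "fmat \<Rightarrow> fmat" where "pr X = (\<Sum>k\<in>I. cs (ip (A k) X) (A k))"

lemma pr_simps [simp]:
  "pr (X + Y) = pr X + pr Y" "pr (X - Y) = pr X - pr Y" "pr (- X) = - pr X" "pr (cs c X) = cs c (pr X)"
  "pr 0 = 0" "pr X \<in> gl d" "tr (pr X) = 0"
  by (simp_all add: pr_def cs_add cs_diff sum.distrib sum_subtractf sum_negf cs_sum gl_sum gl tr_sum tr0)

lemma pr_A: "i \<in> I \<Longrightarrow> pr (A i) = A i"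
proof -
  assume i: "i \<in> I"
  have "pr (A i) = (\<Sum>k\<in>I. if k = i then A i else 0)"
    unfolding pr_def using i by (intro sum.cong) (auto simp: orth)
  then show ?thesis using i fin by simp
qed

lemma pr_sum: "pr (sum f S) = (\<Sum>s\<in>S. pr (f s))"
  by (induction S rule: infinite_finite_induct) auto

lemma pr_pr [simp]: "pr (pr X) = pr X"
  unfolding pr_def[of X] pr_sum by (intro sum.cong) (auto simp: pr_A)

lemma pr_self: "ip (pr X) Y = ip X (pr Y)"
  by (simp add: pr_def ip_sum ip_cnj mult.commute)

lemma adj_pr: "adj (pr X) = pr (adj X)"
proof -
  have "ip (A k) (adj X) = - cnj (ip (A k) X)" if "k \<in> I" for k
    using ip_adj[of "adj (A k)" X] skew[OF that] by (simp add: ip_cnj)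
  then show ?thesis by (simp add: pr_def adj_sum skew)
qed

lemma pr_comm_A: "i \<in> I \<Longrightarrow> pr (comm (A i) (pr X)) = comm (A i) (pr X)"
proof -
  assume i: "i \<in> I"
  have "pr (comm (A i) (A k)) = comm (A i) (A k)" if "k \<in> I" for k
    using closed[OF i that] by (simp add: pr_def)
  then show ?thesis unfolding pr_def[of X] comm_sum pr_sum by (intro sum.cong) auto
qed

text \<open>ad \<open>A i\<close> preserves the span of the basis and is skew for \<open>ip\<close>,
  so it preserves the orthogonal complement too and commutes with the projection.\<close>

lemma pr_equiv_A: "i \<in> I \<Longrightarrow> comm (A i) (pr X) = pr (comm (A i) X)"
proof (rule ip_eqI)
  fix Y assume i: "i \<in> I"
  have s: "ip Z (comm (A i) W) = - ip (comm (A i) Z) W" for Z W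
    using ip_comm[of "A i" Z W] skew[OF i] by simp
  have "ip Y (comm (A i) (pr X)) = ip Y (pr (comm (A i) (pr X)))" by (simp add: pr_comm_A i)
  also have "\<dots> = - ip (pr (comm (A i) (pr Y))) X"
    by (simp add: pr_self[symmetric] s)
  also have "\<dots> = - ip (comm (A i) (pr Y)) X" using pr_comm_A[OF i, of Y] by simp
  also have "\<dots> = ip Y (pr (comm (A i) X))" by (simp add: pr_self[symmetric] s)
  finally show "ip Y (comm (A i) (pr X)) = ip Y (pr (comm (A i) X))" .
qed

text \<open>Both sides are complex linear in \<open>pr W\<close>. Equivariance thus holds for the
  complexified algebra, which contains the Hermitian elements \<open>Q v\<close> and the ladder
  operators used later.\<close>

lemma pr_equiv: "comm (pr W) (pr X) = pr (comm (pr W) X)"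
proof -
  have "comm (pr W) (pr X) = (\<Sum>k\<in>I. pr (comm (cs (ip (A k) W) (A k)) X))"
    unfolding pr_def[of W] comm_sum by (intro sum.cong) (auto simp: pr_equiv_A)
  then show ?thesis unfolding pr_def[of W] comm_sum pr_sum .
qed

lemma ip_pr_pr: "ip (pr X) (pr Y) = ip X (pr Y)"
  by (simp add: pr_self)

text \<open>This is \<open>\<Sum>A\<^sub>k \<otimes> A\<^sub>k\<close> acting on V \<otimes> V, with
  u \<otimes> x encoded as \<open>u * tp x\<close>.\<close>

definition tt :: "fmat \<Rightarrow> fmat" where "tt M = (\<Sum>k\<in>I. A k * M * tp (A k))"

lemma clinear_tt: "clinear_map tt"
  by (simp add: clinear_map_def tt_def algebra_simps sum.distrib cs_sum)

lemma tt_sym: "M \<in> sym_mats d \<Longrightarrow> tt M \<in> sym_mats d"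
  by (auto simp: sym_mats_def tt_def tp_sum mult.assoc gl intro!: gl_sum)

lemma act_tt: "i \<in> I \<Longrightarrow> act (A i) (tt M) = tt (act (A i) M)"
proof -
  assume i: "i \<in> I"
  define c where "c k l = ip (A l) (comm (A i) (A k))" for k l
  \<comment> \<open>Antisymmetry of the structure constants in an orthonormal basis: ad
    \<open>A i\<close> is skew, and products of skew-Hermitian matrices are real. It cancels the
    double sums below once the indices are swapped.\<close>
  have c: "c k l + c l k = 0" if "k \<in> I" "l \<in> I" for k l
  proof -
    have sk: "adj (comm (A i) (A l)) = - comm (A i) (A l)"
      using skew[OF i] skew[OF that(2)] by (simp add: adj_comm comm_swap[of "A l"])
    have "c k l = ip (comm (adj (A i)) (A l)) (A k)" unfolding c_def by (simp add: ip_comm)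
    also have "\<dots> = - ip (comm (A i) (A l)) (A k)" using skew[OF i] by simp
    also have "\<dots> = - c l k"
      unfolding c_def using ip_skew_real[OF sk skew[OF that(1)]] by (simp add: ip_cnj)
    finally show ?thesis by simp
  qed
  have cm: "comm (A i) (A k) = (\<Sum>l\<in>I. cs (c k l) (A l))" if "k \<in> I" for k
    using closed[OF i that] by (simp add: c_def)
  have "act (A i) (tt M) - tt (act (A i) M)
      = (\<Sum>k\<in>I. comm (A i) (A k) * M * tp (A k) + A k * M * tp (comm (A i) (A k)))"
    unfolding act_def tt_def
    by (simp add: comm_def sum_distrib_left sum_distrib_right algebra_simps sum.distrib sum_subtractf)
  also have "\<dots> = (\<Sum>k\<in>I. \<Sum>l\<in>I. cs (c k l) (A l * M * tp (A k)))
      + (\<Sum>k\<in>I. \<Sum>l\<in>I. cs (c k l) (A k * M * tp (A l)))"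
    by (simp add: cm sum_distrib_left sum_distrib_right tp_sum sum.distrib)
  also have "(\<Sum>k\<in>I. \<Sum>l\<in>I. cs (c k l) (A l * M * tp (A k)))
      = (\<Sum>k\<in>I. \<Sum>l\<in>I. cs (c l k) (A k * M * tp (A l)))" by (rule sum.swap)
  also have "\<dots> + (\<Sum>k\<in>I. \<Sum>l\<in>I. cs (c k l) (A k * M * tp (A l)))
      = (\<Sum>k\<in>I. \<Sum>l\<in>I. cs (c l k + c k l) (A k * M * tp (A l)))"
    by (simp add: sum.distrib cs_add)
  also have "\<dots> = 0" by (intro sum.neutral ballI) (simp add: c)
  finally show ?thesis by simp
qed

text \<open>The Casimir-type operator \<open>\<Sum>A\<^sub>k \<otimes> A\<^sub>k\<close> commutes with the action, hence is scalar on the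
  irreducible symmetric square.\<close>
lemma ex_tt_scalar: "\<exists>c. \<forall>M\<in>sym_mats d. tt M = cs c M"
proof -
  note irr' = irr[unfolded sym_irr_def]
  obtain M c where M: "M \<in> sym_mats d" "M \<noteq> 0" "tt M = cs c M"
    using ex_eigenvector[OF clinear_tt csubspace_sym_mats, of d d] irr' tt_sym
    by (metis (no_types, lifting) mem_Collect_eq subsetI sym_mats_def)
  define W where "W = {M \<in> sym_mats d. tt M = cs c M}"
  have "csubspace W"
    using csubspace_sym_mats[of d]
    by (auto simp: W_def csubspace_def clinear_mapD[OF clinear_tt] mult.commute)
  moreover have "act X N \<in> W" if "X \<in> A ` I" "N \<in> W" for X N
  proof -
    obtain i where i: "i \<in> I" "X = A i" using \<open>X \<in> A ` I\<close> by blast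
    have "act X N \<in> sym_mats d" using that gl[OF i(1)] i(2)
      by (auto simp: W_def sym_mats_def act_def add.commute)
    moreover have "tt (act X N) = cs c (act X N)"
      using that i by (simp add: act_tt[symmetric] W_def) (simp add: act_def)
    ultimately show ?thesis by (simp add: W_def)
  qed
  moreover have "W \<subseteq> sym_mats d" by (auto simp: W_def)
  ultimately have "W = {0} \<or> W = sym_mats d" using irr' by blast
  moreover have "M \<in> W" using M by (simp add: W_def)
  ultimately have "W = sym_mats d" using M(2) by auto
  then show ?thesis by (auto simp: W_def)
qed

text \<open>Apply the scalar to the symmetric tensor of \<open>u\<close> and \<open>x\<close> and
  contract the second factor with \<open>w\<close>. Skewness turns each
  \<open>ip w (A k * x)\<close> into minus a Fourier coefficient of \<open>x * adj w\<close>, so the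
  sums assemble into \<open>pr\<close>; hence the constant is minus the eigenvalue of
  \<open>tt\<close>.\<close>

lemma ex_star: "\<exists>c. \<forall>u\<in>vecs d. \<forall>w\<in>vecs d. \<forall>x\<in>vecs d.
   pr (u * adj w) * x + pr (x * adj w) * u = cs c (cs (ip w x) u + cs (ip w u) x)"
proof -
  obtain c where c: "\<And>M. M \<in> sym_mats d \<Longrightarrow> tt M = cs c M" using ex_tt_scalar by blast
  have "pr (u * adj w) * x + pr (x * adj w) * u = cs (- c) (cs (ip w x) u + cs (ip w u) x)"
    if v: "u \<in> vecs d" "w \<in> vecs d" "x \<in> vecs d" for u w x
  proof -
    let ?M = "u * tp x + x * tp u"
    have "?M \<in> sym_mats d" using v by (auto simp: sym_mats_def vecs_gl add.commute)
    then have "tt ?M * adj (tp w) = cs c (?M * adj (tp w))" by (simp add: c del: cs_simps)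
    also have "?M * adj (tp w) = cs (ip w x) u + cs (ip w u) x"
      using v by (simp add: distrib_right vec_tp_app[of _ d])
    also have "tt ?M * adj (tp w) = (\<Sum>k\<in>I. (A k * u) * tp (A k * x) * adj (tp w) + (A k * x) * tp (A k * u) * adj (tp w))"
      by (simp add: tt_def sum_distrib_right algebra_simps)
    also have "\<dots> = (\<Sum>k\<in>I. cs (ip w (A k * x)) (A k * u) + cs (ip w (A k * u)) (A k * x))"
      by (intro sum.cong refl) (simp only: vec_tp_app[of _ d] vecs_mult gl v)
    also have "\<dots> = - (pr (u * adj w) * x + pr (x * adj w) * u)"
    proof -
      have "ip (A k) (y * adj w) = - ip w (A k * y)" if "k \<in> I" for k y
        using ip_mult_left[of "A k" w y] skew[OF that] by (simp add: ip_outer_left)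
      then show ?thesis
        by (simp add: pr_def sum_distrib_right sum_negf sum.distrib)
    qed
    finally have "pr (u * adj w) * x + pr (x * adj w) * u = - cs c (cs (ip w x) u + cs (ip w u) x)"
      by (metis minus_minus)
    then show ?thesis by simp
  qed
  then show ?thesis by blast
qed

lemma d_pos: "0 < d"
proof (rule ccontr)
  assume "\<not> 0 < d"
  then have "sym_mats d = {0}" by (auto simp: sym_mats_def gl_def intro!: fmat_eqI)
  then show False using irr by (simp add: sym_irr_def)
qed

end

lemma double_cancel: "X + X = Y + (Y::fmat) \<Longrightarrow> X = Y"
proof -
  assume e: "X + X = Y + Y"
  have "ent X i j = ent Y i j" for i j
    using arg_cong[OF e, of "\<lambda>Z. ent Z i j"] by (simp flip: mult_2)
  then show ?thesis by (rule fmat_eqI)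
qed

lemma ip_diff_eq_0: "ip (X - Y) (X - Y) = 0 \<Longrightarrow> X = Y"
  by (metis ip_self_eq_0_iff right_minus_eq)

lemma ip_vecs:
  assumes "x \<in> vecs d" "w \<in> vecs d"
  shows "ip w x = (\<Sum>k<d. cnj (ent w k 0) * ent x k 0)"
proof -
  have "ip w x = ent (adj w * x) 0 0" using vec_dot[OF assms] by simp
  then show ?thesis using assms by (simp add: ent_mult[of _ d] vecs_gl)
qed

lemma ip_unit_vec: "ip (unit_mat j 0) (unit_mat k 0) = (if j = k then 1 else 0)"
proof -
  have v: "unit_mat j 0 \<in> vecs (Suc (j + k))" "unit_mat k 0 \<in> vecs (Suc (j + k))"
    by (auto simp: vecs_unit_iff)
  have "ip (unit_mat j 0) (unit_mat k 0) = (\<Sum>i<Suc (j + k). if i = k then (if j = k then 1 else 0) else 0)"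
    unfolding ip_vecs[OF v(2,1)] by (intro sum.cong) auto
  then show ?thesis by simp
qed

lemma normalize_vec:
  assumes "u \<noteq> 0" obtains r where "r > 0" "ip (cs (of_real r) u) (cs (of_real r) u) = 1"
proof -
  have n: "nsq u > 0" using nsq_nonneg[of u] nsq_eq_0_iff[of u] assms by linarith
  have "ip (cs (of_real (1 / sqrt (nsq u))) u) (cs (of_real (1 / sqrt (nsq u))) u)
    = of_real (1 / sqrt (nsq u) * (1 / sqrt (nsq u)) * nsq u)"
    unfolding ip_simps ip_self[of u] by (simp only: complex_cnj_complex_of_real of_real_mult mult.assoc)
  also have "1 / sqrt (nsq u) * (1 / sqrt (nsq u)) * nsq u = 1" using n assms by (simp add: field_simps)
  finally show ?thesis using that[of "1 / sqrt (nsq u)"] n by simp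
qed

section \<open>Projections of rank-one operators\<close>

locale star_alg = onb_alg d I A for d :: nat and I :: "'i set" and A :: "'i \<Rightarrow> fmat" +
  fixes \<kappa> :: real
  assumes star: "u \<in> vecs d \<Longrightarrow> w \<in> vecs d \<Longrightarrow> x \<in> vecs d \<Longrightarrow>
      pr (u * adj w) * x + pr (x * adj w) * u = cs (of_real \<kappa>) (cs (ip w x) u + cs (ip w u) x)"

text \<open>The constant is real because, tested on a unit vector \<open>v\<close>, it equals the
  squared norm of \<open>pr (v * adj v)\<close>.\<close>

lemma (in onb_alg) ex_star_alg: "\<exists>k. star_alg d I A k"
proof -
  obtain c where c: "\<And>u w x. u \<in> vecs d \<Longrightarrow> w \<in> vecs d \<Longrightarrow> x \<in> vecs d \<Longrightarrow>
      pr (u * adj w) * x + pr (x * adj w) * u = cs c (cs (ip w x) u + cs (ip w u) x)"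
    using ex_star by blast
  define v where "v = unit_mat 0 0"
  have v: "v \<in> vecs d" using d_pos by (simp add: v_def vecs_unit_iff)
  have vv: "ip v v = 1"
    by (simp add: v_def ip_unit_vec)
  have "pr (v * adj v) * v = cs c v"
    by (rule double_cancel) (use c[OF v v v] vv in simp)
  then have "c = ip v (pr (v * adj v) * v)" using vv by simp
  also have "\<dots> = ip (v * adj v) (pr (v * adj v))" by (simp add: ip_outer_left)
  also have "\<dots> = of_real (nsq (pr (v * adj v)))" by (simp flip: ip_self add: ip_pr_pr)
  finally show ?thesis using c
    by (intro exI[of _ "nsq (pr (v * adj v))"] star_alg.intro onb_alg_axioms star_alg_axioms.intro) auto
qed

context star_alg
begin

definition Q :: "fmat \<Rightarrow> fmat" where "Q v = pr (v * adj v)"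

lemma Q_gl [simp]: "Q v \<in> gl d" and adj_Q [simp]: "adj (Q v) = Q v" and pr_Q [simp]: "pr (Q v) = Q v"
  by (simp_all add: Q_def adj_pr)

lemma ip_Q: "ip (Q u) (Q v) = ip u (Q v * u)"
  by (simp add: Q_def pr_self ip_outer_left)

lemma Q_self: "v \<in> vecs d \<Longrightarrow> ip v v = 1 \<Longrightarrow> Q v * v = cs (of_real \<kappa>) v"
proof -
  assume v: "v \<in> vecs d" "ip v v = 1"
  show ?thesis
    by (rule double_cancel) (use star[OF v(1) v(1) v(1)] v(2) in \<open>simp add: Q_def\<close>)
qed

lemma ip_Q_self: "v \<in> vecs d \<Longrightarrow> ip v v = 1 \<Longrightarrow> ip (Q v) (Q v) = \<kappa>"
  by (simp add: ip_Q Q_self)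

lemma star_orth:
  assumes "v \<in> vecs d" "ip v v = 1" "y \<in> vecs d" "ip v y = 0"
  shows "pr (y * adj v) * v = cs (of_real \<kappa>) y - Q v * y"
  using star[of y v v] assms by (simp add: Q_def algebra_simps)

text \<open>Put \<open>u = x = v\<close> and \<open>w = y\<close> in \<open>star\<close>: the
  right-hand side vanishes. In this sense \<open>v\<close> behaves like a highest weight
  vector.\<close>

lemma pr_adj_kill:
  assumes "v \<in> vecs d" "y \<in> vecs d" "ip v y = 0"
  shows "pr (v * adj y) * v = 0"
proof -
  have "ip y v = 0" using assms(3) ip_cnj[of v y] by simp
  then have "pr (v * adj y) * v + pr (v * adj y) * v = 0"
    using star[of v y v] assms by simp
  then show ?thesis by (rule double_cancel[where Y = 0, unfolded add_0_right])
qed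

text \<open>If \<kappa> were 0, every \<open>Q w\<close> would vanish. Then \<open>A i * w\<close>
  is orthogonal to \<open>w\<close>, and \<open>star_orth\<close> annihilates the projection of its
  outer product with \<open>w\<close>, so \<open>A i\<close> kills all vectors, against
  orthonormality.\<close>

lemma Q_scalar_0: "\<kappa> \<noteq> 0"
proof
  assume k: "\<kappa> = 0"
  obtain i where i: "i \<in> I" using ne by blast
  have Q0: "Q w = 0" if "w \<in> vecs d" "ip w w = 1" for w
    using ip_Q_self[OF that] k by simp
  have "A i * w = 0" if w: "w \<in> vecs d" "ip w w = 1" for w
  proof -
    have e: "ip (y * adj w) (A i) = ip (pr (y * adj w)) (A i)" for y
      using pr_self[of "y * adj w" "A i"] pr_A[OF i] by simp
    let ?y = "A i * w"
    have y: "?y \<in> vecs d" using gl[OF i] w by simp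
    have "ip w ?y = 0" using e[of w] Q0[OF w] by (simp add: Q_def ip_outer_left)
    then have "pr (?y * adj w) * w = 0" using star_orth[OF w y] Q0[OF w] k by simp
    then have "ip (pr (?y * adj w)) (pr (?y * adj w)) = 0" by (simp add: pr_self ip_outer_left)
    then have "pr (?y * adj w) = 0" by simp
    then have "ip ?y ?y = 0" using e[of ?y] by (simp add: ip_outer_left)
    then show ?thesis by simp
  qed
  then have u: "A i * unit_mat j 0 = 0" if "j < d" for j
    using that by (simp add: vecs_unit_iff ip_unit_vec)
  have "A i = 0"
  proof (rule gl_eqI[OF gl[OF i]])
    fix x assume "x \<in> vecs d"
    then have "A i * x = A i * (\<Sum>j<d. cs (ent x j 0) (unit_mat j 0))" using vec_expand by metis
    also have "\<dots> = 0" by (simp add: sum_distrib_left u)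
    finally show "A i * x = 0 * x" by simp
  qed simp
  then show False using orth[OF i i] by simp
qed

text \<open>A second unit vector \<open>u\<close> for \<kappa> gives \<open>Q u = Q v\<close> by
  equality in Cauchy-Schwarz, and \<open>pr (u * adj v) = 0\<close>. The commutator \<open>X\<close>
  of \<open>Y\<close> and \<open>adj Y\<close> then has equal diagonal values at \<open>u\<close>
  and \<open>v\<close>, yet they have opposite signs. So every vector orthogonal to \<open>v\<close>
  is an eigenvector for \<kappa>, and \<open>Q v\<close> is a nonzero scalar matrix of trace
  0.\<close>

lemma top_simple:
  assumes v: "v \<in> vecs d" "ip v v = 1" and u: "u \<in> vecs d" "ip u u = 1" and o: "ip v u = 0"
    and e: "Q v * u = cs (of_real \<kappa>) u"
  shows False
proof -
  have uv: "ip u v = 0" using o ip_cnj[of v u] by simp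
  have k: "ip (Q u) (Q v) = \<kappa>" using e u by (simp add: ip_Q)
  then have "ip (Q v) (Q u) = \<kappa>" using ip_cnj[of "Q u" "Q v"] by simp
  then have "ip (Q u - Q v) (Q u - Q v) = 0" using k ip_Q_self u v by simp
  then have Quv: "Q u = Q v" by (rule ip_diff_eq_0)
  have "pr (u * adj v) * v = 0" using star_orth[OF v u(1) o] e by simp
  then have "ip (pr (u * adj v)) (pr (u * adj v)) = 0" by (simp add: pr_self ip_outer_left)
  then have puv: "pr (u * adj v) = 0" by simp
  have *: "Q v * y = cs (of_real \<kappa>) y" if y: "y \<in> vecs d" "ip v y = 0" for y
  proof -
    define Y where "Y = pr (y * adj v)"
    have Yv: "Y * v = cs (of_real \<kappa>) y - Q v * y" unfolding Y_def by (rule star_orth[OF v y])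
    have Yu: "Y * u = 0" using star[of y v u] v u y o puv by (simp add: Y_def)
    have aY: "adj Y = pr (v * adj y)" by (simp add: Y_def adj_pr)
    have Y'v: "adj Y * v = 0" unfolding aY by (rule pr_adj_kill[OF v(1) y])
    define X where "X = comm Y (adj Y)"
    have "X = comm (pr (y * adj v)) (pr (v * adj y))" using X_def aY Y_def by metis
    then have prX: "pr X = X" using pr_equiv[of "y * adj v" "pr (v * adj y)"] by simp
    have w: "ip w (X * w) = ip (adj Y * w) (adj Y * w) - ip (Y * w) (Y * w)" for w
      unfolding X_def comm_def by (simp add: left_diff_distrib mult.assoc ip_mult_left)
    have q: "ip w (X * w) = ip (Q w) X" for w
      unfolding Q_def pr_self prX by (simp add: ip_outer_left)
    \<comment> \<open>\<open>Y\<close> kills \<open>u\<close> and \<open>adj Y\<close> kills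
      \<open>v\<close>, so one term survives on each side: a squared norm and the negative of
      one.\<close>
    have "ip (adj Y * u) (adj Y * u) = - ip (Y * v) (Y * v)"
      using w[of u] w[of v] q[of u] q[of v] Quv Yu Y'v by simp
    then have "complex_of_real (nsq (adj Y * u)) = complex_of_real (- nsq (Y * v))"
      by (simp add: ip_self)
    then have "nsq (adj Y * u) = - nsq (Y * v)" unfolding of_real_eq_iff .
    then have "nsq (Y * v) = 0" using nsq_nonneg[of "adj Y * u"] nsq_nonneg[of "Y * v"] by linarith
    then show ?thesis using Yv by simp
  qed
  have "Q v = cs (of_real \<kappa>) (Idm d)"
  proof (rule gl_eqI)
    fix x assume x: "x \<in> vecs d"
    let ?y = "x - cs (ip v x) v"
    have "Q v * x = Q v * ?y + Q v * (cs (ip v x) v)" by (simp add: right_diff_distrib)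
    also have "Q v * ?y = cs (of_real \<kappa>) ?y" using x v by (intro *) auto
    finally show "Q v * x = cs (of_real \<kappa>) (Idm d) * x"
      using x v by (simp add: Q_self vecs_gl mult.commute)
  qed auto
  then have "tr (Q v) = \<kappa> * of_nat d" by simp
  moreover have "tr (Q v) = 0" by (simp add: Q_def)
  ultimately show False using Q_scalar_0 d_pos by simp
qed

section \<open>Two orthonormal weight vectors and their \<open>sl\<^sub>2\<close>\<close>

context
  fixes v y :: fmat and \<delta> :: real
  assumes v: "v \<in> vecs d" "ip v v = 1" and y: "y \<in> vecs d" "ip y y = 1" and o: "ip v y = 0"
    and e: "Q v * y = cs (of_real (\<kappa> - \<delta>)) y"
begin

lemma o': "ip y v = 0" using o ip_cnj[of v y] by simp

lemma ip_Q_pair: "ip (Q v) (Q y) = \<kappa> - \<delta>"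
  using e y ip_cnj[of "Q y" "Q v"] by (simp add: ip_Q)

text \<open>\<open>2 * \<delta>\<close> is the squared distance of \<open>Q v\<close> and
  \<open>Q y\<close>, and \<open>top_simple\<close> excludes 0.\<close>

lemma delta_pos: "\<delta> > 0"
proof -
  have "ip (Q y) (Q v) = \<kappa> - \<delta>" using ip_Q_pair ip_cnj[of "Q v" "Q y"] by simp
  then have "ip (Q v - Q y) (Q v - Q y) = of_real (2 * \<delta>)"
    using ip_Q_pair ip_Q_self v y by simp
  then have "2 * \<delta> = nsq (Q v - Q y)" unfolding ip_self of_real_eq_iff by simp
  then have "\<delta> \<ge> 0" using nsq_nonneg[of "Q v - Q y"] by linarith
  moreover have "\<delta> \<noteq> 0" using top_simple[OF v y o] e by auto
  ultimately show ?thesis by simp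
qed

lemma raise_v: "pr (y * adj v) * v = cs (of_real \<delta>) y"
  using star_orth[OF v y(1) o] e by (simp add: cs_diff[symmetric] flip: of_real_diff)

lemma nsq_raise: "ip (pr (y * adj v)) (pr (y * adj v)) = \<delta>"
  using y by (simp add: pr_self ip_outer_left raise_v)

text \<open>ad \<open>Q v\<close> multiplies \<open>pr (v * adj y)\<close> by \<delta>, so this
  operator sends \<open>y\<close> into the \<kappa>-eigenspace of \<open>Q v\<close>, which is the
  line of \<open>v\<close> by \<open>top_simple\<close>. The coefficient is read off from the
  adjoint of \<open>raise_v\<close>.\<close>

lemma lower_y: "pr (v * adj y) * y = cs (of_real \<delta>) v"
proof -
  let ?Z = "pr (v * adj y)"
  have aZ: "?Z = adj (pr (y * adj v))" by (simp add: adj_pr)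
  have "comm (Q v) ?Z = pr (comm (Q v) (v * adj y))"
    unfolding Q_def by (rule pr_equiv)
  also have "comm (Q v) (v * adj y) = Q v * v * adj y - v * adj (Q v * y)"
    by (simp add: comm_def mult.assoc)
  also have "\<dots> = cs (of_real \<delta>) (v * adj y)"
    unfolding e Q_self[OF v] by (simp add: cs_diff[symmetric] flip: of_real_diff)
  finally have "Q v * ?Z = ?Z * Q v + cs (of_real \<delta>) ?Z" by (simp add: comm_def algebra_simps)
  then have "Q v * ?Z * y = ?Z * Q v * y + cs (of_real \<delta>) ?Z * y" by (simp add: distrib_right)
  then have "Q v * (?Z * y) = ?Z * (Q v * y) + cs (of_real \<delta>) (?Z * y)" by (simp add: mult.assoc)
  then have Qx: "Q v * (?Z * y) = cs (of_real \<kappa>) (?Z * y)"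
    unfolding e by (simp add: cs_add[symmetric] flip: of_real_add)
  define x where "x = ?Z * y"
  have x: "x \<in> vecs d" using y by (simp add: x_def)
  have vx: "ip v x = \<delta>"
    using ip_mult_left[of "pr (y * adj v)" v y] y by (simp add: x_def aZ raise_v)
  define u where "u = x - cs (ip v x) v"
  have u: "u \<in> vecs d" "ip v u = 0" "Q v * u = cs (of_real \<kappa>) u"
    using x v Qx by (simp_all add: u_def right_diff_distrib Q_self x_def mult.commute)
  have "u = 0"
  proof (rule ccontr)
    assume "u \<noteq> 0"
    then obtain r where r: "ip (cs (of_real r) u) (cs (of_real r) u) = 1" using normalize_vec by blast
    define w where "w = cs (of_real r) u"
    have "ip w w = 1" using r by (simp only: w_def)
    moreover have "w \<in> vecs d" "ip v w = 0" "Q v * w = cs (of_real \<kappa>) w"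
      using u by (simp_all add: w_def mult.commute)
    ultimately show False using top_simple[OF v] by blast
  qed
  then show ?thesis using vx by (simp add: u_def x_def)
qed

text \<open>Inserting \<open>lower_y\<close> into the star identity for \<open>y\<close> exchanges
  the roles: \<open>v\<close> is in turn an eigenvector of \<open>Q y\<close>, with the same gap
  \<delta>.\<close>

lemma Q_pair_sym: "Q y * v = cs (of_real (\<kappa> - \<delta>)) v"
  using star_orth[OF y v(1) o'] lower_y by (simp add: cs_diff algebra_simps)

lemma comm_lower_raise:
  "comm (pr (v * adj y)) (pr (y * adj v)) = cs (of_real \<delta>) (Q v - Q y)"
proof -
  have "comm (pr (v * adj y)) (pr (y * adj v)) = pr (comm (pr (v * adj y)) (y * adj v))"
    by (rule pr_equiv)
  also have "comm (pr (v * adj y)) (y * adj v) = pr (v * adj y) * y * adj v - y * adj (adj (pr (v * adj y)) * v)"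
    by (simp add: comm_def mult.assoc)
  also have "adj (pr (v * adj y)) = pr (y * adj v)" by (simp add: adj_pr)
  finally show ?thesis by (simp add: lower_y raise_v Q_def)
qed

lemma comm_diff_raise:
  "comm (Q v - Q y) (pr (y * adj v)) = cs (of_real (- 2 * \<delta>)) (pr (y * adj v))"
proof -
  have "comm (Q v - Q y) (pr (y * adj v)) = pr (comm (Q v - Q y) (y * adj v))"
    using pr_equiv[of "Q v - Q y" "y * adj v"] by simp
  also have "comm (Q v - Q y) (y * adj v) = (Q v - Q y) * y * adj v - y * adj ((Q v - Q y) * v)"
    by (simp add: comm_def mult.assoc)
  also have "(Q v - Q y) * y = cs (of_real (- \<delta>)) y"
    unfolding left_diff_distrib e Q_self[OF y] cs_diff[symmetric] by simp
  also have "(Q v - Q y) * v = cs (of_real \<delta>) v"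
    unfolding left_diff_distrib Q_pair_sym Q_self[OF v] cs_diff[symmetric] by simp
  finally have "comm (Q v - Q y) (pr (y * adj v)) = cs (- of_real \<delta>) (pr (y * adj v)) - cs (of_real \<delta>) (pr (y * adj v))"
    by simp
  then show ?thesis unfolding cs_diff[symmetric] by simp
qed

text \<open>Division by \<delta> normalises the two ladder operators and \<open>Q v - Q y\<close> to
  a standard \<open>sl\<^sub>2\<close>-triple, whose semisimple element has integer
  eigenvalues.\<close>

lemma diff_eigenvalue_int:
  assumes x: "x \<noteq> 0" "(Q v - Q y) * x = cs (of_real m) x"
  shows "\<exists>n::int. m = of_int n * \<delta>"
proof -
  define h where "h = cs (of_real (1 / \<delta>)) (Q v - Q y)"
  define f where "f = cs (of_real (1 / \<delta>)) (pr (y * adj v))"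
  define e where "e = cs (of_real (1 / \<delta>)) (pr (v * adj y))"
  have d: "\<delta> \<noteq> 0" using delta_pos by simp
  have ef: "comm e f = h"
    unfolding e_def f_def h_def by (simp only: comm_simps comm_lower_raise cs_simps) (use d in simp)
  have hf: "comm h f = cs (- 2) f"
    unfolding f_def h_def by (simp only: comm_simps(7,8) comm_diff_raise cs_simps(4)) (use d in simp)
  have aef: "e = adj f" "adj h = h" by (simp_all add: e_def f_def h_def adj_pr)
  have "comm h e = - adj (comm h f)"
    unfolding adj_comm aef by (rule comm_swap)
  then have "comm h e = cs 2 e" unfolding hf aef by simp
  moreover have "h * x = cs (of_real (m / \<delta>)) x" 
    unfolding h_def mult_cs x(2) cs_simps(4) by simp
  ultimately obtain n :: int where "complex_of_real (m / \<delta>) = of_int n"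
    using sl2_eigenvalue_int[OF _ hf ef] x by blast
  then have "complex_of_real (m / \<delta>) = complex_of_real (of_int n)" by simp
  then have "m / \<delta> = of_int n" unfolding of_real_eq_iff .
  then have "m = of_int n * \<delta>" using d by (simp add: field_simps)
  then show ?thesis by blast
qed

end

end

section \<open>The two possible weight configurations\<close>

text \<open>The difference \<open>x - b\<close> lies strictly between 0 and \<open>y\<close>, where
  no integer multiple of \<open>y\<close> fits.\<close>

lemma int_multiple_gap:
  fixes x y b :: real
  assumes "x - b = of_int n * y" "0 < b" "b < x" "x \<le> y"
  shows False
proof -
  have "0 < of_int n * y" "of_int n * y < y" using assms by linarith+
  moreover have "y > 0" using assms by linarith
  ultimately have "0 < (of_int n :: real)" "(of_int n :: real) < 1"
    by (auto simp: zero_less_mult_iff)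
  then have "0 < n" "n < 1" by auto
  then show False by simp
qed

text \<open>\<open>D i j\<close> is half the squared distance between the projectors \<open>Q i\<close>, \<open>Q j\<close>; \<open>square\<close> is the
  idempotence of their Gram matrix \<open>\<kappa> - D\<close>. The relation \<open>D i j > Min D\<close> is transitive, and
  evaluating \<open>square\<close> on the indicator of one of its classes yields a quadratic equation.\<close>
lemma distance_matrix_dichotomy:
  fixes D :: "nat \<Rightarrow> nat \<Rightarrow> real" and d :: nat and r s :: real
  assumes d: "2 \<le> d"
    and sym: "\<And>i j. i < d \<Longrightarrow> j < d \<Longrightarrow> D i j = D j i"
    and diag: "\<And>i. i < d \<Longrightarrow> D i i = 0"
    and pos: "\<And>i j. i < d \<Longrightarrow> j < d \<Longrightarrow> i \<noteq> j \<Longrightarrow> 0 < D i j"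
    and row: "\<And>i. i < d \<Longrightarrow> (\<Sum>j<d. D i j) = r"
    and square: "\<And>i j. i < d \<Longrightarrow> j < d \<Longrightarrow> (\<Sum>k<d. D i k * D k j) + D i j = s"
    and int: "\<And>i j k. i < d \<Longrightarrow> j < d \<Longrightarrow> k < d \<Longrightarrow> i \<noteq> j \<Longrightarrow> \<exists>n::int. D j k - D i k = of_int n * D i j"
  shows "(\<forall>i<d. \<forall>j<d. i \<noteq> j \<longrightarrow> D i j = 1) \<or>
    (\<exists>p. \<forall>i<d. p i < d \<and> p i \<noteq> i \<and> p (p i) = i \<and> D i (p i) = 1 \<and> (\<forall>j<d. j \<noteq> i \<and> j \<noteq> p i \<longrightarrow> D i j = 1/2))"
proof -
  define S where "S = {D i j |i j. i < d \<and> j < d \<and> i \<noteq> j}"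
  have fS: "finite S"
    by (rule finite_subset[of _ "(\<lambda>(i,j). D i j) ` ({..<d} \<times> {..<d})"]) (auto simp: S_def)
  have "D 0 1 \<in> S" using d unfolding S_def by force
  define \<beta> where "\<beta> = Min S"
  have "\<beta> \<in> S" unfolding \<beta>_def using fS \<open>D 0 1 \<in> S\<close> by (intro Min_in) auto
  then obtain a b where ab: "a < d" "b < d" "a \<noteq> b" "D a b = \<beta>" by (auto simp: S_def)
  have ge: "\<beta> \<le> D i j" if "i < d" "j < d" "i \<noteq> j" for i j
    unfolding \<beta>_def using that fS by (intro Min_le) (auto simp: S_def)
  have b0: "\<beta> > 0" using pos ab by auto
  \<comment> \<open>If \<open>D i k = \<beta>\<close>, integrality makes the smaller of
    \<open>D i j\<close> and \<open>D j k\<close>, less \<beta>, an integer multiple of the larger,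
    against \<open>int_multiple_gap\<close>.\<close>
  have tri: "\<beta> < D i k" if ijk: "i < d" "j < d" "k < d" "i \<noteq> k" and "\<beta> < D i j" "\<beta> < D j k" for i j k
  proof (rule ccontr)
    assume "\<not> \<beta> < D i k"
    then have e: "D i k = \<beta>" using ge[of i k] ijk by simp
    have ne: "i \<noteq> j" "j \<noteq> k" using that diag b0 by auto
    show False
    proof (cases "D j k \<le> D i j")
      case True
      obtain n :: int where "D j k - D i k = of_int n * D i j" using int[of i j k] ijk ne by auto
      then show False using int_multiple_gap[of "D j k" \<beta> n "D i j"] e that b0 True by simp
    next
      case False
      obtain n :: int where "D j i - D k i = of_int n * D k j" using int[of k j i] ijk ne by auto
      then show False using int_multiple_gap[of "D i j" \<beta> n "D j k"] e that b0 False sym by simp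
    qed
  qed
  have bb: "b \<noteq> a" "D b a = \<beta>" using ab sym by auto
  \<comment> \<open>Every point has a neighbour at distance \<beta>: a point far from all others
    would make \<open>a\<close> and \<open>b\<close> far from each other by transitivity.\<close>
  have far: "\<exists>l<d. l \<noteq> i \<and> D i l = \<beta>" if i: "i < d" for i
  proof (rule ccontr)
    assume "\<not> ?thesis"
    then have *: "\<beta> < D i l" if "l < d" "l \<noteq> i" for l using ge[of i l] i that by force
    show False
    proof (cases "i = a \<or> i = b")
      case True then show ?thesis using *[of a] *[of b] ab bb by auto
    next
      case False
      then have "\<beta> < D a b" using tri[of a i b] *[of a] *[of b] sym[of i a] ab i by auto
      then show ?thesis using ab by simp
    qed
  qed
  \<comment> \<open>Pick \<open>l\<close> at distance \<beta> from \<open>i\<close>. Transitivity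
    puts \<open>k\<close> at distance \<beta> from \<open>l\<close> as well, and integrality for the
    pair \<open>i\<close>, \<open>l\<close> makes \<open>D i k\<close> an integer multiple of
    \<beta>.\<close>
  have dbl: "2 * \<beta> \<le> D i k" if ik: "i < d" "k < d" "\<beta> < D i k" for i k
  proof -
    obtain l where l: "l < d" "l \<noteq> i" "D i l = \<beta>" using far ik by blast
    have "k \<noteq> l" using l ik by auto
    have "D k l = \<beta>"
    proof (rule ccontr)
      assume "D k l \<noteq> \<beta>"
      then have "\<beta> < D k l" using ge[of k l] ik l \<open>k \<noteq> l\<close> by simp
      then show False using tri[of i k l] ik l by simp
    qed
    obtain n :: int where n: "D l k - D i k = of_int n * D i l" using int[of i l k] ik l by auto
    have e: "D i k = (1 - of_int n) * \<beta>" using n l \<open>D k l = \<beta>\<close> sym[of l k] ik by (simp add: algebra_simps)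
    then have "1 * \<beta> < of_int (1 - n) * \<beta>" using ik by simp
    then have "(1::real) < of_int (1 - n)" using b0 by (simp only: mult_less_cancel_right)
    then have "2 \<le> 1 - n" by linarith
    then have "(2::real) \<le> of_int (1 - n)" by linarith
    then show ?thesis unfolding e using b0 by (intro mult_right_mono) auto
  qed
  define N where "N i = {k. k < d \<and> \<beta> < D i k}" for i
  have finN: "finite (N i)" for i unfolding N_def by simp
  have iN: "i \<notin> N i" if "i < d" for i using diag[OF that] b0 by (simp add: N_def)
  \<comment> \<open>The total excess of a row over \<beta>; as row sums are constant, it is the same
    for every point.\<close>
  define X where "X = r - (real d - 1) * \<beta>"
  have X: "(\<Sum>k\<in>N i. D i k - \<beta>) = X" if i: "i < d" for i
  proof -
    have "(\<Sum>k<d. D i k - \<beta>) = (\<Sum>k\<in>insert i (N i). D i k - \<beta>)"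
      using i ge[of i] by (intro sum.mono_neutral_right) (force simp: N_def)+
    also have "\<dots> = (\<Sum>k\<in>N i. D i k - \<beta>) - \<beta>" using i iN finN diag by simp
    finally show ?thesis using row[OF i] by (simp add: sum_subtractf X_def algebra_simps)
  qed
  \<comment> \<open>The class of \<open>a\<close>. The point \<open>b\<close> lies outside it, so
    the rows of \<open>a\<close> and \<open>b\<close> have different sums over \<open>B\<close>
    unless \<open>X = \<beta>\<close>.\<close>
  define B where "B = insert a (N a)"
  have finB: "finite B" by (simp add: B_def finN)
  have Bd: "k < d" if "k \<in> B" for k using that ab by (auto simp: B_def N_def)
  have Bin: "insert l (N l) = B" if "l \<in> B" for l
  proof (cases "l = a")
    case False
    then have l: "l < d" "\<beta> < D a l" "\<beta> < D l a" using that sym ab by (auto simp: B_def N_def)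
    have "k \<in> insert l (N l) \<longleftrightarrow> k \<in> B" for k
      using tri[of a l k] tri[of l a k] l ab sym[of k a] sym[of k l] by (auto simp: B_def N_def)
    then show ?thesis by blast
  qed (simp add: B_def)
  have \<sigma>in: "(\<Sum>k\<in>B. D l k) = real (card B) * \<beta> + X - \<beta>" if "l \<in> B" for l
  proof -
    have l: "l < d" by (rule Bd[OF that])
    have "(\<Sum>k\<in>B. D l k - \<beta>) = X - \<beta>"
      unfolding Bin[OF that, symmetric] using iN[OF l] finN diag[OF l] X[OF l] by simp
    then show ?thesis by (simp add: sum_subtractf)
  qed
  have \<sigma>out: "(\<Sum>k\<in>B. D l k) = real (card B) * \<beta>" if "l \<notin> B" "l < d" for l
  proof -
    have "D l k = \<beta>" if k: "k \<in> B" for k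
    proof (rule ccontr)
      assume "D l k \<noteq> \<beta>"
      moreover have "l \<noteq> k" using k \<open>l \<notin> B\<close> by auto
      ultimately have "\<beta> < D k l" using ge[of l k] sym[of l k] Bd[OF k] \<open>l < d\<close> by simp
      then have "l \<in> N k" using \<open>l < d\<close> by (simp add: N_def)
      then show False using Bin[OF k] \<open>l \<notin> B\<close> by blast
    qed
    then show ?thesis by simp
  qed
  \<comment> \<open>Sum \<open>square\<close> over \<open>j\<close> in \<open>B\<close>: the row
    sums over \<open>B\<close> take one value inside \<open>B\<close> and one outside, and these
    differ by \<open>X - \<beta>\<close>.\<close>
  have main: "(X - \<beta> + 1) * (\<Sum>k\<in>B. D i k) = real (card B) * (s - \<beta> * r)" if i: "i < d" for i
  proof -
    have "real (card B) * s = (\<Sum>j\<in>B. (\<Sum>k<d. D i k * D k j) + D i j)"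
      using square[OF i Bd] by simp
    also have "\<dots> = (\<Sum>k<d. \<Sum>j\<in>B. D i k * D k j) + (\<Sum>j\<in>B. D i j)"
      by (simp add: sum.distrib) (rule sum.swap)
    also have "(\<Sum>k<d. \<Sum>j\<in>B. D i k * D k j)
        = (\<Sum>k<d. D i k * (real (card B) * \<beta>) + (if k \<in> B then D i k * (X - \<beta>) else 0))"
      unfolding sum_distrib_left[symmetric]
      by (intro sum.cong refl) (auto simp: \<sigma>in \<sigma>out algebra_simps)
    also have "\<dots> = r * (real (card B) * \<beta>) + (\<Sum>k\<in>B. D i k * (X - \<beta>))"
    proof -
      have "{..<d} \<inter> B = B" using Bd by auto
      then show ?thesis
        unfolding sum.distrib row[OF i, symmetric] sum_distrib_right
        by (simp add: sum.inter_restrict[symmetric])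
    qed
    also have "(\<Sum>k\<in>B. D i k * (X - \<beta>)) = (X - \<beta>) * (\<Sum>k\<in>B. D i k)"
      by (simp add: sum_distrib_left mult.commute)
    finally show ?thesis by (simp add: algebra_simps)
  qed
  have aB: "a \<in> B" by (simp add: B_def)
  have bB: "b \<notin> B" using ab by (simp add: B_def N_def)
  \<comment> \<open>Subtract \<open>main\<close> for \<open>b\<close> from \<open>main\<close> for
    \<open>a\<close>; the right-hand sides agree.\<close>
  have "(X - \<beta> + 1) * (X - \<beta>) = 0"
    using main[OF ab(1)] main[OF ab(2)] \<sigma>in[OF aB] \<sigma>out[OF bB ab(2)] by (simp add: algebra_simps)
  then consider "X = \<beta> - 1" | "X = \<beta>" by force
  then show ?thesis
  proof cases
    case 1
    \<comment> \<open>A far point would contribute at least \<beta> to an excess of only \<beta> -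
      1.\<close>
    have "N i = {}" if i: "i < d" for i
    proof (rule ccontr)
      assume "N i \<noteq> {}"
      then obtain k where k: "k \<in> N i" by blast
      then have "D i k - \<beta> \<le> (\<Sum>k\<in>N i. D i k - \<beta>)"
        using finN by (intro member_le_sum) (auto simp: N_def)
      then show False using X[OF i] dbl[of i k] k i 1 by (simp add: N_def)
    qed
    then have *: "N i = {}" if "i < d" for i using that by blast
    then have "X = 0" using X[OF ab(1)] ab by simp
    then have "\<beta> = 1" using 1 by simp
    then have "D i j = 1" if "i < d" "j < d" "i \<noteq> j" for i j
      using *[OF that(1)] ge[OF that] that by (force simp: N_def)
    then show ?thesis by blast
  next
    case 2
    \<comment> \<open>Each far point contributes at least \<beta> and the contributions add up to
      \<beta>: there is exactly one, at distance \<open>2 * \<beta>\<close>.\<close>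
    have "\<exists>k. N i = {k} \<and> D i k = 2 * \<beta>" if i: "i < d" for i
    proof -
      have "N i \<noteq> {}" using X[OF i] 2 b0 by auto
      then obtain k where k: "k \<in> N i" by blast
      have "(\<Sum>k\<in>N i. D i k - \<beta>) = (D i k - \<beta>) + (\<Sum>k\<in>N i - {k}. D i k - \<beta>)"
        using finN k by (simp add: sum.remove)
      then have e: "\<beta> = (D i k - \<beta>) + (\<Sum>k\<in>N i - {k}. D i k - \<beta>)" using X[OF i] 2 by simp
      have k2: "2 * \<beta> \<le> D i k" using dbl[of i k] k i by (simp add: N_def)
      have "N i - {k} = {}"
      proof (rule ccontr)
        assume "N i - {k} \<noteq> {}"
        then have "0 < (\<Sum>k\<in>N i - {k}. D i k - \<beta>)"
          using finN by (intro sum_pos) (auto simp: N_def)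
        then show False using e k2 by simp
      qed
      then have "N i = {k}" using k by blast
      then show ?thesis using e by (intro exI[of _ k]) simp
    qed
    then obtain p where p: "\<And>i. i < d \<Longrightarrow> N i = {p i} \<and> D i (p i) = 2 * \<beta>" by metis
    have pd: "p i < d" "p i \<noteq> i" if i: "i < d" for i
      using p[OF i] iN[OF i] by (auto simp: N_def)
    have pp: "p (p i) = i" if i: "i < d" for i
    proof -
      have "i \<in> N (p i)" using p[OF i] pd[OF i] sym[OF i pd(1)[OF i]] b0 i by (simp add: N_def)
      then show ?thesis using p[OF pd(1)[OF i]] by auto
    qed
    have rest: "D i j = \<beta>" if "i < d" "j < d" "j \<noteq> i" "j \<noteq> p i" for i j
      using p[OF that(1)] ge[of i j] that by (force simp: N_def)
    \<comment> \<open>Compare \<open>square\<close> at \<open>(a, a)\<close> and at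
      \<open>(a, p a)\<close>: rows \<open>a\<close> and \<open>p a\<close> differ only at these two
      points, so \<open>4 * \<beta>\<^sup>2 = 2 * \<beta>\<close>, which fixes \<beta> =
      1/2.\<close>
    have "(\<Sum>k<d. D a k * D k a) - (\<Sum>k<d. D a k * D k (p a)) = D a (p a)"
      using square[OF ab(1) ab(1)] square[OF ab(1) pd(1)[OF ab(1)]] diag ab by simp
    moreover have "(\<Sum>k<d. D a k * D k a) - (\<Sum>k<d. D a k * D k (p a))
        = (\<Sum>k<d. if k = p a then 4 * \<beta>\<^sup>2 else 0)"
      unfolding sum_subtractf[symmetric]
    proof (intro sum.cong refl)
      fix k assume "k \<in> {..<d}"
      then have k: "k < d" by simp
      note pa = pd[OF ab(1)]
      show "D a k * D k a - D a k * D k (p a) = (if k = p a then 4 * \<beta>\<^sup>2 else 0)"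
      proof (cases "k = p a \<or> k = a")
        case True
        then show ?thesis using p[OF ab(1)] sym[OF ab(1) pa(1)] diag[OF pa(1)] diag[OF ab(1)] pa
          by (auto simp: power2_eq_square)
      next
        case False
        then show ?thesis
          using rest[of a k] rest[of "p a" k] pp[OF ab(1)] k ab pa sym[of k a] sym[of k "p a"] by simp
      qed
    qed
    ultimately have "4 * \<beta>\<^sup>2 = 2 * \<beta>" using p[OF ab(1)] pd[OF ab(1)] by simp
    then have "\<beta> = 1/2" using b0 by (simp add: power2_eq_square)
    then show ?thesis using p pd pp rest by (intro disjI2 exI[of _ p]) auto
  qed
qed

lemma ip_tp: "ip (tp X) Y = ip X (tp Y)"
proof -
  have "ip (tp X) Y = tr (tp (adj (tp X) * Y))" by (simp only: ip_def tr_simps(6))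
  also have "\<dots> = tr (tp Y * adj X)" by (simp only: tp_mult tp_simps)
  also have "\<dots> = ip X (tp Y)" by (simp add: ip_def tr_comm)
  finally show ?thesis .
qed

text \<open>Irreducibility passes from Sym^2 V to V. The symmetric tensors with image in an
  invariant \<open>U\<close> form an invariant subspace, nonzero since it contains
  \<open>u * tp u\<close>. So it is everything, and applying \<open>x * tp x\<close> to the
  conjugate of \<open>x\<close> puts \<open>x\<close> into \<open>U\<close>.\<close>

lemma sym_irr_vecs:
  assumes irr: "sym_irr d S" and S: "S \<subseteq> gl d"
    and U: "csubspace U" "U \<subseteq> vecs d" "\<And>X x. X \<in> S \<Longrightarrow> x \<in> U \<Longrightarrow> X * x \<in> U" and ne: "U \<noteq> {0}"
  shows "U = vecs d"
proof -
  define W where "W = {M \<in> sym_mats d. \<forall>x\<in>vecs d. M * x \<in> U}"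
  have sub: "W \<subseteq> sym_mats d" by (auto simp: W_def)
  have c: "csubspace W"
    using csubspace_sym_mats[of d] U(1)
    by (auto simp: W_def csubspace_def distrib_right)
  have inv: "act X M \<in> W" if "X \<in> S" "M \<in> W" for X M
  proof -
    have X: "X \<in> gl d" using that S by blast
    have "act X M \<in> sym_mats d" using that X by (auto simp: W_def sym_mats_def act_def add.commute)
    moreover have "act X M * x \<in> U" if x: "x \<in> vecs d" for x
    proof -
      have "X * (M * x) \<in> U" using U(3) \<open>X \<in> S\<close> \<open>M \<in> W\<close> x by (simp add: W_def)
      moreover have "M * (tp X * x) \<in> U" using \<open>M \<in> W\<close> x X by (simp add: W_def)
      ultimately show ?thesis using U(1) by (simp add: act_def distrib_right mult.assoc csubspace_def)
    qed
    ultimately show ?thesis by (simp add: W_def)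
  qed
  have rank1: "x * tp x \<in> sym_mats d" if "x \<in> vecs d" for x
    using that by (simp add: sym_mats_def vecs_gl)
  have tpx: "tp x * y = cs (ip (tp (adj x)) y) (unit_mat 0 0)" if "x \<in> vecs d" "y \<in> vecs d" for x y
  proof -
    have "ent (adj (tp x)) i j \<noteq> 0 \<Longrightarrow> i < d \<and> j = 0" for i j
      using that(1) by (auto simp: vecs_def)
    then have "adj (tp x) \<in> vecs d" by (simp add: vecs_def)
    then show ?thesis using vec_dot[OF that(2), of "adj (tp x)"] by simp
  qed
  obtain u where u: "u \<in> U" "u \<noteq> 0" using ne U(1) by (auto simp: csubspace_def)
  then have uv: "u \<in> vecs d" using U by blast
  have outer: "x * tp x * y = cs (ip (tp (adj x)) y) x" if "x \<in> vecs d" "y \<in> vecs d" for x y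
    using that tpx by (simp add: mult.assoc)
  have "u * tp u \<in> W"
    using uv u U(1) by (auto simp: W_def rank1 outer csubspace_def)
  moreover have conj_ne: "ip (tp (adj x)) (tp (adj x)) \<noteq> 0" if "x \<noteq> 0" for x
  proof
    assume "ip (tp (adj x)) (tp (adj x)) = 0"
    then have "tp (adj x) = 0" by simp
    then have "adj (tp (adj (tp x))) = 0" by simp
    then show False using that by simp
  qed
  have conj_vec: "tp (adj x) \<in> vecs d" if "x \<in> vecs d" for x
    using that by (auto simp: vecs_def)
  have "u * tp u \<noteq> 0"
  proof
    assume "u * tp u = 0"
    then have "cs (ip (tp (adj u)) (tp (adj u))) u = 0" using outer[OF uv conj_vec[OF uv]] by simp
    then show False using conj_ne u by simp
  qed
  ultimately have "W = sym_mats d" using irr c sub inv unfolding sym_irr_def by blast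
  have "x \<in> U" if x: "x \<in> vecs d" for x
  proof (cases "x = 0")
    case False
    have "x * tp x \<in> W" using rank1[OF x] \<open>W = sym_mats d\<close> by simp
    then have "cs (ip (tp (adj x)) (tp (adj x))) x \<in> U"
      using outer[OF x conj_vec[OF x]] conj_vec[OF x] by (auto simp: W_def)
    then have "cs (inverse (ip (tp (adj x)) (tp (adj x)))) (cs (ip (tp (adj x)) (tp (adj x))) x) \<in> U"
      using U(1) unfolding csubspace_def by blast
    then show ?thesis using conj_ne[OF False] by simp
  qed (use U(1) in \<open>simp add: csubspace_def\<close>)
  then show ?thesis using U by blast
qed

section \<open>Orthonormal systems and simultaneous eigenspaces\<close>

definition onb :: "nat \<Rightarrow> nat \<Rightarrow> (nat \<Rightarrow> fmat) \<Rightarrow> bool" where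
  "onb d m v \<longleftrightarrow> (\<forall>i<m. v i \<in> vecs d) \<and> (\<forall>i<m. \<forall>j<m. ip (v i) (v j) = (if i = j then 1 else 0))"

text \<open>The squared norm of the complementary projection counts the missing vectors. It stands
  in for dimension theory: \<open>d\<close> vectors are complete, fewer leave a nonzero
  complement.\<close>

lemma onb_defect:
  assumes "onb d m v"
  defines "F \<equiv> Idm d - (\<Sum>i<m. v i * adj (v i))"
  shows "ip F F = of_nat d - of_nat m"
proof -
  have v: "\<And>i. i < m \<Longrightarrow> v i \<in> vecs d" "\<And>i j. i < m \<Longrightarrow> j < m \<Longrightarrow> ip (v i) (v j) = (if i = j then 1 else 0)"
    using assms by (auto simp: onb_def)
  define G where "G = (\<Sum>i<m. v i * adj (v i))"
  have 1: "ip (Idm d) (Idm d) = of_nat d" by (simp add: ip_def)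
  have 2: "ip (Idm d) G = of_nat m"
    by (simp add: G_def ip_sum ip_outer_left v vecs_gl)
  then have 3: "ip G (Idm d) = of_nat m" by (metis complex_cnj_of_nat ip_cnj)
  have "ip G G = (\<Sum>i<m. \<Sum>j<m. if i = j then 1 else 0)"
    unfolding G_def ip_sum by (intro sum.cong refl) (auto simp: ip_outer[of _ d] v)
  then have 4: "ip G G = of_nat m" by simp
  show ?thesis unfolding F_def G_def[symmetric] using 1 2 3 4 by simp
qed

lemma onb_complete: "onb d d v \<Longrightarrow> (\<Sum>i<d. v i * adj (v i)) = Idm d"
proof -
  assume "onb d d v"
  then have "ip (Idm d - (\<Sum>i<d. v i * adj (v i))) (Idm d - (\<Sum>i<d. v i * adj (v i))) = 0"
    by (simp only: onb_defect diff_self)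
  then show ?thesis by (rule ip_diff_eq_0[symmetric])
qed

lemma onb_expand:
  assumes "onb d d v" "x \<in> vecs d" shows "x = (\<Sum>i<d. cs (ip (v i) x) (v i))"
proof -
  have "x = Idm d * x" using assms by (simp add: vecs_gl)
  also have "\<dots> = (\<Sum>i<d. v i * adj (v i) * x)"
    unfolding onb_complete[OF assms(1), symmetric] by (simp add: sum_distrib_right)
  also have "\<dots> = (\<Sum>i<d. cs (ip (v i) x) (v i))"
    using assms by (intro sum.cong refl) (simp add: outer_app onb_def)
  finally show ?thesis .
qed

lemma onb_expand_gl:
  assumes "onb d d v" "X \<in> gl d"
  shows "X = (\<Sum>i<d. \<Sum>j<d. cs (ip (v i) (X * v j)) (v i * adj (v j)))"
proof -
  have v: "v j \<in> vecs d" if "j < d" for j using assms that by (auto simp: onb_def)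
  have "X = X * (\<Sum>j<d. v j * adj (v j))" using assms by (simp add: onb_complete)
  also have "\<dots> = (\<Sum>j<d. X * v j * adj (v j))" by (simp add: sum_distrib_left mult.assoc)
  also have "\<dots> = (\<Sum>j<d. (\<Sum>i<d. cs (ip (v i) (X * v j)) (v i)) * adj (v j))"
    using assms v by (intro sum.cong refl) (simp add: onb_expand[OF assms(1), symmetric])
  also have "\<dots> = (\<Sum>j<d. \<Sum>i<d. cs (ip (v i) (X * v j)) (v i * adj (v j)))"
    by (simp add: sum_distrib_right)
  finally show ?thesis by (subst sum.swap) 
qed

lemma onb_tr:
  assumes "onb d d v" "X \<in> gl d" shows "tr X = (\<Sum>j<d. ip (v j) (X * v j))"
proof -
  have "X = X * (\<Sum>j<d. v j * adj (v j))" using assms by (simp add: onb_complete)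
  also have "\<dots> = (\<Sum>j<d. X * v j * adj (v j))" by (simp add: sum_distrib_left mult.assoc)
  finally have "tr X = tr (\<Sum>j<d. X * v j * adj (v j))" by simp
  then show ?thesis by (simp add: tr_sum tr_outer)
qed

text \<open>Induction on the number \<open>n\<close> of operators already made scalar. All
  \<open>M\<close> operators keep preserving the current subspace, because commutativity keeps each
  new eigenspace invariant.\<close>

lemma common_eigenspace:
  fixes H :: "nat \<Rightarrow> fmat"
  assumes U: "csubspace U" "U \<subseteq> gl N" "U \<noteq> {0}"
    and inv: "\<And>i x. i < M \<Longrightarrow> x \<in> U \<Longrightarrow> H i * x \<in> U"
    and comm: "\<And>i j. i < M \<Longrightarrow> j < M \<Longrightarrow> H i * H j = H j * H i"
  shows "n \<le> M \<Longrightarrow> \<exists>W. csubspace W \<and> W \<subseteq> U \<and> W \<noteq> {0} \<and> (\<forall>i<M. \<forall>x\<in>W. H i * x \<in> W) \<and>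
     (\<forall>i<n. \<exists>l. \<forall>x\<in>W. H i * x = cs l x)"
proof (induction n)
  case 0
  then show ?case using U inv by (intro exI[of _ U]) auto
next
  case (Suc n)
  then obtain W where W: "csubspace W" "W \<subseteq> U" "W \<noteq> {0}" "\<forall>i<M. \<forall>x\<in>W. H i * x \<in> W"
    "\<forall>i<n. \<exists>l. \<forall>x\<in>W. H i * x = cs l x" by auto
  have "W \<subseteq> gl N" using W U by blast
  moreover have "\<And>x. x \<in> W \<Longrightarrow> H n * x \<in> W" using W Suc by auto
  ultimately obtain x l where x: "x \<in> W" "x \<noteq> 0" "H n * x = cs l x"
    using ex_eigenvector[OF clinear_map_mult[of "H n"] W(1)] W(3) by metis
  define W' where "W' = {x \<in> W. H n * x = cs l x}"
  have "csubspace W'" using W(1) by (auto simp: W'_def csubspace_def distrib_left mult.commute)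
  moreover have "H i * y \<in> W'" if "i < M" "y \<in> W'" for i y
  proof -
    have "H n * (H i * y) = H i * (H n * y)"
      using comm[of n i] that Suc by (simp flip: mult.assoc)
    then show ?thesis using that W by (simp add: W'_def)
  qed
  moreover have "W' \<noteq> {0}" using x by (auto simp: W'_def)
  moreover have "\<exists>l. \<forall>x\<in>W'. H i * x = cs l x" if "i < Suc n" for i
  proof (cases "i = n")
    case False
    then have "i < n" using that by simp
    then obtain l' where "\<forall>x\<in>W. H i * x = cs l' x" using W(5) by blast
    then show ?thesis by (auto simp: W'_def)
  qed (auto simp: W'_def)
  moreover have "W' \<subseteq> U" using W by (auto simp: W'_def)
  ultimately show ?case by (intro exI[of _ W']) auto
qed

context star_alg
begin

text \<open>The \<open>v i\<close> are common eigenvectors of their own \<open>Q (v i)\<close>; the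
  latter commute and take the place of a Cartan subalgebra.\<close>

definition torus :: "nat \<Rightarrow> (nat \<Rightarrow> fmat) \<Rightarrow> bool" where
  "torus m v \<longleftrightarrow> onb d m v \<and> (\<forall>i<m. \<forall>j<m. \<exists>r::real. Q (v i) * v j = cs (of_real r) (v j))"

text \<open>The orthogonal complement of the \<open>v i\<close> is nonzero by
  \<open>onb_defect\<close> and stable under the Hermitian \<open>Q (v i)\<close>, so it contains a
  common unit eigenvector. \<open>Q_pair_sym\<close> makes the old vectors eigenvectors of the new
  operator.\<close>

lemma torus_extend:
  assumes T: "torus m v" and m: "m < d"
  shows "\<exists>x. torus (Suc m) (v(m := x))"
proof -
  have v: "\<And>i. i < m \<Longrightarrow> v i \<in> vecs d" "\<And>i j. i < m \<Longrightarrow> j < m \<Longrightarrow> ip (v i) (v j) = (if i = j then 1 else 0)"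
    and o: "onb d m v"
    using T by (auto simp: torus_def onb_def)
  have ex: "\<exists>r::real. Q (v i) * v j = cs (of_real r) (v j)" if "i < m" "j < m" for i j
    using T that by (auto simp: torus_def)
  define U where "U = {x \<in> vecs d. \<forall>i<m. ip (v i) x = 0}"
  have csU: "csubspace U" by (auto simp: csubspace_def U_def)
  have Ugl: "U \<subseteq> gl d" by (auto simp: U_def vecs_gl)
  define F where "F = Idm d - (\<Sum>i<m. v i * adj (v i))"
  have Fgl: "F \<in> gl d" unfolding F_def by (intro gl_closed gl_sum) (auto simp: v vecs_gl)
  have "ip F F = of_nat d - of_nat m" unfolding F_def by (rule onb_defect[OF o])
  then have "F \<noteq> 0" using m by auto
  then obtain x where x: "x \<in> vecs d" "F * x \<noteq> 0"
    using gl_eqI[OF Fgl, of 0] by auto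
  have "F * x \<in> U"
  proof -
    have Fx: "F * x = x - (\<Sum>i<m. cs (ip (v i) x) (v i))"
      using x v by (simp add: F_def left_diff_distrib sum_distrib_right outer_app vecs_gl)
    have "ip (v i) (F * x) = 0" if "i < m" for i
    proof -
      have "(\<Sum>j<m. ip (v j) x * ip (v i) (v j)) = (\<Sum>j<m. if j = i then ip (v i) x else 0)"
        using that by (intro sum.cong) (auto simp: v)
      then show ?thesis using that unfolding Fx by (simp add: ip_sum)
    qed
    then show ?thesis using x Fgl by (simp add: U_def)
  qed
  then have Une: "U \<noteq> {0}" using x by auto
  have inv: "Q (v i) * x \<in> U" if "i < m" "x \<in> U" for i x
  proof -
    have "ip (v j) (Q (v i) * x) = 0" if j: "j < m" for j
    proof -
      obtain r where r: "Q (v i) * v j = cs (complex_of_real r) (v j)" using ex \<open>i < m\<close> j by blast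
      have "ip (v j) (Q (v i) * x) = ip (Q (v i) * v j) x" by (simp add: ip_mult_left)
      then show ?thesis using \<open>x \<in> U\<close> j by (simp add: r U_def)
    qed
    then show ?thesis using that by (simp add: U_def)
  qed
  \<comment> \<open>\<open>Q (v i)\<close> commutes with the projector onto its eigenvector
    \<open>v j\<close>, and equivariance of \<open>pr\<close> carries this over to
    \<open>Q (v j)\<close>.\<close>
  have cm: "Q (v i) * Q (v j) = Q (v j) * Q (v i)" if ij: "i < m" "j < m" for i j
  proof -
    obtain r where r: "Q (v i) * v j = cs (complex_of_real r) (v j)" using ex ij by blast
    have "comm (Q (v i)) (Q (v j)) = pr (comm (Q (v i)) (v j * adj (v j)))"
      using pr_equiv[of "v i * adj (v i)" "v j * adj (v j)"] by (simp add: Q_def)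
    also have "comm (Q (v i)) (v j * adj (v j)) = Q (v i) * v j * adj (v j) - v j * adj (Q (v i) * v j)"
      by (simp add: comm_def mult.assoc)
    also have "\<dots> = 0" unfolding r by simp
    finally show ?thesis by (simp add: comm_def)
  qed
  obtain W where W: "csubspace W" "W \<subseteq> U" "W \<noteq> {0}" "\<forall>i<m. \<exists>l. \<forall>x\<in>W. Q (v i) * x = cs l x"
    using common_eigenspace[OF csU Ugl Une, of m "\<lambda>i. Q (v i)" m] inv cm by auto
  obtain y where y: "y \<in> W" "y \<noteq> 0" using W by (auto simp: csubspace_def)
  obtain r where r: "ip (cs (complex_of_real r) y) (cs (complex_of_real r) y) = 1"
    using normalize_vec[OF y(2)] by blast
  define z where "z = cs (complex_of_real r) y"
  have zW: "z \<in> W" using y W unfolding z_def csubspace_def by blast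
  have z: "z \<in> vecs d" "ip z z = 1" "\<And>i. i < m \<Longrightarrow> ip (v i) z = 0"
  proof -
    have "z \<in> U" using zW W(2) by blast
    then show "z \<in> vecs d" "\<And>i. i < m \<Longrightarrow> ip (v i) z = 0" by (auto simp: U_def)
  qed (use r in \<open>simp add: z_def\<close>)
  have z': "ip z (v i) = 0" if "i < m" for i using z(3)[OF that] ip_cnj[of "v i" z] by simp
  have eig: "\<exists>l::real. Q (v i) * z = cs (of_real l) z" if i: "i < m" for i
  proof -
    obtain l where l: "Q (v i) * z = cs l z" using W(4) zW i by blast
    have "ip z (Q (v i) * z) = ip (Q (v i) * z) z" by (simp add: ip_mult_left)
    then have "cnj l = l" using z by (simp add: l)
    then have "of_real (Re l) = l" by (simp add: complex_eq_iff)
    then show ?thesis using l by (intro exI[of _ "Re l"]) simp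
  qed
  have eig': "\<exists>l::real. Q z * v i = cs (of_real l) (v i)" if i: "i < m" for i
  proof -
    obtain l where l: "Q (v i) * z = cs (complex_of_real l) z" using eig i by blast
    have "Q (v i) * z = cs (of_real (\<kappa> - (\<kappa> - l))) z" by (simp add: l)
    from Q_pair_sym[OF _ _ z(1,2,3) this] v i
    have "Q z * v i = cs (of_real (\<kappa> - (\<kappa> - l))) (v i)" by simp
    then show ?thesis by (rule exI)
  qed
  have "torus (Suc m) (v(m := z))"
    unfolding torus_def onb_def
    using v z z' eig eig' ex Q_self[OF z(1,2)] by (auto simp: less_Suc_eq)
  then show ?thesis by blast
qed

lemma ex_torus: "\<exists>v. torus d v"
proof -
  have "m \<le> d \<Longrightarrow> \<exists>v. torus m v" for m
  proof (induction m)
    case 0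
    then show ?case by (auto simp: torus_def onb_def)
  next
    case (Suc m)
    then obtain v where "torus m v" by auto
    then show ?case using torus_extend[of m v] Suc by auto
  qed
  then show ?thesis by blast
qed

lemma two_le_d: "2 \<le> d"
proof (rule ccontr)
  assume "\<not> 2 \<le> d"
  then have d: "d = 1" using d_pos by simp
  obtain i where i: "i \<in> I" using ne by blast
  have "ent (A i) 0 0 = 0" using tr0[OF i] tr_gl[OF gl[OF i]] d by simp
  then have "A i = 0" using gl[OF i] d
    by (intro fmat_eqI) (metis ent_simps(1) gl_ent less_one not_le)
  then show False using orth[OF i i] by simp
qed

end

section \<open>The Gram matrix of the commuting operators \<open>Q (v i)\<close>\<close>

locale torus_alg = star_alg +
  fixes v :: "nat \<Rightarrow> fmat"
  assumes torus: "torus d v"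
begin

lemma v [simp]: "i < d \<Longrightarrow> v i \<in> vecs d" and onb: "onb d d v"
  and ip_v: "i < d \<Longrightarrow> j < d \<Longrightarrow> ip (v i) (v j) = (if i = j then 1 else 0)"
  using torus by (auto simp: torus_def onb_def)

text \<open>\<open>\<kappa> - D i j\<close> is both the eigenvalue of \<open>Q (v i)\<close> on
  \<open>v j\<close> and the inner product of \<open>Q (v i)\<close> with
  \<open>Q (v j)\<close>.\<close>

definition D :: "nat \<Rightarrow> nat \<Rightarrow> real" where "D i j = \<kappa> - Re (ip (v j) (Q (v i) * v j))"

lemma Q_v: "i < d \<Longrightarrow> j < d \<Longrightarrow> Q (v i) * v j = cs (of_real (\<kappa> - D i j)) (v j)"
proof -
  assume ij: "i < d" "j < d"
  then obtain r where r: "Q (v i) * v j = cs (complex_of_real r) (v j)"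
    using torus by (auto simp: torus_def)
  then have "D i j = \<kappa> - r" using ij by (simp add: D_def ip_v)
  then show ?thesis using r by simp
qed

lemma ip_Q_v: "i < d \<Longrightarrow> j < d \<Longrightarrow> k < d \<Longrightarrow> ip (v k) (Q (v i) * v j) = (if k = j then of_real (\<kappa> - D i j) else 0)"
  by (simp add: Q_v ip_v)

lemma D_diag: "i < d \<Longrightarrow> D i i = 0"
  by (simp add: D_def Q_self ip_v)

lemma D_sym: "i < d \<Longrightarrow> j < d \<Longrightarrow> D i j = D j i"
proof (cases "i = j")
  case False
  assume ij: "i < d" "j < d"
  have "Q (v j) * v i = cs (of_real (\<kappa> - D i j)) (v i)"
    by (rule Q_pair_sym) (use ij False ip_v Q_v in auto)
  then have "ip (v i) (Q (v j) * v i) = of_real (\<kappa> - D i j)" using ij by (simp add: ip_v)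
  then have "complex_of_real (\<kappa> - D j i) = of_real (\<kappa> - D i j)" using ij by (simp add: ip_Q_v)
  then show ?thesis unfolding of_real_eq_iff by simp
qed simp

lemma D_pos: "i < d \<Longrightarrow> j < d \<Longrightarrow> i \<noteq> j \<Longrightarrow> 0 < D i j"
  by (rule delta_pos[of "v i" "v j"]) (auto simp: ip_v Q_v)

lemma D_row: "i < d \<Longrightarrow> (\<Sum>j<d. D i j) = real d * \<kappa>"
proof -
  assume i: "i < d"
  have "(\<Sum>j<d. complex_of_real (\<kappa> - D i j)) = tr (Q (v i))"
    using i by (subst onb_tr[OF onb]) (auto simp: ip_Q_v)
  also have "\<dots> = 0" by (simp add: Q_def)
  finally have "complex_of_real (\<Sum>j<d. \<kappa> - D i j) = 0" by simp
  then have "(\<Sum>j<d. \<kappa> - D i j) = 0" unfolding of_real_eq_0_iff .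
  then show ?thesis by (simp add: sum_subtractf)
qed

lemma Q_diag: "i < d \<Longrightarrow> Q (v i) = (\<Sum>j<d. cs (of_real (\<kappa> - D i j)) (v j * adj (v j)))"
proof -
  assume i: "i < d"
  have "Q (v i) = Q (v i) * (\<Sum>j<d. v j * adj (v j))" by (simp add: onb_complete[OF onb])
  also have "\<dots> = (\<Sum>j<d. Q (v i) * v j * adj (v j))" by (simp add: sum_distrib_left mult.assoc)
  also have "\<dots> = (\<Sum>j<d. cs (of_real (\<kappa> - D i j)) (v j * adj (v j)))"
    using i by (intro sum.cong) (auto simp: Q_v simp del: of_real_diff)
  finally show ?thesis .
qed

text \<open>Expand \<open>Q (v i)\<close> in the diagonal projectors and apply \<open>pr\<close>,
  which fixes the left side and turns each projector into \<open>Q (v k)\<close>. The resulting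
  relation says that the Gram matrix is its own square.\<close>

lemma D_square: "i < d \<Longrightarrow> j < d \<Longrightarrow> (\<Sum>k<d. D i k * D k j) + D i j = \<kappa> + real d * \<kappa>\<^sup>2"
proof -
  assume ij: "i < d" "j < d"
  have "Q (v i) = pr (Q (v i))" by simp
  also have "\<dots> = (\<Sum>k<d. cs (of_real (\<kappa> - D i k)) (Q (v k)))"
    by (subst Q_diag[OF ij(1)]) (simp only: pr_sum pr_simps Q_def)
  finally have "ip (v j) (Q (v i) * v j) = ip (v j) ((\<Sum>k<d. cs (of_real (\<kappa> - D i k)) (Q (v k))) * v j)"
    by simp
  then have "complex_of_real (\<kappa> - D i j) = (\<Sum>k<d. of_real (\<kappa> - D i k) * of_real (\<kappa> - D k j))"
    using ij by (simp add: sum_distrib_right ip_sum ip_Q_v del: of_real_diff)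
  also have "\<dots> = of_real (\<Sum>k<d. (\<kappa> - D i k) * (\<kappa> - D k j))" by simp
  finally have e: "\<kappa> - D i j = (\<Sum>k<d. (\<kappa> - D i k) * (\<kappa> - D k j))" unfolding of_real_eq_iff .
  have "(\<Sum>k<d. D k j) = real d * \<kappa>"
  proof -
    have "(\<Sum>k<d. D k j) = (\<Sum>k<d. D j k)" using ij by (intro sum.cong) (auto simp: D_sym)
    then show ?thesis using D_row ij by simp
  qed
  moreover have "(\<Sum>k<d. (\<kappa> - D i k) * (\<kappa> - D k j))
      = real d * \<kappa>\<^sup>2 - \<kappa> * (\<Sum>k<d. D i k) - \<kappa> * (\<Sum>k<d. D k j) + (\<Sum>k<d. D i k * D k j)"
    by (simp add: algebra_simps sum.distrib sum_subtractf sum_distrib_left power2_eq_square)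
  ultimately show ?thesis using e D_row[OF ij(1)] by (simp add: power2_eq_square algebra_simps)
qed

lemma D_int:
  assumes ijk: "i < d" "j < d" "k < d" "i \<noteq> j"
  shows "\<exists>n::int. D j k - D i k = of_int n * D i j"
proof (rule diff_eigenvalue_int)
  show "v k \<noteq> 0" using ip_v[OF ijk(3) ijk(3)] by auto
  show "(Q (v i) - Q (v j)) * v k = cs (of_real (D j k - D i k)) (v k)"
    using ijk by (simp add: left_diff_distrib Q_v cs_diff)
qed (use ijk in \<open>auto simp: ip_v Q_v\<close>)

text \<open>These norms identify \<pi> in both cases: a projection whose range contains that of
  \<open>pr\<close> and which has the same norm on an elementary matrix agrees with
  \<open>pr\<close> there.\<close>

lemma ip_pr_outer:
  assumes ij: "i < d" "j < d"
  shows "ip (pr (v i * adj (v j))) (pr (v i * adj (v j))) = (if i = j then of_real \<kappa> else of_real (D i j))"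
proof (cases "i = j")
  case True
  then show ?thesis using ij ip_Q_self[of "v i"] by (simp add: Q_def ip_v)
next
  case False
  then show ?thesis using ij nsq_raise[of "v j" "v i" "D j i"] by (simp add: ip_v Q_v D_sym)
qed

lemma D_dichotomy: "(\<forall>i<d. \<forall>j<d. i \<noteq> j \<longrightarrow> D i j = 1) \<or>
    (\<exists>p. \<forall>i<d. p i < d \<and> p i \<noteq> i \<and> p (p i) = i \<and> D i (p i) = 1 \<and> (\<forall>j<d. j \<noteq> i \<and> j \<noteq> p i \<longrightarrow> D i j = 1/2))"
  by (rule distance_matrix_dichotomy[OF two_le_d D_sym D_diag D_pos D_row D_square D_int])

text \<open>Off the diagonal an elementary matrix and its projection both have norm 1 and so
  coincide. On the diagonal \<open>Q_diag\<close> gives \<open>v i * adj (v i)\<close> up to a fixed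
  scalar matrix, and these scalars cancel when the trace is 0.\<close>

lemma pr_outer_sl:
  assumes D1: "\<forall>i<d. \<forall>j<d. i \<noteq> j \<longrightarrow> D i j = 1" and X: "X \<in> gl d" "tr X = 0"
  shows "pr X = X"
proof -
  have d0: "0 < d" by (rule d_pos)
  have "(\<Sum>j<d. D 0 j) = (\<Sum>j<d. 1 - (if j = 0 then 1 else 0))"
    using D1 d0 D_diag by (intro sum.cong) auto
  then have k: "real d * \<kappa> = real d - 1" using D_row[OF d0] d0 by (simp add: sum_subtractf)
  define c where "c = complex_of_real (1 - \<kappa>)"
  have E: "pr (v i * adj (v j)) = v i * adj (v j) - cs (c * ip (v j) (v i)) (Idm d)" if ij: "i < d" "j < d" for i j
  proof (cases "i = j")
    case True
    have "Q (v i) = (\<Sum>k<d. (if k = i then v i * adj (v i) else 0) - cs c (v k * adj (v k)))"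
      unfolding Q_diag[OF ij(1)] using ij D1 D_diag[OF ij(1)]
      by (intro sum.cong refl) (auto simp: c_def cs_diff)
    also have "\<dots> = v i * adj (v i) - cs c (Idm d)"
      using ij by (simp add: sum_subtractf cs_sum[symmetric] onb_complete[OF onb])
    finally show ?thesis using True ij by (simp add: ip_v Q_def)
  next
    case False
    let ?E = "v i * adj (v j)"
    have "ip (pr ?E) (pr ?E) = 1" using ip_pr_outer[OF ij] False D1 ij by simp
    moreover have "ip (pr ?E) ?E = ip (pr ?E) (pr ?E)" "ip ?E (pr ?E) = ip (pr ?E) (pr ?E)"
      by (simp_all add: pr_self)
    moreover have "ip ?E ?E = 1" using ij by (simp add: ip_outer[of _ d] ip_v)
    ultimately have "ip (pr ?E - ?E) (pr ?E - ?E) = 0" by simp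
    then have "pr ?E = ?E" by (rule ip_diff_eq_0)
    then show ?thesis using ij False by (simp add: ip_v)
  qed
  have Xe: "X = (\<Sum>i<d. \<Sum>j<d. cs (ip (v i) (X * v j)) (v i * adj (v j)))"
    by (rule onb_expand_gl[OF onb X(1)])
  have "pr X = (\<Sum>i<d. \<Sum>j<d. cs (ip (v i) (X * v j)) (pr (v i * adj (v j))))"
    by (subst Xe) (simp add: pr_sum)
  also have "\<dots> = (\<Sum>i<d. \<Sum>j<d. cs (ip (v i) (X * v j)) (v i * adj (v j))
      - (if j = i then cs (ip (v i) (X * v i) * c) (Idm d) else 0))"
    by (intro sum.cong refl) (auto simp: E ip_v)
  also have "\<dots> = X - (\<Sum>i<d. cs (ip (v i) (X * v i) * c) (Idm d))"
    unfolding sum_subtractf Xe[symmetric] by simp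
  also have "(\<Sum>i<d. cs (ip (v i) (X * v i) * c) (Idm d)) = cs (tr X * c) (Idm d)"
    by (simp add: onb_tr[OF onb X(1)] cs_sum_left sum_distrib_right)
  finally show ?thesis using X by simp
qed

end

section \<open>The symplectic case\<close>

context star_alg
begin

text \<open>Expand each \<open>A k * u\<close> in the basis \<open>v\<close>; the coefficients
  recombine into \<open>pr (u * adj (v i))\<close>. This expresses \<open>tt\<close> through
  \<open>pr\<close> on all of V \<otimes> V and not only on symmetric tensors.\<close>

lemma tt_outer:
  assumes o: "onb d d v" and u: "u \<in> vecs d" and x: "x \<in> vecs d"
  shows "tt (u * tp x) = - (\<Sum>i<d. v i * tp (pr (u * adj (v i)) * x))"
proof -
  have "pr (u * adj (v i)) * x = - (\<Sum>k\<in>I. cs (ip (v i) (A k * u)) (A k * x))" if "i < d" for i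
  proof -
    have "ip (A k) (u * adj (v i)) = - ip (v i) (A k * u)" if "k \<in> I" for k
      using ip_mult_left[of "A k" "v i" u] skew[OF that] by (simp add: ip_outer_left)
    then show ?thesis by (simp add: pr_def sum_distrib_right sum_negf)
  qed
  then have "- (\<Sum>i<d. v i * tp (pr (u * adj (v i)) * x))
      = (\<Sum>i<d. \<Sum>k\<in>I. cs (ip (v i) (A k * u)) (v i * tp (A k * x)))"
    by (simp add: tp_sum sum_distrib_left sum_negf del: tp_mult)
  also have "\<dots> = (\<Sum>k\<in>I. \<Sum>i<d. cs (ip (v i) (A k * u)) (v i * tp (A k * x)))"
    by (rule sum.swap)
  also have "\<dots> = (\<Sum>k\<in>I. (\<Sum>i<d. cs (ip (v i) (A k * u)) (v i)) * tp (A k * x))"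
    by (simp add: sum_distrib_right)
  also have "\<dots> = (\<Sum>k\<in>I. A k * u * tp (A k * x))"
    using onb_expand[OF o vecs_mult[OF gl u]] by (intro sum.cong refl) simp
  also have "\<dots> = tt (u * tp x)" by (simp add: tt_def mult.assoc)
  finally show ?thesis by simp
qed

lemma act_pr_eq_0:
  assumes "\<And>k. k \<in> I \<Longrightarrow> act (A k) W = 0"
  shows "act (pr X) W = 0"
proof -
  have "act (pr X) W = (\<Sum>k\<in>I. cs (ip (A k) X) (act (A k) W))"
    by (simp add: act_def pr_def sum_distrib_right sum_distrib_left tp_sum sum.distrib)
  then show ?thesis by (simp add: assms)
qed

end

locale paired_alg = torus_alg +
  fixes p :: "nat \<Rightarrow> nat"
  assumes p: "i < d \<Longrightarrow> p i < d" "i < d \<Longrightarrow> p i \<noteq> i" "i < d \<Longrightarrow> p (p i) = i"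
    and D_p: "i < d \<Longrightarrow> D i (p i) = 1"
    and D_rest: "i < d \<Longrightarrow> j < d \<Longrightarrow> j \<noteq> i \<Longrightarrow> j \<noteq> p i \<Longrightarrow> D i j = 1/2"
begin

lemma kappa_half: "\<kappa> = 1/2"
proof -
  note d0 = d_pos
  \<comment> \<open>Row 0 has entries 1/2, except 0 at itself and 1 at its partner; the two
    corrections cancel.\<close>
  have "(\<Sum>j<d. D 0 j) = (\<Sum>j<d. 1/2 + (if j = p 0 then 1/2 else 0) - (if j = 0 then 1/2 else 0))"
    using d0 D_diag D_p D_rest p(2)[OF d0] by (intro sum.cong) auto
  also have "\<dots> = real d * (1/2)"
    using d0 p by (simp add: sum_subtractf sum.distrib)
  finally show ?thesis using D_row[OF d0] d0 by simp
qed

text \<open>The weight of \<open>v j\<close> under \<open>Q (v i)\<close>: \<open>p\<close> pairs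
  each weight with its negative, as in the defining representation of a symplectic algebra.\<close>

definition K :: "nat \<Rightarrow> nat \<Rightarrow> complex" where "K i j = (if j = i then 1/2 else if j = p i then - 1/2 else 0)"

lemma D_val: "i < d \<Longrightarrow> j < d \<Longrightarrow> D i j = (if j = i then 0 else if j = p i then 1 else 1/2)"
  by (simp add: D_diag D_p D_rest)

lemma K_eq: "i < d \<Longrightarrow> j < d \<Longrightarrow> complex_of_real (\<kappa> - D i j) = K i j"
proof -
  assume ij: "i < d" "j < d"
  show ?thesis unfolding D_val[OF ij] unfolding kappa_half by (simp add: K_def)
qed

lemma Q_K: "i < d \<Longrightarrow> j < d \<Longrightarrow> Q (v i) * v j = cs (K i j) (v j)"
  by (simp add: Q_v K_eq[symmetric] del: of_real_diff)

lemma Q_diag_K: "i < d \<Longrightarrow> Q (v i) = (\<Sum>j<d. cs (K i j) (v j * adj (v j)))"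
  by (simp add: Q_diag K_eq[symmetric] del: of_real_diff)

lemma p_eq: "i < d \<Longrightarrow> j < d \<Longrightarrow> p i = j \<longleftrightarrow> i = p j"
  using p by auto

lemma Q_p: "i < d \<Longrightarrow> Q (v (p i)) = - Q (v i)"
proof -
  assume i: "i < d"
  have "K (p i) j = - K i j" if "j < d" for j
    using p(2,3)[OF i] by (auto simp: K_def)
  then show ?thesis using i by (simp add: Q_diag_K p sum_negf[symmetric])
qed

text \<open>ad \<open>Q (v m)\<close> acts on \<open>pr (v k * adj (v i))\<close> with eigenvalue
  \<open>K m k - K m i\<close>, so its matrix entry from \<open>v l\<close> to \<open>v j\<close>
  vanishes unless the weights balance.\<close>

lemma weight:
  assumes "m < d" "i < d" "j < d" "k < d" "l < d"
    and nz: "ip (v j) (pr (v k * adj (v i)) * v l) \<noteq> 0"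
  shows "K m j + K m i = K m k + K m l"
proof -
  let ?Z = "pr (v k * adj (v i))"
  have "comm (Q (v m)) ?Z = pr (comm (Q (v m)) (v k * adj (v i)))"
    unfolding Q_def by (rule pr_equiv)
  also have "comm (Q (v m)) (v k * adj (v i)) = Q (v m) * v k * adj (v i) - v k * adj (Q (v m) * v i)"
    by (simp add: comm_def mult.assoc)
  also have "\<dots> = cs (K m k - K m i) (v k * adj (v i))"
  proof -
    have "cnj (K m i) = K m i" by (simp add: K_def)
    then show ?thesis using assms by (simp add: Q_K cs_diff)
  qed
  finally have "ip (v j) (comm (Q (v m)) ?Z * v l) = (K m k - K m i) * ip (v j) (?Z * v l)" by simp
  moreover have "ip (v j) (Q (v m) * (?Z * v l)) = K m j * ip (v j) (?Z * v l)"
  proof -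
    have "ip (v j) (Q (v m) * (?Z * v l)) = ip (Q (v m) * v j) (?Z * v l)" by (simp add: ip_mult_left)
    moreover have "cnj (K m j) = K m j" by (simp add: K_def)
    ultimately show ?thesis using assms by (simp add: Q_K)
  qed
  moreover have "?Z * Q (v m) * v l = cs (K m l) (?Z * v l)" using assms by (simp add: mult.assoc Q_K)
  ultimately have "(K m j - K m l) * ip (v j) (?Z * v l) = (K m k - K m i) * ip (v j) (?Z * v l)"
    by (simp add: comm_def left_diff_distrib mult.assoc)
  then have "K m j - K m l = K m k - K m i" using nz by simp
  then show ?thesis by (simp add: algebra_simps)
qed

text \<open>By \<open>tt_outer\<close> this says that \<open>tt\<close> is -1/2 times the flip on
  weight vectors of nonzero total weight. If \<open>l\<close> differs from both \<open>k\<close> and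
  \<open>i\<close>, weight balance at \<open>m = k\<close> and \<open>m = l\<close> leaves only
  \<open>i = k\<close>, \<open>j = l\<close>, and that entry is the weight
  \<open>K k l = 0\<close>.\<close>

lemma pr_outer_generic:
  assumes kl: "k < d" "l < d" "l \<noteq> p k" and i: "i < d"
  shows "pr (v k * adj (v i)) * v l = (if i = l then cs (1/2) (v k) else 0)"
proof -
  have x: "pr (v k * adj (v i)) * v l \<in> vecs d" using kl by simp
  consider "k = l" "i = l" | "k = l" "i \<noteq> l" | "k \<noteq> l" "i = l" | "k \<noteq> l" "i \<noteq> l" by blast
  then show ?thesis
  proof cases
    case 1
    then show ?thesis using Q_K[of k k] kl by (simp add: Q_def K_def)
  next
    case 2
    then show ?thesis using pr_adj_kill[of "v k" "v i"] kl i by (simp add: ip_v)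
  next
    case 3
    then have "Q (v l) * v k = 0" using Q_K[of l k] kl p_eq[of k l] by (auto simp: K_def)
    then show ?thesis using star_orth[of "v l" "v k"] 3 kl by (simp add: ip_v kappa_half)
  next
    case 4
    have "ip (v j) (pr (v k * adj (v i)) * v l) = 0" if j: "j < d" for j
    proof (rule ccontr)
      assume nz: "ip (v j) (pr (v k * adj (v i)) * v l) \<noteq> 0"
      have "K k k + K k l = 1/2" "K l k + K l l = 1/2"
        using 4 kl p_eq[of k l] by (auto simp: K_def)
      then have e: "K k j + K k i = 1/2" "K l j + K l i = 1/2"
        using weight[OF kl(1) i j kl(1,2) nz] weight[OF kl(2) i j kl(1,2) nz] by auto
      \<comment> \<open>Weights are 0, 1/2 or -1/2, so two of them add up to 1/2 only if one of them
        is 1/2.\<close>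
      have "K m j = 1/2 \<or> K m i = 1/2" if "K m j + K m i = 1/2" for m
        using that unfolding K_def by (auto simp: complex_eq_iff split: if_splits)
      then have "K k j = 1/2 \<or> K k i = 1/2" "K l j = 1/2 \<or> K l i = 1/2" using e by blast+
      moreover have "K m n = 1/2 \<Longrightarrow> n = m" for m n by (auto simp: K_def complex_eq_iff split: if_splits)
      ultimately have "i = k" "j = l" using 4 by blast+
      then have "pr (v k * adj (v i)) * v l = cs (K k l) (v l)" using Q_K[of k l] kl by (simp add: Q_def)
      moreover have "K k l = 0" using 4 kl by (simp add: K_def)
      ultimately show False using nz by simp
    qed
    then show ?thesis using onb_expand[OF onb x] 4 by simp
  qed
qed

text \<open>\<open>\<Sum>A\<^sub>k \<otimes> A\<^sub>k\<close> agrees with \<open>- 1/2\<close> times the flip up to the operator \<open>R\<close>, which vanishes on all weight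
  vectors of nonzero weight. As \<open>R\<close> commutes with the action, its image consists of invariants.\<close>
definition R :: "fmat \<Rightarrow> fmat" where "R M = tp M + cs 2 (tt M)"

lemma R_simps: "R (X + Y) = R X + R Y" "R (cs c X) = cs c (R X)" "R 0 = 0"
  by (simp_all add: R_def clinear_mapD[OF clinear_tt] mult.commute)

lemma R_sum: "R (sum f S) = (\<Sum>s\<in>S. R (f s))"
  by (induction S rule: infinite_finite_induct) (auto simp: R_simps)

lemma act_R: "i \<in> I \<Longrightarrow> act (A i) (R M) = R (act (A i) M)"
proof -
  assume i: "i \<in> I"
  have "act (A i) (tp M) = tp (act (A i) M)" by (simp add: act_def add.commute)
  moreover have "act (A i) (R M) = act (A i) (tp M) + cs 2 (act (A i) (tt M))"
    by (simp add: R_def act_def algebra_simps)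
  ultimately show ?thesis by (simp add: act_tt[OF i] R_def)
qed

lemma R_outer:
  "u \<in> vecs d \<Longrightarrow> x \<in> vecs d \<Longrightarrow> R (u * tp x) = x * tp u - cs 2 (\<Sum>i<d. v i * tp (pr (u * adj (v i)) * x))"
  by (simp add: R_def tt_outer[OF onb] del: tp_mult) simp

lemma R_generic: "k < d \<Longrightarrow> l < d \<Longrightarrow> l \<noteq> p k \<Longrightarrow> R (v k * tp (v l)) = 0"
proof -
  assume kl: "k < d" "l < d" "l \<noteq> p k"
  have "(\<Sum>i<d. v i * tp (pr (v k * adj (v i)) * v l)) = (\<Sum>i<d. if i = l then cs (1/2) (v l * tp (v k)) else 0)"
    using kl by (intro sum.cong refl) (auto simp: pr_outer_generic simp del: tp_mult)
  then show ?thesis using kl by (simp add: R_outer)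
qed

text \<open>On symmetric tensors the flip is 1 and \<open>tt\<close> is -1/2, the negative of
  \<kappa>, so the two terms of \<open>R\<close> cancel.\<close>

lemma R_sym_outer: "u \<in> vecs d \<Longrightarrow> x \<in> vecs d \<Longrightarrow> R (u * tp x) + R (x * tp u) = 0"
proof -
  assume u: "u \<in> vecs d" and x: "x \<in> vecs d"
  have "(\<Sum>i<d. v i * tp (pr (u * adj (v i)) * x)) + (\<Sum>i<d. v i * tp (pr (x * adj (v i)) * u))
     = (\<Sum>i<d. v i * tp (pr (u * adj (v i)) * x + pr (x * adj (v i)) * u))"
    by (simp add: sum.distrib[symmetric] distrib_left del: tp_mult)
  also have "\<dots> = (\<Sum>i<d. cs (1/2) (cs (ip (v i) x) (v i) * tp u + cs (ip (v i) u) (v i) * tp x))"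
    using u x by (intro sum.cong refl) (simp add: star kappa_half distrib_left)
  also have "\<dots> = cs (1/2) ((\<Sum>i<d. cs (ip (v i) x) (v i)) * tp u + (\<Sum>i<d. cs (ip (v i) u) (v i)) * tp x)"
    by (simp only: sum_distrib_right cs_sum[symmetric] sum.distrib[symmetric])
  also have "\<dots> = cs (1/2) (x * tp u + u * tp x)"
    using onb_expand[OF onb] u x by metis
  finally have e: "(\<Sum>i<d. v i * tp (pr (u * adj (v i)) * x)) = cs (1/2) (x * tp u + u * tp x)
     - (\<Sum>i<d. v i * tp (pr (x * adj (v i)) * u))" by (simp add: algebra_simps)
  show ?thesis unfolding R_outer[OF u x] R_outer[OF x u] e by simp
qed

definition Omega :: fmat where "Omega = R (v 0 * tp (v (p 0)))"

definition co :: "nat \<Rightarrow> complex" where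
  "co i = (if i = p 0 then 1 else 0) - 2 * ip (v (p i)) (pr (v 0 * adj (v i)) * v (p 0))"

text \<open>\<open>R\<close> preserves weights, so \<open>Omega\<close> involves only the zero
  weight vectors v_i \<otimes> v_(p i).\<close>

lemma Omega_expand: "Omega = (\<Sum>i<d. cs (co i) (v i * tp (v (p i))))"
proof -
  note d0 = d_pos
  have e: "pr (v 0 * adj (v i)) * v (p 0) = cs (ip (v (p i)) (pr (v 0 * adj (v i)) * v (p 0))) (v (p i))"
    if i: "i < d" for i
  proof -
    let ?z = "pr (v 0 * adj (v i)) * v (p 0)"
    have z: "?z \<in> vecs d" using d0 p by simp
    have "ip (v j) ?z = 0" if j: "j < d" "j \<noteq> p i" for j
    proof (rule ccontr)
      assume "ip (v j) ?z \<noteq> 0"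
      then have "K i j + K i i = K i 0 + K i (p 0)" using weight[of i i j 0 "p 0"] i j d0 p by auto
      moreover have "K i 0 + K i (p 0) = 0" using p[OF i] p[OF d0] by (auto simp: K_def)
      ultimately show False using j by (auto simp: K_def complex_eq_iff split: if_splits)
    qed
    then have "(\<Sum>j<d. cs (ip (v j) ?z) (v j)) = (\<Sum>j<d. if j = p i then cs (ip (v (p i)) ?z) (v (p i)) else 0)"
      by (intro sum.cong) auto
    then show ?thesis using onb_expand[OF onb z] p(1)[OF i] by simp
  qed
  have "(\<Sum>i<d. v i * tp (pr (v 0 * adj (v i)) * v (p 0)))
      = (\<Sum>i<d. cs (ip (v (p i)) (pr (v 0 * adj (v i)) * v (p 0))) (v i * tp (v (p i))))"
    by (intro sum.cong refl, subst e) (auto simp del: tp_mult)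
  moreover have "v (p 0) * tp (v 0) = (\<Sum>i<d. if i = p 0 then v i * tp (v (p i)) else 0)"
    using p d0 by simp
  moreover have "Omega = v (p 0) * tp (v 0) - cs 2 (\<Sum>i<d. v i * tp (pr (v 0 * adj (v i)) * v (p 0)))"
    unfolding Omega_def using p d0 by (simp add: R_outer)
  ultimately have "Omega = (\<Sum>i<d. (if i = p 0 then v i * tp (v (p i)) else 0)
      - cs (2 * ip (v (p i)) (pr (v 0 * adj (v i)) * v (p 0))) (v i * tp (v (p i))))"
    by (simp add: sum_subtractf cs_sum)
  also have "\<dots> = (\<Sum>i<d. cs (co i) (v i * tp (v (p i))))"
    by (intro sum.cong refl) (auto simp: co_def cs_diff)
  finally show ?thesis .
qed

text \<open>This is where \<open>Omega\<close> is seen to be nonzero: the partner of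
  \<open>v 0\<close> has weight -1/2 under \<open>Q (v 0)\<close>, and the factor 2 in
  \<open>R\<close> turns this into the coefficient 1.\<close>

lemma co_0: "co 0 = 1"
proof -
  have "pr (v 0 * adj (v 0)) * v (p 0) = cs (- 1/2) (v (p 0))"
    using Q_K[of 0 "p 0"] d_pos p by (simp add: Q_def K_def)
  then show ?thesis using d_pos p by (auto simp: co_def ip_v)
qed

text \<open>\<open>R\<close> commutes with the flip and vanishes on symmetric tensors, hence its
  values are antisymmetric.\<close>

lemma tp_Omega: "tp Omega = - Omega"
proof -
  note d0 = d_pos
  have tpR: "tp (R M) = R (tp M)" for M
    by (simp add: R_def tt_def tp_sum mult.assoc)
  have "tp Omega = R (v (p 0) * tp (v 0))" by (simp add: Omega_def tpR)
  then show ?thesis using R_sym_outer[of "v 0" "v (p 0)"] d0 p by (simp add: Omega_def add_eq_0_iff2)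
qed

lemma vec_tp_adj: "i < d \<Longrightarrow> j < d \<Longrightarrow> u \<in> vecs d \<Longrightarrow> u * tp (v i) * adj (tp (v j)) = (if i = j then u else 0)"
  using vec_tp_app[of "v i" d "v j" u] by (simp add: ip_v)

lemma Omega_conj: "j < d \<Longrightarrow> Omega * adj (tp (v j)) = cs (co (p j)) (v (p j))"
proof -
  assume j: "j < d"
  have "Omega * adj (tp (v j)) = (\<Sum>i<d. if i = p j then cs (co i) (v i) else 0)"
    unfolding Omega_expand sum_distrib_right mult_cs
    by (intro sum.cong refl, subst vec_tp_adj) (use j p p_eq in auto)
  then show ?thesis using p(1)[OF j] by simp
qed

lemma co_p: "i < d \<Longrightarrow> co (p i) = - co i"
proof -
  assume i: "i < d"
  have "Omega * adj (tp (v i)) = - (tp Omega * adj (tp (v i)))" by (simp add: tp_Omega)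
  also have "tp Omega * adj (tp (v i)) = (\<Sum>k<d. if k = i then cs (co i) (v (p i)) else 0)"
    unfolding Omega_expand tp_sum sum_distrib_right
    by (intro sum.cong refl) (use i p in \<open>simp add: vec_tp_adj\<close>)
  finally have "cs (co (p i)) (v (p i)) = cs (- co i) (v (p i))"
    using i by (simp add: Omega_conj)
  then have "ip (v (p i)) (cs (co (p i)) (v (p i))) = ip (v (p i)) (cs (- co i) (v (p i)))" by simp
  then show ?thesis using p(1)[OF i] by (simp only: ip_simps) (simp add: ip_v)
qed

lemma Omega_gl [simp]: "Omega \<in> gl d"
  unfolding Omega_expand using p by (intro gl_sum) (auto simp: vecs_gl)

text \<open>\<open>R\<close> commutes with the action, and of the image of v_0 \<otimes> v_(p 0)
  under \<open>A k\<close> it sees only the component along that tensor itself. The coefficient is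
  the inner product of \<open>A k\<close> with \<open>Q (v 0) + Q (v (p 0))\<close>, which is
  0.\<close>

lemma act_Omega: "k \<in> I \<Longrightarrow> act (A k) Omega = 0"
proof -
  assume k: "k \<in> I"
  note d0 = d_pos
  let ?u = "v 0" and ?w = "v (p 0)"
  have uw: "?u \<in> vecs d" "?w \<in> vecs d" using d0 p by auto
  have Au: "A k * ?u \<in> vecs d" "A k * ?w \<in> vecs d" using uw gl[OF k] by auto
  have 1: "R ((A k * ?u) * tp ?w) = cs (ip ?u (A k * ?u)) Omega"
  proof -
    have "R ((A k * ?u) * tp ?w) = R ((\<Sum>i<d. cs (ip (v i) (A k * ?u)) (v i)) * tp ?w)"
      using onb_expand[OF onb Au(1)] by simp
    also have "\<dots> = (\<Sum>i<d. cs (ip (v i) (A k * ?u)) (R (v i * tp ?w)))"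
      by (simp add: sum_distrib_right R_sum R_simps)
    also have "\<dots> = (\<Sum>i<d. if i = 0 then cs (ip ?u (A k * ?u)) Omega else 0)"
    proof (intro sum.cong refl)
      fix i assume "i \<in> {..<d}"
      then have i: "i < d" by simp
      have "R (v i * tp ?w) = 0" if "i \<noteq> 0"
        using R_generic[OF i, of "p 0"] p d0 that p(3)[OF i] p(3)[OF d0] by metis
      then show "cs (ip (v i) (A k * ?u)) (R (v i * tp ?w)) = (if i = 0 then cs (ip ?u (A k * ?u)) Omega else 0)"
        by (auto simp: Omega_def)
    qed
    finally show ?thesis using d0 by simp
  qed
  have 2: "R (?u * tp (A k * ?w)) = cs (ip ?w (A k * ?w)) Omega"
  proof -
    have "R (?u * tp (A k * ?w)) = R (?u * tp (\<Sum>i<d. cs (ip (v i) (A k * ?w)) (v i)))"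
      using onb_expand[OF onb Au(2)] by simp
    also have "\<dots> = (\<Sum>i<d. cs (ip (v i) (A k * ?w)) (R (?u * tp (v i))))"
      by (simp add: sum_distrib_left tp_sum R_sum R_simps)
    also have "\<dots> = (\<Sum>i<d. if i = p 0 then cs (ip ?w (A k * ?w)) Omega else 0)"
      by (intro sum.cong refl) (use R_generic[OF d0] in \<open>auto simp: Omega_def\<close>)
    finally show ?thesis using d0 p by simp
  qed
  have "ip ?u (A k * ?u) + ip ?w (A k * ?w) = ip (Q ?u + Q ?w) (A k)"
    using pr_self[of "?u * adj ?u" "A k"] pr_self[of "?w * adj ?w" "A k"] pr_A[OF k]
    by (simp add: Q_def ip_outer_left)
  also have "\<dots> = 0" using Q_p[OF d0] by simp
  finally have s: "ip ?u (A k * ?u) + ip ?w (A k * ?w) = 0" .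
  have "act (A k) (?u * tp ?w) = (A k * ?u) * tp ?w + ?u * tp (A k * ?w)"
    by (simp add: act_def mult.assoc)
  then have "act (A k) Omega = cs (ip ?u (A k * ?u) + ip ?w (A k * ?w)) Omega"
    unfolding Omega_def act_R[OF k] unfolding Omega_def[symmetric]
    by (simp only: R_simps 1 2 cs_add)
  then show ?thesis by (simp add: s)
qed

lemma pr_Omega: "pr X * Omega = - (Omega * tp (pr X))"
  using act_pr_eq_0[OF act_Omega, of X] by (simp add: act_def add_eq_0_iff2)

lemma adj_Omega: "adj Omega = (\<Sum>i<d. cs (cnj (co i)) (adj (tp (v (p i))) * adj (v i)))"
  by (simp add: Omega_expand adj_sum)

lemma Omega_adj: "i < d \<Longrightarrow> Omega * adj Omega * v i = cs (co i * cnj (co i)) (v i)"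
proof -
  assume i: "i < d"
  have "Omega * adj Omega * v i = Omega * (adj Omega * v i)" by (simp add: mult.assoc)
  also have "adj Omega * v i = (\<Sum>k<d. if k = i then cs (cnj (co i)) (adj (tp (v (p i)))) else 0)"
    unfolding adj_Omega sum_distrib_right
  proof (intro sum.cong refl)
    fix k assume "k \<in> {..<d}"
    then have k: "k < d" by simp
    have "adj (tp (v (p k))) \<in> vecs d" using p(1)[OF k] v[of "p k"] by (auto simp: vecs_def simp del: v)
    then show "cs (cnj (co k)) (adj (tp (v (p k))) * adj (v k)) * v i = (if k = i then cs (cnj (co i)) (adj (tp (v (p i)))) else 0)"
      using i k outer_app[of "v i" d "v k" "adj (tp (v (p k)))"] by (simp add: ip_v)
  qed
  also have "\<dots> = cs (cnj (co i)) (adj (tp (v (p i))))" using i by simp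
  finally show ?thesis using i p by (simp add: Omega_conj mult.commute)
qed

text \<open>\<open>Omega * adj Omega\<close> commutes with the algebra and fixes \<open>v 0\<close>;
  its fixed space is invariant, hence all of V.\<close>

lemma Omega_adj_Omega: "Omega * adj Omega = Idm d"
proof -
  define U where "U = {x \<in> vecs d. Omega * adj Omega * x = x}"
  have "csubspace U" by (auto simp: U_def csubspace_def distrib_left)
  moreover have "X * x \<in> U" if X: "X \<in> A ` I" and x: "x \<in> U" for X x
  proof -
    obtain k where k: "k \<in> I" "X = A k" using X by blast
    have e: "A k * Omega = - (Omega * tp (A k))" using pr_Omega[of "A k"] pr_A[OF k(1)] by simp
    have "adj Omega * A k = - (tp (A k) * adj Omega)"
    proof -
      have "adj (A k * Omega) = adj (- (Omega * tp (A k)))" using e by simp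
      then have "adj Omega * adj (A k) = - (tp (adj (A k)) * adj Omega)" by simp
      then have "- (adj Omega * A k) = tp (A k) * adj Omega" using skew[OF k(1)] by simp
      then show ?thesis by (metis minus_minus)
    qed
    then have "Omega * adj Omega * A k = A k * (Omega * adj Omega)"
      using e by (simp add: mult.assoc) (simp flip: mult.assoc)
    then have "Omega * adj Omega * (A k * x) = A k * (Omega * adj Omega * x)"
      by (simp flip: mult.assoc)
    then show ?thesis using x k gl[OF k(1)] by (simp add: U_def)
  qed
  moreover have "v 0 \<in> U" using d_pos by (simp add: U_def Omega_adj co_0)
  moreover have "v 0 \<noteq> 0" using ip_v[of 0 0] d_pos by auto
  ultimately have "U = vecs d"
    by (intro sym_irr_vecs[OF irr]) (auto simp: U_def gl)
  show ?thesis
    by (rule gl_eqI[of _ d]) (use \<open>U = vecs d\<close> in \<open>auto simp: U_def vecs_gl\<close>)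
qed

lemma co_unit: "i < d \<Longrightarrow> co i * cnj (co i) = 1"
  using arg_cong[OF Omega_adj[of i], of "ip (v i)"] by (simp add: Omega_adj_Omega vecs_gl ip_v)

text \<open>The involution whose fixed points in \<open>gl d\<close> form the symplectic algebra of
  \<open>Omega\<close>; \<open>rho\<close> is the projection onto them.\<close>

definition theta :: "fmat \<Rightarrow> fmat" where "theta X = - (Omega * tp X * adj Omega)"

definition rho :: "fmat \<Rightarrow> fmat" where "rho X = cs (1/2) (X + theta X)"

lemma theta_pr: "theta (pr X) = pr X"
proof -
  have "theta (pr X) = pr X * Omega * adj Omega" by (simp add: theta_def pr_Omega)
  then show ?thesis by (simp add: mult.assoc Omega_adj_Omega)
qed

lemma theta_self: "ip (theta X) Y = ip X (theta Y)"
proof -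
  have "ip (Omega * tp X * adj Omega) Y = ip (tp X) (adj Omega * Y * Omega)"
    using ip_mult_right[of "Omega * tp X" "adj Omega" Y] ip_mult_left[of Omega "tp X" "Y * Omega"]
    by (simp add: mult.assoc)
  also have "\<dots> = ip X (tp Omega * tp Y * adj (tp Omega))"
    by (simp add: ip_tp mult.assoc)
  finally show ?thesis by (simp add: theta_def tp_Omega)
qed

lemma theta_theta: "X \<in> gl d \<Longrightarrow> theta (theta X) = X"
proof -
  assume X: "X \<in> gl d"
  have "theta (theta X) = Omega * adj (tp Omega) * X * tp Omega * adj Omega"
    by (simp add: theta_def mult.assoc)
  also have "\<dots> = (Omega * adj Omega) * X * (Omega * adj Omega)" by (simp add: tp_Omega mult.assoc)
  finally show ?thesis using X by (simp add: Omega_adj_Omega)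
qed

lemma theta_outer: "i < d \<Longrightarrow> j < d \<Longrightarrow>
  theta (v i * adj (v j)) = - cs (co (p j) * cnj (co (p i))) (v (p j) * adj (v (p i)))"
proof -
  assume ij: "i < d" "j < d"
  have "theta (v i * adj (v j)) = - (Omega * adj (tp (v j)) * adj (Omega * adj (tp (v i))))"
    by (simp add: theta_def mult.assoc)
  then show ?thesis using ij by (simp add: Omega_conj)
qed

text \<open>The range of \<open>pr\<close> is fixed by \<open>theta\<close>, hence contained in that
  of \<open>rho\<close>. On an elementary matrix the squared norm of \<open>rho\<close> is 1 if
  \<open>i = p j\<close> and 1/2 otherwise, exactly as for \<open>pr\<close>, and equal norms force
  equality.\<close>

lemma pr_eq_rho: "X \<in> gl d \<Longrightarrow> pr X = rho X"
proof -
  assume X: "X \<in> gl d"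
  have E: "pr (v i * adj (v j)) = rho (v i * adj (v j))" if ij: "i < d" "j < d" for i j
  proof -
    let ?E = "v i * adj (v j)"
    have Eg: "?E \<in> gl d" using ij by (simp add: vecs_gl)
    have rp: "ip (rho ?E) (pr ?E) = ip (pr ?E) (pr ?E)"
      by (simp add: rho_def theta_self theta_pr pr_self)
    then have pr': "ip (pr ?E) (rho ?E) = ip (pr ?E) (pr ?E)" by (metis ip_cnj)
    have EE: "ip ?E ?E = 1" using ij by (simp add: ip_outer[of _ d] ip_v)
    have Et: "ip ?E (theta ?E) = (if i = p j then 1 else 0)"
    proof (cases "i = p j")
      case True
      then have "ip ?E (theta ?E) = co (p j) * cnj (co (p j))"
        using ij p by (simp add: theta_outer ip_outer[of _ d] ip_v) (metis co_p complex_cnj_minus minus_mult_right minus_minus)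
      then show ?thesis using True ij p co_unit[of "p j"] by simp
    next
      case False
      then show ?thesis using ij p by (simp add: theta_outer ip_outer[of _ d] ip_v)
    qed
    have "ip (rho ?E) (rho ?E) = 1/2 * (1 + ip ?E (theta ?E))"
      using EE by (simp add: rho_def theta_self theta_theta[OF Eg]) (simp add: theta_self[symmetric] theta_theta[OF Eg] field_simps)
    also have "\<dots> = ip (pr ?E) (pr ?E)"
      unfolding Et ip_pr_outer[OF ij] unfolding D_val[OF ij] unfolding kappa_half
      using ij p(2)[of j] p_eq[of i j] by auto
    finally have "ip (pr ?E - rho ?E) (pr ?E - rho ?E) = 0" using rp pr' by simp
    then show ?thesis by (rule ip_diff_eq_0)
  qed
  have rs: "rho (sum f S) = (\<Sum>s\<in>S. rho (f s))" "rho (cs c Y) = cs c (rho Y)" for f :: "nat \<Rightarrow> fmat" and S c Y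
    by (simp_all add: rho_def theta_def tp_sum sum_distrib_left sum_distrib_right cs_sum sum.distrib sum_negf sum_subtractf mult.commute)
  have Xe: "X = (\<Sum>i<d. \<Sum>j<d. cs (ip (v i) (X * v j)) (v i * adj (v j)))"
    by (rule onb_expand_gl[OF onb X])
  show ?thesis
    by (subst (1 2) Xe) (simp add: pr_sum rs E)
qed

text \<open>As \<open>Omega\<close> is unitary, infinitesimal invariance of \<open>Omega\<close>
  under \<open>X\<close> amounts to \<open>theta X = X\<close>, and then
  \<open>rho X = X\<close>.\<close>

lemma pr_fix_iff: "X \<in> gl d \<Longrightarrow> pr X = X \<longleftrightarrow> act X Omega = 0"
proof
  assume X: "X \<in> gl d" and e: "pr X = X"
  show "act X Omega = 0" using act_pr_eq_0[OF act_Omega, of X] e by simp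
next
  assume X: "X \<in> gl d" and "act X Omega = 0"
  then have "X * Omega = - (Omega * tp X)" by (simp add: act_def add_eq_0_iff2)
  then have "theta X = X * (Omega * adj Omega)" by (simp add: theta_def flip: mult.assoc)
  then have "theta X = X" using X by (simp add: Omega_adj_Omega)
  then show "pr X = X" using X by (simp add: pr_eq_rho rho_def flip: cs_add)
qed

end

section \<open>Unitarity\<close>

definition fconv :: "(nat \<Rightarrow> fmat) \<Rightarrow> fmat \<Rightarrow> bool" where
  "fconv X L \<longleftrightarrow> (\<forall>i j. (\<lambda>n. ent (X n) i j) \<longlonglongrightarrow> ent L i j)"

lemma fconv_const: "fconv (\<lambda>_. C) C"
  and fconv_add: "fconv X K \<Longrightarrow> fconv Y L \<Longrightarrow> fconv (\<lambda>n. X n + Y n) (K + L)"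
  and fconv_diff: "fconv X K \<Longrightarrow> fconv Y L \<Longrightarrow> fconv (\<lambda>n. X n - Y n) (K - L)"
  and fconv_cs: "fconv X K \<Longrightarrow> fconv (\<lambda>n. cs c (X n)) (cs c K)"
  unfolding fconv_def by (auto intro!: tendsto_intros)

lemma fconv_sum: "(\<And>s. s \<in> S \<Longrightarrow> fconv (\<lambda>n. X n s) (K s)) \<Longrightarrow> fconv (\<lambda>n. \<Sum>s\<in>S. X n s) (\<Sum>s\<in>S. K s)"
  by (induction S rule: infinite_finite_induct) (auto intro: fconv_const fconv_add)

lemma fconv_mult:
  assumes "fconv X K" "fconv Y L" "\<And>n. X n \<in> gl d" "K \<in> gl d"
  shows "fconv (\<lambda>n. X n * Y n) (K * L)"
  using assms unfolding fconv_def by (simp add: ent_mult[of _ d] tendsto_intros)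

lemma fconv_unique: "fconv X K \<Longrightarrow> fconv X L \<Longrightarrow> K = L"
  unfolding fconv_def by (blast intro: fmat_eqI LIMSEQ_unique)

lemma fconv_nsq:
  assumes "fconv X K" "\<And>n. X n \<in> gl d" "K \<in> gl d"
  shows "(\<lambda>n. nsq (X n)) \<longlonglongrightarrow> nsq K"
  using assms unfolding fconv_def by (simp add: nsq_gl[of _ d]) (intro tendsto_intros; blast)

text \<open>Bolzano-Weierstrass for finitely many sequences at once, refining the subsequence once
  per index.\<close>

lemma common_subseq:
  fixes s :: "'j \<Rightarrow> nat \<Rightarrow> complex"
  assumes "finite J" "\<And>j. j \<in> J \<Longrightarrow> bounded (range (s j))"
  shows "\<exists>r l. strict_mono (r :: nat \<Rightarrow> nat) \<and> (\<forall>j\<in>J. (\<lambda>n. s j (r n)) \<longlonglongrightarrow> l j)"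
  using assms
proof (induction J)
  case empty
  then show ?case by (auto intro: strict_mono_id)
next
  case (insert k J)
  then obtain r l where r: "strict_mono (r :: nat \<Rightarrow> nat)" "\<And>j. j \<in> J \<Longrightarrow> (\<lambda>n. s j (r n)) \<longlonglongrightarrow> l j" by auto
  have "bounded (range (\<lambda>n. s k (r n)))"
    using insert.prems[of k] by (rule bounded_subset) auto
  then obtain z q where q: "strict_mono (q :: nat \<Rightarrow> nat)" "((\<lambda>n. s k (r n)) \<circ> q) \<longlonglongrightarrow> z"
    using bounded_imp_convergent_subsequence by blast
  have "strict_mono (\<lambda>n. r (q n))" using r(1) q(1) by (simp add: strict_mono_def)
  moreover have "(\<lambda>n. s j (r (q n))) \<longlonglongrightarrow> (if j = k then z else l j)" if "j \<in> insert k J" for j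
    using that q(2) LIMSEQ_subseq_LIMSEQ[OF r(2) q(1), of j] insert.hyps by (auto simp: o_def)
  ultimately show ?case
    by (intro exI[of _ "\<lambda>n. r (q n)"] exI[of _ "\<lambda>j. if j = k then z else l j"]) blast
qed

lemma ent_le_nsq: "X \<in> gl d \<Longrightarrow> (cmod (ent X i j))\<^sup>2 \<le> nsq X"
proof (cases "i < d \<and> j < d")
  case True
  assume "X \<in> gl d"
  have "(cmod (ent X i j))\<^sup>2 \<le> (\<Sum>i<d. (cmod (ent X i j))\<^sup>2)"
    using True by (intro member_le_sum) auto
  also have "\<dots> \<le> (\<Sum>j<d. \<Sum>i<d. (cmod (ent X i j))\<^sup>2)"
    using True by (intro member_le_sum) (auto intro!: sum_nonneg)
  finally show ?thesis using \<open>X \<in> gl d\<close> by (simp add: nsq_gl)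
next
  case False
  assume "X \<in> gl d"
  then have "ent X i j = 0" using False gl_ent[of X d i j] by linarith
  then show ?thesis by simp
qed

lemma fseq_compact:
  assumes J: "finite J" and gl: "\<And>k n. k \<in> J \<Longrightarrow> X k n \<in> gl d" and b: "\<And>k n. k \<in> J \<Longrightarrow> nsq (X k n) \<le> C"
  shows "\<exists>r L. strict_mono (r :: nat \<Rightarrow> nat) \<and> (\<forall>k\<in>J. L k \<in> gl d \<and> fconv (\<lambda>n. X k (r n)) (L k))"
proof -
  define s where "s = (\<lambda>(k, i, j) n. ent (X k n) i j)"
  have "bounded (range (s t))" if t: "t \<in> J \<times> {..<d} \<times> {..<d}" for t
  proof -
    obtain k i j where kij: "t = (k, i, j)" by (cases t)
    have "cmod (ent (X k n) i j) \<le> sqrt C" for n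
      using ent_le_nsq[OF gl, of k n i j] b[of k n] t kij real_le_rsqrt by fastforce
    then show ?thesis unfolding bounded_iff s_def kij by auto
  qed
  then obtain r l where r: "strict_mono (r :: nat \<Rightarrow> nat)"
    and l: "\<And>t. t \<in> J \<times> {..<d} \<times> {..<d} \<Longrightarrow> (\<lambda>n. s t (r n)) \<longlonglongrightarrow> l t"
    using common_subseq[of "J \<times> {..<d} \<times> {..<d}" s] J by (metis finite_SigmaI finite_lessThan)
  define L where "L k = (\<Sum>(i,j)\<in>{..<d} \<times> {..<d}. cs (l (k, i, j)) (unit_mat i j))" for k
  have entL: "ent (L k) i j = (if i < d \<and> j < d then l (k, i, j) else 0)" for k i j
  proof -
    have "ent (L k) i j = (\<Sum>t\<in>{..<d} \<times> {..<d}. if t = (i, j) then l (k, i, j) else 0)"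
      unfolding L_def ent_sum by (intro sum.cong) (auto split: if_split_asm)
    then show ?thesis by auto
  qed
  have "fconv (\<lambda>n. X k (r n)) (L k)" if k: "k \<in> J" for k
    unfolding fconv_def
  proof (intro allI)
    fix i j
    show "(\<lambda>n. ent (X k (r n)) i j) \<longlonglongrightarrow> ent (L k) i j"
    proof (cases "i < d \<and> j < d")
      case True
      then show ?thesis using l[of "(k, i, j)"] k by (simp add: entL s_def)
    next
      case False
      then have "ent (X k (r n)) i j = 0" for n using gl_ent[OF gl[OF k], of i j] by (meson not_le)
      then show ?thesis using False by (auto simp: entL)
    qed
  qed
  moreover have "L k \<in> gl d" for k by (auto simp: gl_def entL split: if_splits)
  ultimately show ?thesis using r by blast
qed

text \<open>The competitor is the conjugate of \<open>\<beta> b\<close> by 1 + M, whose inverse is 1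
  - M, so everything stays polynomial. The first variation makes the moment map \<open>mu\<close>
  orthogonal to all square-zero matrices; those of rank one force \<open>mu\<close> to be scalar,
  and its trace is 0.\<close>

lemma nilpotent_critical:
  assumes fin: "finite B" and b: "\<And>b. b \<in> B \<Longrightarrow> \<beta> b \<in> gl d"
    and min: "\<And>M. M \<in> gl d \<Longrightarrow> M * M = 0 \<Longrightarrow>
       (\<Sum>b\<in>B. nsq (\<beta> b)) \<le> (\<Sum>b\<in>B. nsq (\<beta> b + comm M (\<beta> b) - M * \<beta> b * M))"
  shows "(\<Sum>b\<in>B. comm (\<beta> b) (adj (\<beta> b))) = 0"
proof -
  define mu where "mu = (\<Sum>b\<in>B. comm (\<beta> b) (adj (\<beta> b)))"
  have mugl: "mu \<in> gl d" unfolding mu_def by (intro gl_sum) (auto simp: b)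
  have ipmu: "ip mu M = (\<Sum>b\<in>B. ip (\<beta> b) (comm M (\<beta> b)))" for M
  proof -
    have "ip (comm X (adj X)) M = ip X (comm M X)" for X
      using ip_mult_right[of X "adj X" M] ip_mult_left[of "adj X" X M] by (simp add: comm_def)
    then show ?thesis by (simp add: mu_def ip_sum)
  qed
  have re: "Re (ip mu M) = 0" if M: "M \<in> gl d" "M * M = 0" for M
  proof -
    define f where "f s = (\<Sum>b\<in>B. nsq (\<beta> b + cs (of_real s) (comm M (\<beta> b)) - cs (of_real (s\<^sup>2)) (M * \<beta> b * M)))" for s :: real
    \<comment> \<open>A polynomial in \<open>s\<close>, so the derivative at 0 is the coefficient of
      its linear term.\<close>
    have nsq3: "nsq (X + cs (of_real s) Y - cs (of_real (s\<^sup>2)) Z)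
       = nsq X + s * (2 * Re (ip X Y)) + s^2 * (nsq Y - 2 * Re (ip X Z)) - s^3 * (2 * Re (ip Y Z)) + s^4 * nsq Z" for X Y Z and s :: real
    proof -
      have "Re (ip Y X) = Re (ip X Y)" "Re (ip Z X) = Re (ip X Z)" "Re (ip Z Y) = Re (ip Y Z)"
        by (metis complex_cnj_cancel_iff cnj.simps(1) ip_cnj)+
      then show ?thesis
        unfolding nsq_def by (simp add: algebra_simps power2_eq_square power3_eq_cube power4_eq_xxxx del: of_real_power of_real_mult)
    qed
    have "f s = (\<Sum>b\<in>B. nsq (\<beta> b)) + s * (2 * Re (ip mu M))
       + s^2 * (\<Sum>b\<in>B. nsq (comm M (\<beta> b)) - 2 * Re (ip (\<beta> b) (M * \<beta> b * M)))
       - s^3 * (\<Sum>b\<in>B. 2 * Re (ip (comm M (\<beta> b)) (M * \<beta> b * M))) + s^4 * (\<Sum>b\<in>B. nsq (M * \<beta> b * M))" for s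
      unfolding f_def nsq3 ipmu
      by (simp add: sum.distrib sum_subtractf sum_distrib_left right_diff_distrib)
    then have fe: "f = (\<lambda>s. (\<Sum>b\<in>B. nsq (\<beta> b)) + s * (2 * Re (ip mu M))
       + s^2 * (\<Sum>b\<in>B. nsq (comm M (\<beta> b)) - 2 * Re (ip (\<beta> b) (M * \<beta> b * M)))
       - s^3 * (\<Sum>b\<in>B. 2 * Re (ip (comm M (\<beta> b)) (M * \<beta> b * M))) + s^4 * (\<Sum>b\<in>B. nsq (M * \<beta> b * M)))"
      by blast
    have "DERIV f 0 :> 2 * Re (ip mu M)"
      unfolding fe by (auto intro!: derivative_eq_intros)
    moreover have "f 0 \<le> f s" for s
    proof -
      have "f 0 = (\<Sum>b\<in>B. nsq (\<beta> b))" by (simp add: f_def)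
      also have "\<dots> \<le> (\<Sum>b\<in>B. nsq (\<beta> b + comm (cs (of_real s) M) (\<beta> b) - cs (of_real s) M * \<beta> b * cs (of_real s) M))"
        using M by (intro min) auto
      also have "\<dots> = f s" by (simp add: f_def power2_eq_square)
      finally show ?thesis .
    qed
    ultimately have "2 * Re (ip mu M) = 0"
      using DERIV_local_min[of f "2 * Re (ip mu M)" 0 1] by auto
    then show ?thesis by simp
  qed
  \<comment> \<open>\<open>cs \<i> M\<close> also squares to 0, which upgrades vanishing real parts
    to vanishing products.\<close>
  have nil: "ip mu M = 0" if M: "M \<in> gl d" "M * M = 0" for M
  proof -
    have "Re (ip mu (cs \<i> M)) = 0" using M by (intro re) auto
    then show ?thesis using re[OF M] by (simp add: complex_eq_iff)
  qed
  have orth: "ip (mu * y) x = 0" if x: "x \<in> vecs d" and y: "y \<in> vecs d" and xy: "ip y x = 0" for x y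
  proof -
    have "x * adj y * x = 0" using x y xy by (simp add: outer_app)
    then have "x * adj y * (x * adj y) = 0" by (metis mult.assoc mult_zero_left)
    then have "ip mu (x * adj y) = 0" using x y by (intro nil) (auto simp: vecs_gl)
    then show ?thesis by (simp add: ip_outer_left)
  qed
  define e where "e i = unit_mat i 0" for i
  have e: "e i \<in> vecs d" if "i < d" for i using that by (simp add: e_def vecs_unit_iff)
  have ee: "ip (e i) (e j) = (if i = j then 1 else 0)" for i j by (simp add: e_def ip_unit_vec)
  have onb: "onb d d e" by (simp add: onb_def e ee)
  have off: "ip (mu * e i) (e j) = 0" if "i < d" "j < d" "i \<noteq> j" for i j
    using that by (intro orth) (auto simp: e ee)
  \<comment> \<open>\<open>e i - e 0\<close> and \<open>e i + e 0\<close> are orthogonal, which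
    equates the diagonal entries of \<open>mu\<close>.\<close>
  have dg: "ip (mu * e i) (e i) = ip (mu * e 0) (e 0)" if i: "i < d" for i
  proof (cases "i = 0")
    case False
    have "ip (mu * (e i - e 0)) (e i + e 0) = 0"
      using i False by (intro orth) (auto simp: e ee)
    then show ?thesis using off[of i 0] off[of 0 i] i False by (simp add: right_diff_distrib)
  qed simp
  have "tr mu = 0" by (simp add: mu_def tr_sum)
  then have "(\<Sum>i<d. ip (e i) (mu * e i)) = 0" using onb_tr[OF onb mugl] by simp
  then have "(\<Sum>i<d. ip (e 0) (mu * e 0)) = 0"
    using dg by (metis (no_types, lifting) ip_cnj lessThan_iff sum.cong)
  then have "d = 0 \<or> ip (e 0) (mu * e 0) = 0" by simp
  then have "ip (e i) (mu * e i) = 0" if "i < d" for i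
    using dg[OF that] that by (metis ip_cnj not_less_zero)
  then have z: "ip (e i) (mu * e j) = 0" if "i < d" "j < d" for i j
    using off[of j i] that by (cases "i = j") (auto, metis complex_cnj_zero ip_cnj)
  have "mu = (\<Sum>i<d. \<Sum>j<d. cs (ip (e i) (mu * e j)) (e i * adj (e j)))"
    by (rule onb_expand_gl[OF onb mugl])
  also have "\<dots> = 0" by (intro sum.neutral ballI) (simp add: z)
  finally show ?thesis by (simp add: mu_def)
qed

text \<open>An orthonormal set of greatest cardinality works: a nonzero remainder of some expansion
  could be normalised and added. It serves for the negative Killing form and, later, for a trace
  form.\<close>

lemma form_onb:
  fixes Q :: "'a::euclidean_space \<Rightarrow> 'a \<Rightarrow> real"
  assumes lin: "\<And>y. linear (\<lambda>x. Q x y)" and sym: "\<And>x y. Q x y = Q y x" and pos: "\<And>x. x \<noteq> 0 \<Longrightarrow> Q x x > 0"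
  shows "\<exists>B. finite B \<and> (\<forall>b\<in>B. \<forall>c\<in>B. Q b c = (if b = c then 1 else 0)) \<and> (\<forall>x. x = (\<Sum>b\<in>B. Q x b *\<^sub>R b))"
proof -
  define P where "P B \<longleftrightarrow> finite B \<and> (\<forall>b\<in>B. \<forall>c\<in>B. Q b c = (if b = c then 1 else 0))" for B
  note L = linear_add[OF lin] linear_diff[OF lin] linear_scale[OF lin] linear_sum[OF lin] linear_0[OF lin]
  have indep: "independent B" if B: "P B" for B
  proof
    assume "dependent B"
    then obtain u v where u: "v \<in> B" "u v \<noteq> 0" "(\<Sum>w\<in>B. u w *\<^sub>R w) = 0"
      using B dependent_finite[of B] by (auto simp: P_def)
    have "0 = Q (\<Sum>w\<in>B. u w *\<^sub>R w) v" using u L by simp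
    also have "\<dots> = (\<Sum>w\<in>B. u w * Q w v)" by (simp add: L)
    also have "\<dots> = (\<Sum>w\<in>B. if w = v then u v else 0)"
      using B u by (intro sum.cong) (auto simp: P_def)
    also have "\<dots> = u v" using B u by (simp add: P_def)
    finally show False using u by simp
  qed
  have bnd: "card B < DIM('a) + 1" if "P B" for B
    using independent_bound[OF indep[OF that]] by simp
  have "P {}" by (simp add: P_def)
  then obtain B where B: "P B" and max: "\<And>B'. P B' \<Longrightarrow> card B' \<le> card B"
    using ex_has_greatest_nat[of P "{}" card "DIM('a) + 1"] bnd by auto
  have "x = (\<Sum>b\<in>B. Q x b *\<^sub>R b)" for x
  proof (rule ccontr)
    assume ne: "x \<noteq> (\<Sum>b\<in>B. Q x b *\<^sub>R b)"
    define y where "y = x - (\<Sum>b\<in>B. Q x b *\<^sub>R b)"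
    have "y \<noteq> 0" using ne by (simp add: y_def)
    have yb: "Q y b = 0" if b: "b \<in> B" for b
    proof -
      have "(\<Sum>c\<in>B. Q x c * Q c b) = (\<Sum>c\<in>B. if c = b then Q x b else 0)"
        using B b by (intro sum.cong) (auto simp: P_def)
      then show ?thesis using B b by (simp add: y_def L P_def)
    qed
    define z where "z = (1 / sqrt (Q y y)) *\<^sub>R y"
    have Qy: "Q y y > 0" using pos \<open>y \<noteq> 0\<close> by simp
    have zb: "Q z b = 0" if "b \<in> B" for b using yb[OF that] by (simp add: z_def L)
    have "Q z z = 1 / sqrt (Q y y) * Q y z" by (simp add: z_def L)
    also have "Q y z = 1 / sqrt (Q y y) * Q y y" unfolding sym[of y z] by (simp add: z_def L)
    finally have zz: "Q z z = 1" using Qy by (simp add: field_simps)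
    have "z \<notin> B" using zb[of z] zz by auto
    moreover have "Q b z = 0" if "b \<in> B" for b using zb[OF that] sym[of b z] by simp
    then have "P (insert z B)" using B zb zz by (auto simp: P_def)
    ultimately show False using max[of "insert z B"] B by (simp add: P_def)
  qed
  then show ?thesis using B unfolding P_def by blast
qed

section \<open>Killing form and Casimir identities\<close>

definition tre :: "('a::euclidean_space \<Rightarrow> 'a) \<Rightarrow> real" where "tre L = (\<Sum>c\<in>Basis. L c \<bullet> c)"

lemma tre_comm:
  fixes L M :: "'a::euclidean_space \<Rightarrow> 'a"
  assumes "linear L" "linear M" shows "tre (\<lambda>c. L (M c)) = tre (\<lambda>c. M (L c))"
proof -
  have "tre (\<lambda>c. L (M c)) = (\<Sum>c\<in>Basis. \<Sum>e\<in>Basis. (M c \<bullet> e) * (L e \<bullet> c))" if "linear L" "linear M" for L M :: "'a \<Rightarrow> 'a"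
  proof -
    have "L (M c) \<bullet> c = (\<Sum>e\<in>Basis. (M c \<bullet> e) * (L e \<bullet> c))" for c
    proof -
      have "L (M c) = L (\<Sum>e\<in>Basis. (M c \<bullet> e) *\<^sub>R e)" by (simp add: euclidean_representation)
      also have "\<dots> = (\<Sum>e\<in>Basis. (M c \<bullet> e) *\<^sub>R L e)" using that by (simp add: linear_sum linear_scale)
      finally show ?thesis by (simp add: inner_sum_left)
    qed
    then show ?thesis by (simp add: tre_def)
  qed
  from this[OF assms] this[OF assms(2,1)] show ?thesis
    by (subst (asm) (2) sum.swap) (simp add: mult.commute)
qed

lemma killing_linear:
  assumes "lie_algebra br" shows "linear (\<lambda>x. killing_form br x y)"
proof -
  have l: "\<And>z. linear (\<lambda>x. br x z)" using assms by (auto simp: lie_algebra_def)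
  show ?thesis
    unfolding killing_form_def
    by (rule linearI) (simp_all add: linear_add[OF l] linear_scale[OF l] inner_add_left sum.distrib sum_distrib_left)
qed

lemma killing_sym:
  assumes "lie_algebra br" shows "killing_form br x y = killing_form br y x"
proof -
  have "\<And>x. linear (br x)" using assms by (auto simp: lie_algebra_def)
  from tre_comm[OF this this] show ?thesis by (simp add: killing_form_def tre_def)
qed

text \<open>Here \<open>Q\<close> is the negative Killing form, not the projected operator of
  \<open>star_alg\<close>, and \<open>B\<close> is an orthonormal basis for it.\<close>

locale compact_lie =
  fixes br :: "'a::euclidean_space \<Rightarrow> 'a \<Rightarrow> 'a" and Q :: "'a \<Rightarrow> 'a \<Rightarrow> real" and B :: "'a set"
  assumes semisimple: "compact_semisimple br"
    and Q_def: "Q x y = - killing_form br x y"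
    and finB: "finite B"
    and QB: "b \<in> B \<Longrightarrow> c \<in> B \<Longrightarrow> Q b c = (if b = c then 1 else 0)"
    and expand: "x = (\<Sum>b\<in>B. Q x b *\<^sub>R b)"

lemma ex_compact_lie:
  assumes "compact_semisimple br"
  shows "\<exists>Q B. compact_lie br Q B"
proof -
  have l: "lie_algebra br" using assms by (simp add: compact_semisimple_def)
  define Q where "Q x y = - killing_form br x y" for x y
  have "linear (\<lambda>x. Q x y)" for y unfolding Q_def by (rule linear_compose_neg[OF killing_linear[OF l]])
  moreover have "Q x y = Q y x" for x y by (simp add: Q_def killing_sym[OF l])
  moreover have "x \<noteq> 0 \<Longrightarrow> Q x x > 0" for x using assms by (simp add: Q_def compact_semisimple_def)
  ultimately obtain B where "finite B" "\<forall>b\<in>B. \<forall>c\<in>B. Q b c = (if b = c then 1 else 0)" "\<forall>x. x = (\<Sum>b\<in>B. Q x b *\<^sub>R b)"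
    using form_onb[of Q] by blast
  then have "compact_lie br Q B" using assms by unfold_locales (auto simp: Q_def)
  then show ?thesis by blast
qed

context compact_lie
begin

lemma lin1: "linear (\<lambda>x. br x y)" and lin2: "linear (br x)" and br_self: "br x x = 0"
  and jacobi: "br x (br y z) + br y (br z x) + br z (br x y) = 0"
  using semisimple by (auto simp: compact_semisimple_def lie_algebra_def)

lemma lie: "lie_algebra br"
  using semisimple by (simp add: compact_semisimple_def)

lemma linQ1: "linear (\<lambda>x. Q x y)"
  unfolding Q_def by (rule linear_compose_neg[OF killing_linear[OF lie]])

lemma Q_sym: "Q x y = Q y x"
  by (simp add: Q_def killing_sym[OF lie])

lemma linQ2: "linear (Q x)"
  using linQ1[of x] by (subst (asm) Q_sym)

lemmas lin_simps = linear_add[OF linQ1] linear_add[OF linQ2] linear_scale[OF linQ1] linear_scale[OF linQ2]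
  linear_sum[OF linQ1] linear_sum[OF linQ2] linear_neg[OF linQ1] linear_neg[OF linQ2]
  linear_diff[OF linQ1] linear_diff[OF linQ2]

lemmas br_lin = linear_add[OF lin1] linear_add[OF lin2] linear_scale[OF lin1] linear_scale[OF lin2]
  linear_sum[OF lin1] linear_sum[OF lin2] linear_neg[OF lin1] linear_neg[OF lin2]
  linear_diff[OF lin1] linear_diff[OF lin2]

lemma br_anti: "br x y = - br y x"
proof -
  have "br (x + y) (x + y) = br x (x + y) + br y (x + y)" by (rule linear_add[OF lin1])
  also have "\<dots> = (br x x + br x y) + (br y x + br y y)" by (simp only: linear_add[OF lin2])
  finally have "br x y + br y x = 0" by (simp add: br_self)
  then show ?thesis by (simp add: add_eq_0_iff)
qed

lemma Q_inv: "Q (br x y) z = - Q y (br x z)"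
proof -
  have "killing_form br (br x y) z = tre (\<lambda>c. br x (br y (br z c))) - tre (\<lambda>c. br y (br x (br z c)))"
  proof -
    have "br (br x y) w = br x (br y w) - br y (br x w)" for w
      using jacobi[of x y w] br_anti[of w "br x y"] br_anti[of w x] by (simp add: br_lin algebra_simps)
    then show ?thesis by (simp add: killing_form_def tre_def inner_diff_left sum_subtractf)
  qed
  moreover have "killing_form br y (br x z) = tre (\<lambda>c. br y (br x (br z c))) - tre (\<lambda>c. br y (br z (br x c)))"
  proof -
    have "br (br x z) w = br x (br z w) - br z (br x w)" for w
      using jacobi[of x z w] br_anti[of w "br x z"] br_anti[of w x] by (simp add: br_lin algebra_simps)
    then show ?thesis by (simp add: killing_form_def tre_def inner_diff_left sum_subtractf br_lin)
  qed
  moreover have "tre (\<lambda>c. br x (br y (br z c))) = tre (\<lambda>c. br y (br z (br x c)))"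
    using tre_comm[OF lin2[of x], of "\<lambda>c. br y (br z c)"] lin2 linear_compose[OF lin2 lin2] by (simp add: o_def)
  ultimately show ?thesis by (simp add: Q_def)
qed

lemma tre_Q: "linear L \<Longrightarrow> tre L = (\<Sum>b\<in>B. Q (L b) b)"
proof -
  assume L: "linear L"
  have "tre L = (\<Sum>c\<in>Basis. \<Sum>b\<in>B. Q c b * (L b \<bullet> c))"
  proof -
    have "L c \<bullet> c = (\<Sum>b\<in>B. Q c b * (L b \<bullet> c))" for c
    proof -
      have "L c = L (\<Sum>b\<in>B. Q c b *\<^sub>R b)" by (rule arg_cong[OF expand])
      also have "\<dots> = (\<Sum>b\<in>B. Q c b *\<^sub>R L b)" by (simp add: linear_sum[OF L] linear_scale[OF L])
      finally show ?thesis by (simp add: inner_sum_left)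
    qed
    then show ?thesis by (simp add: tre_def)
  qed
  also have "\<dots> = (\<Sum>b\<in>B. \<Sum>c\<in>Basis. Q c b * (L b \<bullet> c))" by (rule sum.swap)
  also have "\<dots> = (\<Sum>b\<in>B. Q (\<Sum>c\<in>Basis. (L b \<bullet> c) *\<^sub>R c) b)"
    by (simp add: lin_simps mult.commute)
  finally show ?thesis by (simp add: euclidean_representation)
qed

text \<open>The Killing form is the trace of \<open>ad x ad y\<close>. Taken in the basis
  \<open>B\<close> and combined with invariance, this writes \<open>Q\<close> in terms of itself,
  which is the source of the normalisations in \<open>casimir\<close> and
  \<open>struct_const\<close>.\<close>

lemma Q_casimir: "Q x y = (\<Sum>b\<in>B. Q (br b x) (br b y))"
proof -
  have "killing_form br x y = tre (\<lambda>c. br x (br y c))" by (simp add: killing_form_def tre_def)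
  also have "\<dots> = (\<Sum>b\<in>B. Q (br x (br y b)) b)"
    using linear_compose[OF lin2 lin2] by (intro tre_Q) (simp add: o_def)
  also have "\<dots> = (\<Sum>b\<in>B. - Q (br b x) (br b y))"
  proof (intro sum.cong refl)
    fix b
    show "Q (br x (br y b)) b = - Q (br b x) (br b y)"
      unfolding Q_inv[of x "br y b" b]
      by (subst br_anti[of y b], subst br_anti[of x b])
        (simp add: linear_neg[OF linQ1] linear_neg[OF linQ2] Q_sym[of "br b y"])
  qed
  finally show ?thesis by (simp add: Q_def[of x y] sum_negf)
qed

lemma Q_eqI: "(\<And>y. Q x y = Q z y) \<Longrightarrow> x = z"
  using expand[of x] expand[of z] by simp

lemma casimir: "(\<Sum>b\<in>B. br b (br b x)) = - x"
proof (rule Q_eqI)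
  fix y
  have "Q (\<Sum>b\<in>B. br b (br b x)) y = (\<Sum>b\<in>B. Q (br b (br b x)) y)" by (rule linear_sum[OF linQ1])
  also have "\<dots> = (\<Sum>b\<in>B. - Q (br b x) (br b y))" by (simp only: Q_inv)
  also have "\<dots> = - Q x y" by (simp only: sum_negf Q_casimir[of x y])
  also have "\<dots> = Q (- x) y" by (rule linear_neg[OF linQ1, symmetric])
  finally show "Q (\<Sum>b\<in>B. br b (br b x)) y = Q (- x) y" .
qed

lemma parseval: "Q x y = (\<Sum>b\<in>B. Q x b * Q y b)"
  by (subst expand[of x]) (simp add: lin_simps Q_sym expand[symmetric])

lemma struct_const: "(\<Sum>i\<in>B. \<Sum>j\<in>B. Q (br i j) k * Q (br i j) l) = Q k l"
proof -
  have "(\<Sum>j\<in>B. Q (br i j) k * Q (br i j) l) = Q (br i k) (br i l)" for i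
  proof -
    have "Q (br i j) k * Q (br i j) l = Q (br i k) j * Q (br i l) j" for j
      by (simp only: Q_inv[of i j] Q_sym[of j] mult_minus_left mult_minus_right minus_minus)
    then show ?thesis by (simp only: parseval[of "br i k" "br i l"])
  qed
  then show ?thesis by (simp only: Q_casimir[of k l])
qed

definition frep :: "nat \<Rightarrow> ('a \<Rightarrow> fmat) \<Rightarrow> bool" where
  "frep d \<beta> \<longleftrightarrow> (\<forall>x. \<beta> x \<in> gl d) \<and> (\<forall>x y. \<beta> (x + y) = \<beta> x + \<beta> y) \<and>
     (\<forall>r x. \<beta> (r *\<^sub>R x) = cs (of_real r) (\<beta> x)) \<and> (\<forall>x y. \<beta> (br x y) = comm (\<beta> x) (\<beta> y))"

lemma frepD:
  assumes "frep d \<beta>"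
  shows "\<beta> x \<in> gl d" "\<beta> (x + y) = \<beta> x + \<beta> y" "\<beta> (r *\<^sub>R x) = cs (of_real r) (\<beta> x)"
    "\<beta> (br x y) = comm (\<beta> x) (\<beta> y)" "\<beta> 0 = 0" "\<beta> (- x) = - \<beta> x"
    "\<beta> (sum f S) = (\<Sum>s\<in>S. \<beta> (f s))"
proof -
  show 1: "\<beta> x \<in> gl d" "\<beta> (x + y) = \<beta> x + \<beta> y" "\<beta> (r *\<^sub>R x) = cs (of_real r) (\<beta> x)"
    "\<beta> (br x y) = comm (\<beta> x) (\<beta> y)" for x y r using assms by (auto simp: frep_def)
  show z: "\<beta> 0 = 0" using 1(3)[of 0 0] by simp
  show "\<beta> (- x) = - \<beta> x" using 1(3)[of "-1" x] by simp
  show "\<beta> (sum f S) = (\<Sum>s\<in>S. \<beta> (f s))"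
    by (induction S rule: infinite_finite_induct) (auto simp: z 1)
qed

text \<open>If the moment map of the tuple \<open>\<beta> b\<close> vanishes, both \<open>[\<beta> i, \<beta> j]\<close> and \<open>[\<beta> i\<^sup>*, \<beta> j]\<close> have total
  square norm \<open>N\<close> while their total inner product is \<open>- N\<close>: equality in Cauchy--Schwarz.\<close>
lemma critical_skew:
  assumes rep: "frep d \<beta>" and crit: "(\<Sum>b\<in>B. comm (\<beta> b) (adj (\<beta> b))) = 0"
  shows "adj (\<beta> x) = - \<beta> x"
proof -
  note \<beta> = frepD[OF rep]
  define N where "N = (\<Sum>b\<in>B. ip (\<beta> b) (\<beta> b))"
  have Nreal: "cnj N = N" by (simp add: N_def ip_cnj)
  have \<beta>e: "\<beta> x = (\<Sum>b\<in>B. cs (of_real (Q x b)) (\<beta> b))" for x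
  proof -
    have "\<beta> x = \<beta> (\<Sum>b\<in>B. Q x b *\<^sub>R b)" by (rule arg_cong[OF expand])
    then show ?thesis by (simp add: \<beta>)
  qed
  \<comment> \<open>By \<open>struct_const\<close> the contracted structure constants form the
    identity matrix, so the brackets have the same total norm as the \<open>\<beta> b\<close>
    themselves.\<close>
  have s2: "(\<Sum>i\<in>B. \<Sum>j\<in>B. ip (comm (\<beta> i) (\<beta> j)) (comm (\<beta> i) (\<beta> j))) = N"
  proof -
    have "(\<Sum>i\<in>B. \<Sum>j\<in>B. ip (comm (\<beta> i) (\<beta> j)) (comm (\<beta> i) (\<beta> j)))
      = (\<Sum>i\<in>B. \<Sum>j\<in>B. \<Sum>k\<in>B. \<Sum>l\<in>B. of_real (Q (br i j) k * Q (br i j) l) * ip (\<beta> k) (\<beta> l))"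
    proof (intro sum.cong refl)
      fix i j
      have "comm (\<beta> i) (\<beta> j) = (\<Sum>k\<in>B. cs (of_real (Q (br i j) k)) (\<beta> k))"
        using \<beta>e[of "br i j"] by (simp add: \<beta>)
      then show "ip (comm (\<beta> i) (\<beta> j)) (comm (\<beta> i) (\<beta> j))
         = (\<Sum>k\<in>B. \<Sum>l\<in>B. of_real (Q (br i j) k * Q (br i j) l) * ip (\<beta> k) (\<beta> l))"
        by (simp add: ip_sum sum_distrib_left) (subst sum.swap, simp add: mult_ac)
    qed
    also have "\<dots> = (\<Sum>i\<in>B. \<Sum>k\<in>B. \<Sum>j\<in>B. \<Sum>l\<in>B. of_real (Q (br i j) k * Q (br i j) l) * ip (\<beta> k) (\<beta> l))"
      by (intro sum.cong refl sum.swap)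
    also have "\<dots> = (\<Sum>i\<in>B. \<Sum>k\<in>B. \<Sum>l\<in>B. \<Sum>j\<in>B. of_real (Q (br i j) k * Q (br i j) l) * ip (\<beta> k) (\<beta> l))"
      by (intro sum.cong refl sum.swap)
    also have "\<dots> = (\<Sum>k\<in>B. \<Sum>i\<in>B. \<Sum>l\<in>B. \<Sum>j\<in>B. of_real (Q (br i j) k * Q (br i j) l) * ip (\<beta> k) (\<beta> l))"
      by (rule sum.swap)
    also have "\<dots> = (\<Sum>k\<in>B. \<Sum>l\<in>B. \<Sum>i\<in>B. \<Sum>j\<in>B. of_real (Q (br i j) k * Q (br i j) l) * ip (\<beta> k) (\<beta> l))"
      by (intro sum.cong refl sum.swap)
    also have "\<dots> = (\<Sum>k\<in>B. \<Sum>l\<in>B. of_real (Q k l) * ip (\<beta> k) (\<beta> l))"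
    proof (intro sum.cong refl)
      fix k l
      show "(\<Sum>i\<in>B. \<Sum>j\<in>B. of_real (Q (br i j) k * Q (br i j) l) * ip (\<beta> k) (\<beta> l)) = of_real (Q k l) * ip (\<beta> k) (\<beta> l)"
        by (subst struct_const[of k l, symmetric]) (simp add: sum_distrib_right)
    qed
    also have "\<dots> = (\<Sum>k\<in>B. \<Sum>l\<in>B. if l = k then ip (\<beta> k) (\<beta> k) else 0)"
      by (intro sum.cong refl) (auto simp: QB)
    finally show ?thesis using finB by (simp add: N_def)
  qed
  \<comment> \<open>Term by term the difference to \<open>s2\<close> is the action of
    \<open>comm (\<beta> i) (adj (\<beta> i))\<close>, and the sum of these over \<open>i\<close> is
    the moment map.\<close>
  have s3: "(\<Sum>i\<in>B. \<Sum>j\<in>B. ip (comm (adj (\<beta> i)) (\<beta> j)) (comm (adj (\<beta> i)) (\<beta> j))) = N"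
  proof -
    have "ip (comm (adj (\<beta> i)) (\<beta> j)) (comm (adj (\<beta> i)) (\<beta> j)) - ip (comm (\<beta> i) (\<beta> j)) (comm (\<beta> i) (\<beta> j))
       = ip (\<beta> j) (comm (comm (\<beta> i) (adj (\<beta> i))) (\<beta> j))" for i j
    proof -
      have "comm X (comm Y Z) - comm Y (comm X Z) = comm (comm X Y) Z" for X Y Z
        by (simp add: comm_def algebra_simps)
      then show ?thesis by (simp add: ip_comm flip: ip_simps(4))
    qed
    then have "(\<Sum>i\<in>B. \<Sum>j\<in>B. ip (comm (adj (\<beta> i)) (\<beta> j)) (comm (adj (\<beta> i)) (\<beta> j)))
       - (\<Sum>i\<in>B. \<Sum>j\<in>B. ip (comm (\<beta> i) (\<beta> j)) (comm (\<beta> i) (\<beta> j)))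
       = (\<Sum>i\<in>B. \<Sum>j\<in>B. ip (\<beta> j) (comm (comm (\<beta> i) (adj (\<beta> i))) (\<beta> j)))"
      by (simp only: sum_subtractf[symmetric])
    also have "\<dots> = (\<Sum>j\<in>B. \<Sum>i\<in>B. ip (\<beta> j) (comm (comm (\<beta> i) (adj (\<beta> i))) (\<beta> j)))"
      by (rule sum.swap)
    also have "\<dots> = (\<Sum>j\<in>B. ip (\<beta> j) (comm (\<Sum>i\<in>B. comm (\<beta> i) (adj (\<beta> i))) (\<beta> j)))"
      by (simp only: comm_sum ip_sum)
    finally show ?thesis using s2 crit by simp
  qed
  \<comment> \<open>Moving the adjoint across the product leaves a double bracket with
    \<open>\<beta> i\<close>, whose sum is the Casimir of the adjoint representation, that is
    -1.\<close>
  have s4: "(\<Sum>i\<in>B. \<Sum>j\<in>B. ip (comm (adj (\<beta> i)) (\<beta> j)) (comm (\<beta> i) (\<beta> j))) = - N"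
  proof -
    have "(\<Sum>i\<in>B. \<Sum>j\<in>B. ip (comm (adj (\<beta> i)) (\<beta> j)) (comm (\<beta> i) (\<beta> j)))
      = (\<Sum>i\<in>B. \<Sum>j\<in>B. ip (\<beta> j) (\<beta> (br i (br i j))))"
      by (simp add: ip_comm \<beta>)
    also have "\<dots> = (\<Sum>j\<in>B. \<Sum>i\<in>B. ip (\<beta> j) (\<beta> (br i (br i j))))" by (rule sum.swap)
    also have "\<dots> = (\<Sum>j\<in>B. ip (\<beta> j) (\<beta> (\<Sum>i\<in>B. br i (br i j))))"
      by (simp only: \<beta>(7) ip_sum)
    also have "\<dots> = - N" by (simp add: casimir \<beta>(6) N_def sum_negf)
    finally show ?thesis .
  qed
  have s4': "(\<Sum>i\<in>B. \<Sum>j\<in>B. ip (comm (\<beta> i) (\<beta> j)) (comm (adj (\<beta> i)) (\<beta> j))) = - N"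
    using arg_cong[OF s4, of cnj] by (simp add: ip_cnj Nreal)
  have "(\<Sum>i\<in>B. \<Sum>j\<in>B. ip (comm (adj (\<beta> i)) (\<beta> j) + comm (\<beta> i) (\<beta> j)) (comm (adj (\<beta> i)) (\<beta> j) + comm (\<beta> i) (\<beta> j))) = 0"
    using s2 s3 s4 s4' by (simp add: sum.distrib)
  then have "complex_of_real (\<Sum>i\<in>B. \<Sum>j\<in>B. nsq (comm (adj (\<beta> i)) (\<beta> j) + comm (\<beta> i) (\<beta> j))) = 0"
    by (simp add: ip_self)
  then have "(\<Sum>i\<in>B. \<Sum>j\<in>B. nsq (comm (adj (\<beta> i)) (\<beta> j) + comm (\<beta> i) (\<beta> j))) = 0"
    unfolding of_real_eq_0_iff .
  then have "comm (adj (\<beta> i)) (\<beta> j) + comm (\<beta> i) (\<beta> j) = 0" if "i \<in> B" "j \<in> B" for i j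
    using that finB by (simp add: sum_nonneg_eq_0_iff sum_nonneg)
  then have c: "comm (adj (\<beta> i)) (\<beta> j) = - comm (\<beta> i) (\<beta> j)" if "i \<in> B" "j \<in> B" for i j
    using that by (simp add: add_eq_0_iff2)
  define H where "H x = \<beta> x + adj (\<beta> x)" for x
  \<comment> \<open>Taking adjoints in \<open>c\<close> and exchanging \<open>i\<close> with
    \<open>j\<close> shows that brackets of basis elements have skew-Hermitian images.\<close>
  have H0: "H (br i j) = 0" if ij: "i \<in> B" "j \<in> B" for i j
  proof -
    have "comm (adj (\<beta> j)) (\<beta> i) = adj (comm (adj (\<beta> i)) (\<beta> j))" by (simp add: adj_comm)
    also have "\<dots> = - comm (adj (\<beta> j)) (adj (\<beta> i))" unfolding c[OF ij] by (simp add: adj_comm)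
    finally have "comm (adj (\<beta> j)) (adj (\<beta> i)) = comm (\<beta> j) (\<beta> i)" using c[OF ij(2,1)] by simp
    then show ?thesis by (simp add: H_def \<beta> adj_comm comm_swap[of "\<beta> j"])
  qed
  have Hs: "H (sum f S) = (\<Sum>s\<in>S. H (f s))" "H (r *\<^sub>R y) = cs (of_real r) (H y)" "H (- y) = - H y"
    for f :: "'a \<Rightarrow> 'a" and S r y
    by (simp_all add: H_def \<beta> adj_sum sum.distrib)
  have Hb: "H (br i y) = 0" if i: "i \<in> B" for i y
  proof -
    have "br i y = (\<Sum>b\<in>B. Q y b *\<^sub>R br i b)"
    proof -
      have "br i y = br i (\<Sum>b\<in>B. Q y b *\<^sub>R b)" by (rule arg_cong[OF expand])
      then show ?thesis by (simp add: linear_sum[OF lin2] linear_scale[OF lin2])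
    qed
    then show ?thesis by (simp add: Hs H0 i)
  qed
  \<comment> \<open>The Casimir identity writes every element as a sum of brackets, on which
    \<open>H\<close> is already known to vanish.\<close>
  have "- H x = H (\<Sum>b\<in>B. br b (br b x))" by (simp add: casimir Hs)
  also have "\<dots> = 0" by (simp add: Hs Hb)
  finally have "H x = 0" by simp
  then have "\<beta> x + adj (\<beta> x) = 0" unfolding H_def .
  then show ?thesis by (simp add: add_eq_0_iff)
qed

text \<open>Kempf--Ness: minimise the norm of the representation over its conjugates. The limit of a
  minimising sequence is critical, and the rescaled conjugating matrices converge to a nonzero
  intertwiner.\<close>
lemma ex_unitary_limit:
  assumes rep: "frep d \<phi>" and d: "0 < d"
  shows "\<exists>\<beta> T. frep d \<beta> \<and> (\<forall>x. adj (\<beta> x) = - \<beta> x) \<and> T \<in> gl d \<and> T \<noteq> 0 \<and> (\<forall>x. T * \<phi> x = \<beta> x * T)"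
proof -
  note \<phi> = frepD[OF rep]
  \<comment> \<open>Carrying the inverse along as a second component keeps \<open>F\<close> an
    explicit expression.\<close>
  define G where "G = {(g, h). g \<in> gl d \<and> h \<in> gl d \<and> g * h = Idm d \<and> h * g = Idm d}"
  define F where "F = (\<lambda>(g, h). \<Sum>b\<in>B. nsq (g * \<phi> b * h))"
  have F0: "F z \<ge> 0" for z by (auto simp: F_def split: prod.split intro!: sum_nonneg)
  define m where "m = Inf (F ` G)"
  have Gne: "F ` G \<noteq> {}" by (auto simp: G_def intro!: exI[of _ "Idm d"])
  have bdd: "bdd_below (F ` G)" using F0 by (auto intro!: bdd_belowI[of _ 0])
  have m: "m \<le> F z" if "z \<in> G" for z unfolding m_def using that bdd by (intro cInf_lower) auto
  have "\<exists>z\<in>G. F z < m + 1 / real (Suc n)" for n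
    using cInf_lessD[OF Gne, of "m + 1 / real (Suc n)"] by (auto simp: m_def)
  then obtain z where z: "\<And>n. z n \<in> G" "\<And>n. F (z n) < m + 1 / real (Suc n)" by metis
  define g where "g n = fst (z n)" for n
  define h where "h n = snd (z n)" for n
  have gh: "g n \<in> gl d" "h n \<in> gl d" "g n * h n = Idm d" "h n * g n = Idm d" for n
    using z(1)[of n] by (auto simp: G_def g_def h_def split: prod.splits)
  define X where "X n x = g n * \<phi> x * h n" for n x
  have Fz: "F (z n) = (\<Sum>b\<in>B. nsq (X n b))" for n
    by (simp add: F_def X_def g_def h_def split: prod.split)
  have Xgl: "X n x \<in> gl d" for n x by (simp add: X_def gh \<phi>)
  have Xrep: "frep d (X n)" for n
    unfolding frep_def
  proof (intro conjI allI)
    fix x y r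
    show "X n x \<in> gl d" by (rule Xgl)
    show "X n (x + y) = X n x + X n y" by (simp add: X_def \<phi> algebra_simps)
    show "X n (r *\<^sub>R x) = cs (complex_of_real r) (X n x)" by (simp add: X_def \<phi>)
    have "X n x * X n y = g n * \<phi> x * (h n * g n) * \<phi> y * h n" for x y by (simp add: X_def mult.assoc)
    then have "X n x * X n y = g n * (\<phi> x * \<phi> y) * h n" for x y using \<phi>(1) gh by (simp add: mult.assoc)
    then show "X n (br x y) = comm (X n x) (X n y)"
      by (simp add: comm_def) (simp add: X_def \<phi> comm_def algebra_simps)
  qed
  \<comment> \<open>The conjugating matrices may be unbounded along the sequence; scaled to norm 1
    they still intertwine, stay in a compact set and cannot tend to 0.\<close>
  define t where "t n = 1 / sqrt (nsq (g n))" for n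
  have gne: "g n \<noteq> 0" for n
  proof
    assume "g n = 0"
    then have "ent (Idm d) 0 0 = 0" using gh(3)[of n] by (metis ent_simps(1) mult_zero_left)
    then show False using d by simp
  qed
  have gpos: "nsq (g n) > 0" for n
    using gne[of n] nsq_nonneg[of "g n"] nsq_eq_0_iff[of "g n"] by linarith
  define T where "T n = cs (of_real (t n)) (g n)" for n
  have Tgl: "T n \<in> gl d" for n by (simp add: T_def gh)
  have nT: "nsq (T n) = 1" for n
    using gpos[of n] gne[of n] by (simp add: T_def nsq_cs t_def norm_divide power_divide)
  have bX: "nsq (X n b) \<le> m + 1" if "b \<in> B" for n b
  proof -
    have "nsq (X n b) \<le> F (z n)" unfolding Fz using that finB by (intro member_le_sum) auto
    also have "\<dots> \<le> m + 1 / real (Suc n)" using z(2)[of n] by simp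
    also have "\<dots> \<le> m + 1" by simp
    finally show ?thesis .
  qed
  have m0: "m \<ge> 0" unfolding m_def using Gne F0 by (intro cInf_greatest) auto
  \<comment> \<open>\<open>None\<close> indexes the intertwiners and \<open>Some b\<close> the
    images of basis elements, so that one subsequence serves all of them.\<close>
  define Y where "Y = (\<lambda>k n. case k of None \<Rightarrow> T n | Some b \<Rightarrow> X n b)"
  have "\<exists>r L. strict_mono (r :: nat \<Rightarrow> nat) \<and> (\<forall>k\<in>insert None (Some ` B). L k \<in> gl d \<and> fconv (\<lambda>n. Y k (r n)) (L k))"
    by (rule fseq_compact[where C = "m + 1"]) (use finB Tgl Xgl nT bX m0 in \<open>auto simp: Y_def\<close>)
  then obtain r L where r: "strict_mono (r :: nat \<Rightarrow> nat)"
    and L: "\<And>k. k \<in> insert None (Some ` B) \<Longrightarrow> L k \<in> gl d \<and> fconv (\<lambda>n. Y k (r n)) (L k)" by blast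
  define S where "S = L None"
  have S: "S \<in> gl d" "fconv (\<lambda>n. T (r n)) S" using L[of None] by (auto simp: S_def Y_def)
  have Lb: "L (Some b) \<in> gl d" "fconv (\<lambda>n. X (r n) b) (L (Some b))" if "b \<in> B" for b
    using L[of "Some b"] that by (auto simp: Y_def)
  define \<beta> where "\<beta> x = (\<Sum>b\<in>B. cs (of_real (Q x b)) (L (Some b)))" for x
  have \<beta>gl: "\<beta> x \<in> gl d" for x unfolding \<beta>_def by (intro gl_sum) (simp add: Lb)
  have conv: "fconv (\<lambda>n. X (r n) x) (\<beta> x)" for x
  proof -
    have "X k x = (\<Sum>b\<in>B. cs (of_real (Q x b)) (X k b))" for k
    proof -
      have "X k x = X k (\<Sum>b\<in>B. Q x b *\<^sub>R b)" by (rule arg_cong[OF expand])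
      then show ?thesis by (simp add: frepD[OF Xrep])
    qed
    then show ?thesis unfolding \<beta>_def by (simp add: fconv_sum fconv_cs Lb)
  qed
  have cm: "fconv (\<lambda>n. comm (X (r n) x) (X (r n) y)) (comm (\<beta> x) (\<beta> y))" for x y
    unfolding comm_def by (intro fconv_diff fconv_mult[of _ _ _ _ d] conv Xgl \<beta>gl)
  have \<beta>rep: "frep d \<beta>"
    unfolding frep_def
  proof (intro conjI allI)
    fix x y c
    show "\<beta> x \<in> gl d" by (rule \<beta>gl)
    show "\<beta> (x + y) = \<beta> x + \<beta> y" by (simp add: \<beta>_def lin_simps cs_add sum.distrib)
    show "\<beta> (c *\<^sub>R x) = cs (complex_of_real c) (\<beta> x)" by (simp add: \<beta>_def lin_simps cs_sum)
    show "\<beta> (br x y) = comm (\<beta> x) (\<beta> y)"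
      using fconv_unique[OF conv[of "br x y"]] cm[of x y] by (simp add: frepD(4)[OF Xrep])
  qed
  have lim_m: "(\<lambda>n. F (z (r n))) \<longlonglongrightarrow> m"
  proof (rule tendsto_sandwich[of "\<lambda>_. m" _ _ "\<lambda>n. m + 1 / real (Suc (r n))"])
    show "\<forall>\<^sub>F n in sequentially. m \<le> F (z (r n))" using m z(1) by simp
    show "\<forall>\<^sub>F n in sequentially. F (z (r n)) \<le> m + 1 / real (Suc (r n))"
      using z(2) by (simp add: less_imp_le)
    have "(\<lambda>n. 1 / real (Suc n)) \<longlonglongrightarrow> 0" by (rule LIMSEQ_Suc[OF lim_1_over_n])
    from tendsto_add[OF tendsto_const LIMSEQ_subseq_LIMSEQ[OF this r], of m]
    show "(\<lambda>n. m + 1 / real (Suc (r n))) \<longlonglongrightarrow> m" by (simp add: o_def)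
  qed simp
  have "(\<lambda>n. F (z (r n))) \<longlonglongrightarrow> (\<Sum>b\<in>B. nsq (\<beta> b))"
    unfolding Fz by (intro tendsto_sum fconv_nsq[of _ _ d] conv Xgl \<beta>gl)
  then have mb: "(\<Sum>b\<in>B. nsq (\<beta> b)) = m" using lim_m LIMSEQ_unique by blast
  \<comment> \<open>The limit is not yet known to be a conjugate of \<phi>. The inequality for the
    competitors 1 + M holds for each member of the sequence, which is a conjugate, and survives in
    the limit.\<close>
  have "(\<Sum>b\<in>B. comm (\<beta> b) (adj (\<beta> b))) = 0"
  proof (rule nilpotent_critical[OF finB \<beta>gl])
    fix M assume M: "M \<in> gl d" "M * M = 0"
    have P: "(Idm d + M) * W * (Idm d - M) = W + comm M W - M * W * M" if "W \<in> gl d" for W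
      using that M(1) by (simp add: comm_def algebra_simps)
    have "m \<le> (\<Sum>b\<in>B. nsq (X k b + comm M (X k b) - M * X k b * M))" for k
    proof -
      have 1: "(Idm d + M) * (Idm d - M) = Idm d" "(Idm d - M) * (Idm d + M) = Idm d"
        using M by (simp_all add: algebra_simps)
      have "(Idm d + M) * g k * (h k * (Idm d - M)) = (Idm d + M) * (g k * h k) * (Idm d - M)"
        by (simp add: mult.assoc)
      also have "\<dots> = Idm d" unfolding gh using 1 M(1) by simp
      finally have 2: "(Idm d + M) * g k * (h k * (Idm d - M)) = Idm d" .
      have "h k * (Idm d - M) * ((Idm d + M) * g k) = h k * ((Idm d - M) * (Idm d + M)) * g k"
        by (simp add: mult.assoc)
      also have "\<dots> = Idm d" unfolding 1 using gh by simp
      finally have "((Idm d + M) * g k, h k * (Idm d - M)) \<in> G"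
        using 2 gh M(1) by (simp add: G_def)
      from m[OF this] have "m \<le> (\<Sum>b\<in>B. nsq ((Idm d + M) * g k * \<phi> b * (h k * (Idm d - M))))"
        by (simp add: F_def)
      also have "\<dots> = (\<Sum>b\<in>B. nsq ((Idm d + M) * X k b * (Idm d - M)))"
        by (simp add: X_def mult.assoc)
      finally show ?thesis by (simp only: P[OF Xgl])
    qed
    moreover have "(\<lambda>n. \<Sum>b\<in>B. nsq (X (r n) b + comm M (X (r n) b) - M * X (r n) b * M))
       \<longlonglongrightarrow> (\<Sum>b\<in>B. nsq (\<beta> b + comm M (\<beta> b) - M * \<beta> b * M))"
      unfolding comm_def
      by (intro tendsto_sum fconv_nsq[of _ _ d] fconv_add fconv_diff fconv_mult[of _ _ _ _ d]
            conv Xgl \<beta>gl fconv_const gl_closed M)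
    ultimately show "(\<Sum>b\<in>B. nsq (\<beta> b)) \<le> (\<Sum>b\<in>B. nsq (\<beta> b + comm M (\<beta> b) - M * \<beta> b * M))"
      unfolding mb by (intro LIMSEQ_le_const) auto
  qed
  then have skew: "adj (\<beta> x) = - \<beta> x" for x by (rule critical_skew[OF \<beta>rep])
  have "S \<noteq> 0"
  proof
    assume "S = 0"
    have "(\<lambda>n. nsq (T (r n))) \<longlonglongrightarrow> nsq S" by (intro fconv_nsq[of _ _ d] S Tgl)
    then have "1 = nsq S" by (simp only: nT LIMSEQ_const_iff)
    moreover have "nsq S = 0" using \<open>S = 0\<close> by simp
    ultimately show False by simp
  qed
  moreover have "S * \<phi> x = \<beta> x * S" for x
  proof (rule fconv_unique)
    show "fconv (\<lambda>n. T (r n) * \<phi> x) (S * \<phi> x)"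
      by (intro fconv_mult[of _ _ _ _ d] S Tgl fconv_const)
    have "T k * \<phi> x = X k x * T k" for k
    proof -
      have "X k x * g k = g k * \<phi> x * (h k * g k)" by (simp add: X_def mult.assoc)
      also have "\<dots> = g k * \<phi> x" using gh \<phi>(1) by simp
      finally show ?thesis by (simp add: T_def)
    qed
    then show "fconv (\<lambda>n. T (r n) * \<phi> x) (\<beta> x * S)"
      by (simp, intro fconv_mult[of _ _ _ _ d] conv S Xgl \<beta>gl)
  qed
  ultimately show ?thesis using \<beta>rep skew S(1) by blast
qed

end

section \<open>Transfer to carrier-based matrices\<close>

lift_definition fm :: "nat \<Rightarrow> complex mat \<Rightarrow> fmat" is
  "\<lambda>d M i j. if i < d \<and> j < d then M $$ (i, j) else 0"
proof -
  fix d and M :: "complex mat"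
  show "\<exists>N. \<forall>i j. (if i < d \<and> j < d then M $$ (i, j) else 0) \<noteq> 0 \<longrightarrow> i < N \<and> j < N"
    by (rule exI[of _ d]) auto
qed

definition mt :: "nat \<Rightarrow> fmat \<Rightarrow> complex mat" where "mt d X = mat d d (\<lambda>(i, j). ent X i j)"

lemma ent_fm [simp]: "ent (fm d M) i j = (if i < d \<and> j < d then M $$ (i, j) else 0)"
  by (simp add: fm.rep_eq)

lemma fm_gl [simp]: "fm d M \<in> gl d"
  by (auto simp: gl_def split: if_splits)

lemma mt_carrier [simp]: "mt d X \<in> carrier_mat d d"
  by (simp add: mt_def)

lemma fm_mt [simp]: "X \<in> gl d \<Longrightarrow> fm d (mt d X) = X"
proof (rule fmat_eqI)
  fix i j assume X: "X \<in> gl d"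
  show "ent (fm d (mt d X)) i j = ent X i j"
  proof (cases "i < d \<and> j < d")
    case False
    then have "ent X i j = 0" using gl_ent[OF X, of i j] by linarith
    then show ?thesis using False by auto
  qed (simp add: mt_def)
qed

lemma mt_fm [simp]: "M \<in> carrier_mat d d \<Longrightarrow> mt d (fm d M) = M"
  by (rule eq_matI) (auto simp: mt_def)

lemma fm_inj: "M \<in> carrier_mat d d \<Longrightarrow> N \<in> carrier_mat d d \<Longrightarrow> fm d M = fm d N \<Longrightarrow> M = N"
  by (metis mt_fm)

lemma fm_unary:
  assumes "M \<in> carrier_mat d d"
  shows "fm d (c \<cdot>\<^sub>m M) = cs c (fm d M)" "fm d (transpose_mat M) = tp (fm d M)"
    "fm d (- M) = - fm d M" "fm d (cadj M) = adj (fm d M)"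
  using assms by (auto intro!: fmat_eqI simp: cadj_def)

lemma fm_binary:
  assumes "M \<in> carrier_mat d d" "N \<in> carrier_mat d d"
  shows "fm d (M + N) = fm d M + fm d N" "fm d (M - N) = fm d M - fm d N"
  using assms by (auto intro!: fmat_eqI)

lemmas fm_simps = fm_unary fm_binary

lemma fm_mult:
  assumes "M \<in> carrier_mat d d" "N \<in> carrier_mat d d"
  shows "fm d (M * N) = fm d M * fm d N"
proof (rule fmat_eqI)
  fix i j
  show "ent (fm d (M * N)) i j = ent (fm d M * fm d N) i j"
  proof (cases "i < d \<and> j < d")
    case True
    then have "ent (fm d (M * N)) i j = (\<Sum>k<d. M $$ (i, k) * N $$ (k, j))"
      using assms by (simp add: scalar_prod_def atLeast0LessThan)
    then show ?thesis using True by (simp add: ent_mult[of _ d])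
  next
    case False
    have "fm d M * fm d N \<in> gl d" by simp
    then have "ent (fm d M * fm d N) i j = 0" using False gl_ent[of "fm d M * fm d N" d i j] by linarith
    then show ?thesis using False by auto
  qed
qed

lemma fm_mcomm:
  "M \<in> carrier_mat d d \<Longrightarrow> N \<in> carrier_mat d d \<Longrightarrow> fm d (mcomm M N) = comm (fm d M) (fm d N)"
  unfolding mcomm_def comm_def by (subst fm_binary(2)) (auto simp: fm_mult)

lemma fm_mtrace: "M \<in> carrier_mat d d \<Longrightarrow> tr (fm d M) = mtrace M"
  by (simp add: mtrace_def tr_gl[of _ d])

lemma fm_0 [simp]: "fm d (0\<^sub>m d d) = 0" and fm_1 [simp]: "fm d (1\<^sub>m d) = Idm d"
  by (auto intro!: fmat_eqI)

lemma su_alg_iff: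
  "M \<in> su_alg d \<longleftrightarrow> M \<in> carrier_mat d d \<and> adj (fm d M) = - fm d M \<and> tr (fm d M) = 0"
proof -
  have "cadj M = - M \<longleftrightarrow> adj (fm d M) = - fm d M" if M: "M \<in> carrier_mat d d"
  proof -
    have "cadj M \<in> carrier_mat d d" "- M \<in> carrier_mat d d" using M by (auto simp: cadj_def)
    then have "cadj M = - M \<longleftrightarrow> fm d (cadj M) = fm d (- M)" 
      using fm_inj[of "cadj M" d "- M"] by auto
    then show ?thesis using M by (simp add: fm_simps)
  qed
  then show ?thesis by (auto simp: su_alg_def fm_mtrace)
qed

lemma symp_J_carrier: "symp_J l \<in> carrier_mat (2 * l) (2 * l)"
  by (simp add: symp_J_def)

lemma sp_alg_iff:
  "M \<in> sp_alg l \<longleftrightarrow> M \<in> su_alg (2 * l) \<and>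
     tp (fm (2*l) M) * fm (2*l) (symp_J l) + fm (2*l) (symp_J l) * fm (2*l) M = 0"
proof -
  have "transpose_mat M * symp_J l + symp_J l * M = 0\<^sub>m (2*l) (2*l) \<longleftrightarrow>
     tp (fm (2*l) M) * fm (2*l) (symp_J l) + fm (2*l) (symp_J l) * fm (2*l) M = 0" if M: "M \<in> carrier_mat (2*l) (2*l)"
  proof -
    note J = symp_J_carrier[of l]
    have c: "transpose_mat M \<in> carrier_mat (2*l) (2*l)" "transpose_mat M * symp_J l \<in> carrier_mat (2*l) (2*l)"
      "symp_J l * M \<in> carrier_mat (2*l) (2*l)" "transpose_mat M * symp_J l + symp_J l * M \<in> carrier_mat (2*l) (2*l)"
      using M J by auto
    have "transpose_mat M * symp_J l + symp_J l * M = 0\<^sub>m (2*l) (2*l) \<longleftrightarrow>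
      fm (2*l) (transpose_mat M * symp_J l + symp_J l * M) = fm (2*l) (0\<^sub>m (2*l) (2*l))"
      using fm_inj[OF c(4)] by auto
    then show ?thesis
      using c M J by (simp add: fm_simps fm_mult)
  qed
  then show ?thesis by (auto simp: sp_alg_def su_alg_def)
qed

lemma sym2_irreducible_fm:
  assumes irr: "sym2_irreducible d \<phi>" and c: "\<And>x. \<phi> x \<in> carrier_mat d d"
  shows "sym_irr d (range (\<lambda>x. fm d (\<phi> x)))"
proof -
  have sym: "M \<in> sym2_space d \<longleftrightarrow> M \<in> carrier_mat d d \<and> fm d M \<in> sym_mats d" for M
  proof -
    have "transpose_mat M = M \<longleftrightarrow> tp (fm d M) = fm d M" if M: "M \<in> carrier_mat d d"
    proof -
      have "transpose_mat M \<in> carrier_mat d d" using M by simp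
      then show ?thesis using fm_inj[OF _ M] M by (metis fm_unary(2))
    qed
    then show ?thesis by (auto simp: sym2_space_def sym_mats_def)
  qed
  have zero: "0\<^sub>m d d \<in> sym2_space d" by (simp add: sym2_space_def)
  have "sym2_space d \<noteq> {0\<^sub>m d d}" using irr by (simp add: sym2_irreducible_def)
  then obtain M where M: "M \<in> sym2_space d" "M \<noteq> 0\<^sub>m d d" using zero by blast
  have "fm d M \<noteq> 0"
  proof
    assume "fm d M = 0"
    then have "fm d M = fm d (0\<^sub>m d d)" by simp
    then show False using fm_inj[of M d "0\<^sub>m d d"] M sym by auto
  qed
  then have "sym_mats d \<noteq> {0}" using M sym by auto
  moreover have "W = {0} \<or> W = sym_mats d"
    if W: "csubspace W" "W \<subseteq> sym_mats d" "\<forall>X\<in>range (\<lambda>x. fm d (\<phi> x)). \<forall>M\<in>W. act X M \<in> W" for W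
  proof -
    define W' where "W' = {M \<in> carrier_mat d d. fm d M \<in> W}"
    have WW: "W = fm d ` W'"
    proof
      show "W \<subseteq> fm d ` W'"
      proof
        fix N assume N: "N \<in> W"
        then have "N \<in> gl d" using W(2) by (auto simp: sym_mats_def)
        then show "N \<in> fm d ` W'" using N by (intro image_eqI[of _ _ "mt d N"]) (auto simp: W'_def)
      qed
    qed (auto simp: W'_def)
    have "csubspace_mat d W'"
      using W(1) by (auto simp: csubspace_mat_def csubspace_def W'_def fm_simps)
    moreover have "W' \<subseteq> sym2_space d" using W(2) by (auto simp: W'_def sym)
    moreover have "tensor_action (\<phi> x) N \<in> W'" if N: "N \<in> W'" for x N
    proof -
      have Nc: "N \<in> carrier_mat d d" using N by (simp add: W'_def)
      have cc: "\<phi> x * N \<in> carrier_mat d d" "N * transpose_mat (\<phi> x) \<in> carrier_mat d d" "transpose_mat (\<phi> x) \<in> carrier_mat d d"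
        using c Nc by (auto intro!: mult_carrier_mat[of _ d d])
      have "fm d (tensor_action (\<phi> x) N) = act (fm d (\<phi> x)) (fm d N)"
        unfolding tensor_action_def act_def using cc c Nc by (simp add: fm_simps fm_mult)
      moreover have "tensor_action (\<phi> x) N \<in> carrier_mat d d" using cc by (simp add: tensor_action_def)
      ultimately show ?thesis using W(3) N by (auto simp: W'_def)
    qed
    ultimately have "W' = {0\<^sub>m d d} \<or> W' = sym2_space d" using irr by (auto simp: sym2_irreducible_def)
    then show ?thesis
    proof
      assume "W' = {0\<^sub>m d d}"
      then show ?thesis using WW by simp
    next
      assume e: "W' = sym2_space d"
      have "N \<in> W" if N: "N \<in> sym_mats d" for N
      proof -
        have Ng: "N \<in> gl d" using N by (simp add: sym_mats_def)
        then have "mt d N \<in> W'" unfolding e sym using N by simp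
        then show ?thesis using Ng by (simp add: W'_def)
      qed
      then show ?thesis using W(2) by blast
    qed
  qed
  ultimately show ?thesis by (auto simp: sym_irr_def)
qed

text \<open>A trivial kernel makes the determinant nonzero; passing through \<open>mt\<close> gives
  access to determinants of carrier-based matrices.\<close>

lemma inj_inverse:
  assumes T: "T \<in> gl d" and inj: "\<And>x. x \<in> vecs d \<Longrightarrow> T * x = 0 \<Longrightarrow> x = 0"
  shows "\<exists>S\<in>gl d. S * T = Idm d \<and> T * S = Idm d"
proof -
  let ?T = "mt d T"
  have "\<nexists>v. v \<in> carrier_vec d \<and> v \<noteq> 0\<^sub>v d \<and> ?T *\<^sub>v v = 0\<^sub>v d"
  proof
    assume "\<exists>v. v \<in> carrier_vec d \<and> v \<noteq> 0\<^sub>v d \<and> ?T *\<^sub>v v = 0\<^sub>v d"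
    then obtain v where v: "v \<in> carrier_vec d" "v \<noteq> 0\<^sub>v d" "?T *\<^sub>v v = 0\<^sub>v d" by blast
    define x where "x = (\<Sum>k<d. cs (v $ k) (unit_mat k 0))"
    have x: "x \<in> vecs d" unfolding x_def by (intro vecs_sum) (simp add: vecs_unit_iff)
    have ex: "ent x k j = (if k < d \<and> j = 0 then v $ k else 0)" for k j
    proof -
      have "ent x k j = (\<Sum>i<d. if i = k then (if j = 0 then v $ k else 0) else 0)"
        unfolding x_def ent_sum by (intro sum.cong) auto
      then show ?thesis by simp
    qed
    have "T * x = 0"
    proof (rule fmat_eqI)
      fix i j
      have Tx: "T * x \<in> vecs d" using T x by simp
      show "ent (T * x) i j = ent 0 i j"
      proof (cases "i < d \<and> j = 0")
        case True
        have "ent (T * x) i j = (\<Sum>k<d. ent T i k * v $ k)"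
          using T True by (simp add: ent_mult[of _ d] ex)
        also have "\<dots> = (?T *\<^sub>v v) $ i" using True v(1) by (simp add: mt_def scalar_prod_def atLeast0LessThan)
        finally show ?thesis using v(3) True by simp
      next
        case False
        then show ?thesis using Tx by (auto simp: vecs_def)
      qed
    qed
    then have "x = 0" using inj x by blast
    then have "v $ k = 0" if "k < d" for k using ex[of k 0] that by simp
    then have "v = 0\<^sub>v d" using v(1) by (intro eq_vecI) auto
    then show False using v by simp
  qed
  then have "Determinant.det ?T \<noteq> 0" using det_0_iff_vec_prod_zero_field[of ?T d] by auto
  then obtain S where S: "S \<in> carrier_mat d d" "S * ?T = 1\<^sub>m d" "?T * S = 1\<^sub>m d"
    using det_non_zero_imp_unit[of ?T d] unfolding Units_def ring_mat_def by auto
  have "fm d S * fm d ?T = fm d (1\<^sub>m d)" "fm d ?T * fm d S = fm d (1\<^sub>m d)"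
    using S by (simp_all only: fm_mult[OF S(1) mt_carrier, symmetric] fm_mult[OF mt_carrier S(1), symmetric])
  then show ?thesis using T by (intro bexI[of _ "fm d S"]) auto
qed

text \<open>\<open>T * M * tp T\<close> is the symmetric square of the intertwiner applied to
  \<open>M\<close>, so invariant subspaces can be pulled back along it.\<close>

lemma sym_irr_conj:
  assumes irr: "sym_irr d (range \<phi>)" and T: "T \<in> gl d" "S \<in> gl d" "S * T = Idm d" "T * S = Idm d"
    and gl: "\<And>x. \<phi> x \<in> gl d" "\<And>x. \<beta> x \<in> gl d" and int: "\<And>x. T * \<phi> x = \<beta> x * T"
  shows "sym_irr d (range \<beta>)"
  unfolding sym_irr_def
proof (intro conjI allI impI)
  show "sym_mats d \<noteq> {0}" using irr by (simp add: sym_irr_def)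
  fix W assume W: "csubspace W \<and> W \<subseteq> sym_mats d \<and> (\<forall>X\<in>range \<beta>. \<forall>M\<in>W. act X M \<in> W)"
  define W' where "W' = {M \<in> sym_mats d. T * M * tp T \<in> W}"
  have pull: "T * (S * N * tp S) * tp T = N" if "N \<in> gl d" for N
  proof -
    have "T * (S * N * tp S) * tp T = (T * S) * N * tp (T * S)" by (simp add: mult.assoc)
    then show ?thesis using that T by (simp del: tp_mult)
  qed
  have sy: "S * N * tp S \<in> sym_mats d" if "N \<in> sym_mats d" for N
    using that T by (auto simp: sym_mats_def mult.assoc)
  have in_W': "S * N * tp S \<in> W'" if N: "N \<in> W" for N
  proof -
    have "N \<in> sym_mats d" using N W by blast
    then show ?thesis using sy pull N by (simp add: W'_def sym_mats_def)
  qed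
  have "csubspace W'"
    using W csubspace_sym_mats[of d] by (auto simp: csubspace_def W'_def distrib_left distrib_right)
  moreover have "act (\<phi> x) M \<in> W'" if M: "M \<in> W'" for x M
  proof -
    have "T * act (\<phi> x) M * tp T = T * \<phi> x * M * tp T + T * M * tp (T * \<phi> x)"
      by (simp add: act_def algebra_simps)
    also have "\<dots> = act (\<beta> x) (T * M * tp T)"
      unfolding int by (simp add: act_def mult.assoc)
    finally have "T * act (\<phi> x) M * tp T = act (\<beta> x) (T * M * tp T)" .
    moreover have "act (\<phi> x) M \<in> sym_mats d"
      using M gl(1)[of x] by (auto simp: W'_def sym_mats_def act_def add.commute)
    ultimately show ?thesis using M W by (simp add: W'_def)
  qed
  moreover have "W' \<subseteq> sym_mats d" by (auto simp: W'_def)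
  ultimately have "W' = {0} \<or> W' = sym_mats d" using irr by (auto simp: sym_irr_def)
  then show "W = {0} \<or> W = sym_mats d"
  proof
    assume z: "W' = {0}"
    have "N = 0" if N: "N \<in> W" for N
    proof -
      have "N \<in> gl d" using N W by (auto simp: sym_mats_def)
      then show ?thesis using pull[of N] in_W'[OF N] z by simp
    qed
    then show ?thesis using W by (auto simp: csubspace_def)
  next
    assume e: "W' = sym_mats d"
    have "N \<in> W" if N: "N \<in> sym_mats d" for N
    proof -
      have "S * N * tp S \<in> W'" using sy[OF N] e by simp
      then show ?thesis using pull[of N] N by (simp add: W'_def sym_mats_def)
    qed
    then show ?thesis using W by blast
  qed
qed

context compact_lie
begin

text \<open>\<open>\<beta>\<close>, read as carrier-based matrices, is itself the isomorphism onto
  \<open>L\<close>; what remains elsewhere is to conjugate \<phi> until its image is exactly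
  \<open>L\<close>.\<close>

lemma equiv_to_standardI:
  assumes rep: "frep d \<beta>" and inj: "inj \<beta>" and c: "\<And>x. \<phi> x \<in> carrier_mat d d"
    and P: "P \<in> gl d" "P' \<in> gl d" "P * P' = Idm d" "P' * P = Idm d"
    and int: "\<And>x. fm d (\<phi> x) * P = P * \<beta> x"
    and L: "L \<subseteq> carrier_mat d d" "\<And>M. M \<in> carrier_mat d d \<Longrightarrow> M \<in> L \<longleftrightarrow> fm d M \<in> range \<beta>"
  shows "equiv_to_standard br d \<phi> L"
proof -
  note \<beta> = frepD[OF rep]
  define \<psi> where "\<psi> x = mt d (\<beta> x)" for x
  have \<psi>c: "\<psi> x \<in> carrier_mat d d" for x by (simp add: \<psi>_def)
  have fm\<psi>: "fm d (\<psi> x) = \<beta> x" for x by (simp add: \<psi>_def \<beta>)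
  have "inj \<psi>" using inj fm\<psi> by (metis injD injI)
  moreover have "range \<psi> = L"
  proof
    show "range \<psi> \<subseteq> L" using L(2)[OF \<psi>c] fm\<psi> by auto
    show "L \<subseteq> range \<psi>"
    proof
      fix M assume M: "M \<in> L"
      then obtain x where "fm d M = \<beta> x" using L by blast
      then have "M = \<psi> x" using fm_inj[of M d "\<psi> x"] M L(1) \<psi>c fm\<psi> by auto
      then show "M \<in> range \<psi>" by blast
    qed
  qed
  ultimately have "bij_betw \<psi> UNIV L" by (simp add: bij_betw_def)
  moreover have "\<psi> (x + y) = \<psi> x + \<psi> y" for x y
    by (rule fm_inj[of _ d]) (auto simp: \<psi>c fm_unary[OF \<psi>c] fm_binary[OF \<psi>c \<psi>c] fm\<psi> \<beta>)
  moreover have "\<psi> (r *\<^sub>R x) = complex_of_real r \<cdot>\<^sub>m \<psi> x" for r x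
    by (rule fm_inj[of _ d]) (auto simp: \<psi>c fm_unary[OF \<psi>c] fm_binary[OF \<psi>c \<psi>c] fm\<psi> \<beta>)
  moreover have "\<psi> (br x y) = mcomm (\<psi> x) (\<psi> y)" for x y
  proof (rule fm_inj[of _ d])
    have "\<psi> x * \<psi> y \<in> carrier_mat d d" for x y using \<psi>c by (metis mult_carrier_mat)
    then show "mcomm (\<psi> x) (\<psi> y) \<in> carrier_mat d d" unfolding mcomm_def by (metis minus_carrier_mat)
  qed (simp_all add: \<psi>c fm_mcomm[OF \<psi>c \<psi>c] fm\<psi> \<beta>)
  ultimately have iso: "lie_iso_onto br \<psi> L" by (simp add: lie_iso_onto_def)
  have m: "mt d X * mt d Y = 1\<^sub>m d" if "X \<in> gl d" "Y \<in> gl d" "X * Y = Idm d" for X Y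
  proof (rule fm_inj[of _ d])
    show "mt d X * mt d Y \<in> carrier_mat d d" by (rule mult_carrier_mat[of _ d d]) simp_all
  qed (use that in \<open>simp_all add: fm_mult\<close>)
  have "invertible_mat (mt d P)"
    unfolding invertible_mat_def inverts_mat_def using m[OF P(1,2,3)] m[OF P(2,1,4)]
    by (auto simp: mt_def square_mat.simps intro!: exI[of _ "mt d P'"])
  moreover have "\<phi> x * mt d P = mt d P * \<psi> x" for x
  proof (rule fm_inj[of _ d])
    show "\<phi> x * mt d P \<in> carrier_mat d d" "mt d P * \<psi> x \<in> carrier_mat d d"
      using c \<psi>c by (auto intro!: mult_carrier_mat[of _ d d])
    show "fm d (\<phi> x * mt d P) = fm d (mt d P * \<psi> x)"
      using c \<psi>c P int by (simp add: fm_mult fm\<psi>)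
  qed
  ultimately show ?thesis unfolding equiv_to_standard_def using iso mt_carrier by blast
qed

lemma frep_conj:
  assumes rep: "frep d \<beta>" and U: "U \<in> gl d" "U' \<in> gl d" "U * U' = Idm d"
  shows "frep d (\<lambda>x. U' * \<beta> x * U)"
proof -
  note \<beta> = frepD[OF rep]
  have "U' * \<beta> x * U * (U' * \<beta> y * U) = U' * (\<beta> x * \<beta> y) * U" for x y
  proof -
    have "U' * \<beta> x * U * (U' * \<beta> y * U) = U' * \<beta> x * (U * U') * \<beta> y * U" by (simp add: mult.assoc)
    then show ?thesis using U \<beta>(1) by (simp add: mult.assoc)
  qed
  then show ?thesis using U by (simp add: frep_def \<beta> comm_def algebra_simps)
qed

text \<open>\<open>onb_alg\<close> asks for orthonormal matrices, so a basis for the trace form of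
  the representation replaces the Killing basis. Products of skew-Hermitian matrices are real; hence
  a skew-Hermitian element of the complex span has real coefficients and lies in the image.\<close>

lemma trace_form_onb_alg:
  assumes rep: "frep d \<beta>" and inj: "inj \<beta>" and skew: "\<And>x. adj (\<beta> x) = - \<beta> x"
    and irr: "sym_irr d (range \<beta>)"
  shows "\<exists>I. onb_alg d I \<beta> \<and> (\<forall>x. \<beta> x = (\<Sum>k\<in>I. cs (ip (\<beta> k) (\<beta> x)) (\<beta> k))) \<and>
    (\<forall>X. adj X = - X \<and> X = (\<Sum>k\<in>I. cs (ip (\<beta> k) X) (\<beta> k)) \<longrightarrow> X \<in> range \<beta>)"
proof -
  note \<beta> = frepD[OF rep]
  define q where "q x y = Re (ip (\<beta> x) (\<beta> y))" for x y
  have ipq: "ip X Y = of_real (Re (ip X Y))" if "adj X = - X" "adj Y = - Y" for X Y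
    using ip_skew_real[OF that] by (simp add: complex_eq_iff)
  have lin: "linear (\<lambda>x. q x y)" for y by (rule linearI) (simp_all add: q_def \<beta>)
  have qsym: "q x y = q y x" for x y
    unfolding q_def using ip_cnj[of "\<beta> x" "\<beta> y"] by (metis cnj.simps(1))
  have qpos: "q x x > 0" if "x \<noteq> 0" for x
  proof -
    have "\<beta> x \<noteq> 0" using inj \<beta>(5) that by (metis injD)
    then show ?thesis using nsq_nonneg[of "\<beta> x"] nsq_eq_0_iff[of "\<beta> x"] unfolding q_def nsq_def by linarith
  qed
  have "\<exists>I. finite I \<and> (\<forall>b\<in>I. \<forall>c\<in>I. q b c = (if b = c then 1 else 0)) \<and> (\<forall>x. x = (\<Sum>b\<in>I. q x b *\<^sub>R b))"
    by (rule form_onb) (fact lin qsym qpos)+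
  then obtain I where I0: "finite I \<and> (\<forall>b\<in>I. \<forall>c\<in>I. q b c = (if b = c then 1 else 0)) \<and> (\<forall>x. x = (\<Sum>b\<in>I. q x b *\<^sub>R b))"
    by (elim exE)
  note I = I0[THEN conjunct1] I0[THEN conjunct2, THEN conjunct1, rule_format]
    I0[THEN conjunct2, THEN conjunct2, rule_format]
  have e: "\<beta> x = (\<Sum>k\<in>I. cs (ip (\<beta> k) (\<beta> x)) (\<beta> k))" for x
  proof -
    have "\<beta> x = \<beta> (\<Sum>b\<in>I. q x b *\<^sub>R b)" by (rule arg_cong[OF I(3)])
    also have "\<dots> = (\<Sum>k\<in>I. cs (of_real (q x k)) (\<beta> k))" by (simp add: \<beta>)
    also have "\<dots> = (\<Sum>k\<in>I. cs (ip (\<beta> k) (\<beta> x)) (\<beta> k))"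
      
    proof (intro sum.cong refl)
      fix k
      have "complex_of_real (q x k) = of_real (q k x)" by (simp only: qsym[of x k])
      then show "cs (of_real (q x k)) (\<beta> k) = cs (ip (\<beta> k) (\<beta> x)) (\<beta> k)"
        using ipq[OF skew skew, of k x] by (simp add: q_def)
    qed
    finally show ?thesis .
  qed
  have "onb_alg d I \<beta>"
  proof
    show "finite I" by (rule I)
    show "I \<noteq> {}"
    proof
      assume "I = {}"
      then have "x = 0" for x :: 'a using I(3)[of x] by simp
      then show False using nonempty_Basis nonzero_Basis by (metis ex_in_conv)
    qed
    show "\<beta> i \<in> gl d" for i by (rule \<beta>)
    show "adj (\<beta> i) = - \<beta> i" for i by (rule skew)
    show "ip (\<beta> i) (\<beta> j) = (if i = j then 1 else 0)" if "i \<in> I" "j \<in> I" for i j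
      using ipq[OF skew skew, of i j] I(2)[OF that] by (simp add: q_def)
    \<comment> \<open>The Casimir identity writes \<open>- x\<close> as a sum of brackets, whose
      images are traceless.\<close>
    show "tr (\<beta> x) = 0" for x
    proof -
      have "\<beta> (- x) = (\<Sum>b\<in>B. comm (\<beta> b) (\<beta> (br b x)))"
        unfolding casimir[symmetric] by (simp add: \<beta>(7)) (simp add: \<beta>(4))
      then have "tr (\<beta> (- x)) = 0" by (simp add: tr_sum)
      then show ?thesis by (simp add: \<beta>(6))
    qed
    show "comm (\<beta> i) (\<beta> j) = (\<Sum>k\<in>I. cs (ip (\<beta> k) (comm (\<beta> i) (\<beta> j))) (\<beta> k))" for i j
      using e[of "br i j"] by (simp only: \<beta>(4))
    show "sym_irr d (\<beta> ` I)"
      unfolding sym_irr_def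
    proof (intro conjI allI impI)
      show "sym_mats d \<noteq> {0}" using irr by (simp add: sym_irr_def)
      fix W assume W: "csubspace W \<and> W \<subseteq> sym_mats d \<and> (\<forall>X\<in>\<beta> ` I. \<forall>M\<in>W. act X M \<in> W)"
      have sumW: "sum f S \<in> W" if "\<And>s. s \<in> S \<Longrightarrow> f s \<in> W" for f and S :: "'a set"
        using that W by (induction S rule: infinite_finite_induct) (auto simp: csubspace_def)
      have "act (\<beta> x) M \<in> W" if M: "M \<in> W" for x M
      proof -
        have "act (\<beta> x) M = (\<Sum>k\<in>I. cs (ip (\<beta> k) (\<beta> x)) (act (\<beta> k) M))"
          by (subst e[of x]) (simp add: act_def sum_distrib_right sum_distrib_left tp_sum sum.distrib)
        also have "\<dots> \<in> W" using W M by (intro sumW) (auto simp: csubspace_def)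
        finally show ?thesis .
      qed
      then show "W = {0} \<or> W = sym_mats d" using irr W by (auto simp: sym_irr_def)
    qed
  qed
  moreover have "X \<in> range \<beta>" if X: "adj X = - X" "X = (\<Sum>k\<in>I. cs (ip (\<beta> k) X) (\<beta> k))" for X
  proof -
    have "X = (\<Sum>k\<in>I. cs (ip (\<beta> k) X) (\<beta> k))" by (rule X(2))
    also have "\<dots> = (\<Sum>k\<in>I. cs (of_real (Re (ip (\<beta> k) X))) (\<beta> k))"
      by (simp only: ipq[OF skew X(1), symmetric])
    also have "\<dots> = \<beta> (\<Sum>k\<in>I. Re (ip (\<beta> k) X) *\<^sub>R k)" by (simp add: \<beta>)
    finally show ?thesis by blast
  qed
  ultimately show ?thesis using e by blast
qed

end

lemma onb_unitary:
  assumes w: "onb d d w"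
  defines "U \<equiv> (\<Sum>i<d. w i * adj (unit_mat i 0))"
  shows "U \<in> gl d" "adj U * U = Idm d" "U * adj U = Idm d" "\<And>i. i < d \<Longrightarrow> U * unit_mat i 0 = w i"
proof -
  define e where "e i = unit_mat i 0" for i
  have e: "e i \<in> vecs d" if "i < d" for i using that by (simp add: e_def vecs_unit_iff)
  have ee: "ip (e i) (e j) = (if i = j then 1 else 0)" for i j by (simp add: e_def ip_unit_vec)
  have onbe: "onb d d e" by (simp add: onb_def e ee)
  have wv: "w i \<in> vecs d" if "i < d" for i using w that by (simp add: onb_def)
  have ww: "ip (w i) (w j) = (if i = j then 1 else 0)" if "i < d" "j < d" for i j using w that by (simp add: onb_def)
  have U: "U = (\<Sum>i<d. w i * adj (e i))" by (simp add: U_def e_def)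
  show Ug: "U \<in> gl d" unfolding U by (intro gl_sum) (auto simp: wv e vecs_gl)
  show Ue: "U * unit_mat i 0 = w i" if i: "i < d" for i
  proof -
    have "U * e i = (\<Sum>k<d. if k = i then w i else 0)"
      unfolding U sum_distrib_right using i
      by (intro sum.cong refl) (auto simp: outer_app[of _ d] e wv ee)
    then show ?thesis using i by (simp add: e_def)
  qed
  have "U * adj U = (\<Sum>i<d. U * e i * adj (w i))"
    by (subst (2) U) (simp add: adj_sum sum_distrib_left mult.assoc)
  also have "\<dots> = (\<Sum>i<d. w i * adj (w i))" using Ue by (intro sum.cong refl) (simp add: e_def)
  finally show "U * adj U = Idm d" by (simp add: onb_complete[OF w])
  have "adj U * U = (\<Sum>i<d. adj U * w i * adj (e i))"
    by (subst (2) U) (simp add: sum_distrib_left mult.assoc)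
  also have "\<dots> = (\<Sum>i<d. e i * adj (e i))"
  proof (intro sum.cong refl)
    fix i assume "i \<in> {..<d}"
    then have i: "i < d" by simp
    have "adj U * w i = (\<Sum>k<d. if k = i then e i else 0)"
      unfolding U adj_sum sum_distrib_right using i
      by (intro sum.cong refl) (auto simp: outer_app[of _ d] e wv ww)
    then show "adj U * w i * adj (e i) = e i * adj (e i)" using i by simp
  qed
  finally show "adj U * U = Idm d" by (simp add: onb_complete[OF onbe])
qed

lemma fm_symp_J:
  "fm (2*l) (symp_J l) = (\<Sum>i<l. unit_mat i 0 * tp (unit_mat (i + l) 0) - unit_mat (i + l) 0 * tp (unit_mat i 0))"
proof (rule fmat_eqI)
  fix a b
  have u: "ent (unit_mat i 0 * tp (unit_mat j 0)) a b = (if a = i \<and> b = j then 1 else 0)" for i j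
  proof -
    have "unit_mat i 0 \<in> gl (Suc (i + j))" by (auto simp: gl_def)
    then have "ent (unit_mat i 0 * tp (unit_mat j 0)) a b
       = (\<Sum>k<Suc (i + j). if k = 0 then (if a = i \<and> b = j then 1 else 0) else 0)"
      unfolding ent_mult[OF disjI1[OF \<open>unit_mat i 0 \<in> gl (Suc (i + j))\<close>]] by (intro sum.cong) auto
    then show ?thesis by (simp del: sum.lessThan_Suc)
  qed
  have "ent (\<Sum>i<l. unit_mat i 0 * tp (unit_mat (i + l) 0) - unit_mat (i + l) 0 * tp (unit_mat i 0)) a b
    = (\<Sum>i<l. if i = a then (if b = a + l then 1 else 0) else 0) - (\<Sum>i<l. if i = b then (if a = b + l then 1 else 0) else 0)"
    unfolding ent_sum ent_simps u sum_subtractf by (intro arg_cong2[of _ _ _ _ "(-)"] sum.cong refl) auto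
  also have "\<dots> = ent (fm (2*l) (symp_J l)) a b" by (auto simp: symp_J_def)
  finally show "ent (fm (2*l) (symp_J l)) a b
    = ent (\<Sum>i<l. unit_mat i 0 * tp (unit_mat (i + l) 0) - unit_mat (i + l) 0 * tp (unit_mat i 0)) a b" ..
qed

lemma symp_J_square: "fm (2*l) (symp_J l) * fm (2*l) (symp_J l) = - Idm (2*l)"
proof (rule fmat_eqI)
  fix a b
  let ?J = "fm (2*l) (symp_J l)"
  have "ent (?J * ?J) a b = (\<Sum>k<2*l. ent ?J a k * ent ?J k b)" by (simp add: ent_mult[of _ "2*l"])
  \<comment> \<open>Each row of \<open>J\<close> has a single nonzero entry, in the column paired
    with \<open>a\<close>.\<close>
  also have "\<dots> = (\<Sum>k<2*l. if k = (if a < l then a + l else a - l) then (if a < 2*l \<and> b = a then -1 else 0) else 0)"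
    by (intro sum.cong refl) (auto simp: symp_J_def)
  also have "\<dots> = ent (- Idm (2*l)) a b" by auto
  finally show "ent (?J * ?J) a b = ent (- Idm (2*l)) a b" .
qed

context paired_alg
begin

text \<open>\<open>S\<close> takes one index from each pair and supplies the first half of the new
  basis, the partners supply the second. The phases \<open>co\<close> are absorbed into the second
  half: their modulus 1 keeps it orthonormal, and \<open>co (p i) = - co i\<close> produces the
  signs of \<open>symp_J\<close>.\<close>

lemma symplectic_basis:
  obtains l U where "d = 2 * l" "1 \<le> l" "U \<in> gl d" "adj U * U = Idm d" "U * adj U = Idm d"
    "Omega = U * fm (2*l) (symp_J l) * tp U"
proof -
  define S where "S = {i. i < d \<and> i < p i}"
  define l where "l = card S"
  have fS: "finite S" by (simp add: S_def)
  obtain r where r: "bij_betw r {..<l} S"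
    using ex_bij_betw_nat_finite[OF fS] by (auto simp: l_def atLeast0LessThan)
  have rS: "r i \<in> S" if "i < l" for i using r that by (auto simp: bij_betw_def)
  have rd: "r i < d" if "i < l" for i using rS[OF that] by (simp add: S_def)
  have injr: "r i = r j \<longleftrightarrow> i = j" if "i < l" "j < l" for i j
    using r that by (auto simp: bij_betw_def inj_on_def)
  have pS: "{..<d} = S \<union> p ` S" "S \<inter> p ` S = {}"
  proof -
    have "i \<in> S \<union> p ` S" if i: "i < d" for i
    proof (cases "i < p i")
      case False
      then have "p i < i" using p(2)[OF i] by simp
      then have "p i \<in> S" using p[OF i] by (simp add: S_def)
      then show ?thesis using p(3)[OF i] by force
    qed (use i in \<open>simp add: S_def\<close>)
    then show "{..<d} = S \<union> p ` S" using p by (auto simp: S_def)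
    show "S \<inter> p ` S = {}" using p by (force simp: S_def)
  qed
  have injp: "inj_on p S" using p by (metis (no_types, lifting) S_def inj_onI mem_Collect_eq)
  have "card {..<d} = card S + card (p ` S)"
    unfolding pS(1) using fS pS(2) by (intro card_Un_disjoint) auto
  then have dl: "d = 2 * l" using injp by (simp add: card_image l_def)
  then have l1: "1 \<le> l" using d_pos by simp
  have pr_ne: "p (r i) \<noteq> r j" if "i < l" "j < l" for i j
    using pS(2) rS[OF that(1)] rS[OF that(2)] by (metis IntI empty_iff imageI)
  define w where "w i = (if i < l then v (r i) else cs (co (r (i - l))) (v (p (r (i - l)))))" for i
  have w: "onb d d w"
    unfolding onb_def
  proof (intro conjI allI impI)
    fix i assume i: "i < d"
    have il: "\<not> i < l \<Longrightarrow> i - l < l" using i dl by simp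
    show "w i \<in> vecs d"
    proof (cases "i < l")
      case False
      then show ?thesis using v[OF p(1)[OF rd[OF il]]] by (simp add: w_def)
    qed (simp add: w_def rd)
    fix j assume j: "j < d"
    have eqp: "p a = p b \<longleftrightarrow> a = b" if "a < d" "b < d" for a b using p(3) that by metis
    consider "i < l" "j < l" | "i < l" "\<not> j < l" | "\<not> i < l" "j < l" | "\<not> i < l" "\<not> j < l" by blast
    then show "ip (w i) (w j) = (if i = j then 1 else 0)"
    proof cases
      case 1 then show ?thesis by (simp add: w_def ip_v rd injr)
    next
      case 2
      then have "j - l < l" using j dl by simp
      then show ?thesis using 2 pr_ne[of "j - l" i] by (auto simp: w_def ip_v rd p(1))
    next
      case 3
      then have "i - l < l" using i dl by simp
      then show ?thesis using 3 pr_ne[of "i - l" j] by (auto simp: w_def ip_v rd p(1))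
    next
      case 4
      then have "i - l < l" "j - l < l" using i j dl by auto
      moreover have "i = j \<longleftrightarrow> i - l = j - l" using 4 by auto
      ultimately show ?thesis using 4 co_unit[OF rd[of "i - l"]] eqp[OF rd rd, of "i - l" "j - l"]
        by (auto simp: w_def ip_v rd p(1) injr mult.commute)
    qed
  qed
  define U where "U = (\<Sum>i<d. w i * adj (unit_mat i 0))"
  note U = onb_unitary[OF w, folded U_def]
  have "U * fm (2*l) (symp_J l) * tp U
     = (\<Sum>i<l. (U * unit_mat i 0) * tp (U * unit_mat (i + l) 0) - (U * unit_mat (i + l) 0) * tp (U * unit_mat i 0))"
    unfolding fm_symp_J sum_distrib_left sum_distrib_right
    by (simp add: left_diff_distrib right_diff_distrib mult.assoc)
  also have "\<dots> = (\<Sum>i<l. w i * tp (w (i + l)) - w (i + l) * tp (w i))"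
    by (intro sum.cong refl) (simp add: U(4) dl del: tp_mult)
  also have "\<dots> = (\<Sum>i<l. cs (co (r i)) (v (r i) * tp (v (p (r i)))) + cs (co (p (r i))) (v (p (r i)) * tp (v (p (p (r i))))))"
    by (intro sum.cong refl) (simp add: w_def co_p rd p(3))
  also have "\<dots> = (\<Sum>i\<in>S. cs (co i) (v i * tp (v (p i))) + cs (co (p i)) (v (p i) * tp (v (p (p i)))))"
    by (rule sum.reindex_bij_betw[OF r])
  also have "\<dots> = (\<Sum>i\<in>S. cs (co i) (v i * tp (v (p i)))) + (\<Sum>i\<in>p ` S. cs (co i) (v i * tp (v (p i))))"
    by (simp add: sum.distrib sum.reindex[OF injp])
  also have "\<dots> = Omega"
    unfolding Omega_expand pS(1) using fS pS(2) by (intro sum.union_disjoint[symmetric]) auto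
  finally show ?thesis using that[OF dl l1 U(1-3)] by simp
qed

end

theorem theorem3:
  fixes br :: "'a::euclidean_space \<Rightarrow> 'a \<Rightarrow> 'a"
    and d :: nat
    and \<phi> :: "'a \<Rightarrow> complex mat"
  assumes "compact_semisimple br"
    and "lie_rep br d \<phi>"
    and "inj \<phi>"
    and "sym2_irreducible d \<phi>"
  shows "\<exists>l\<ge>1.
           (d = 2 * l \<and> equiv_to_standard br d \<phi> (sp_alg l))
         \<or> (d = l + 1 \<and> equiv_to_standard br d \<phi> (su_alg (l + 1)))"
proof -
  obtain Q B where "compact_lie br Q B" using ex_compact_lie[OF assms(1)] by blast
  then interpret compact_lie br Q B .
  have c: "\<phi> x \<in> carrier_mat d d" for x using assms(2) by (simp add: lie_rep_def)
  define f where "f x = fm d (\<phi> x)" for x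
  have f: "frep d f"
    using assms(2) unfolding frep_def f_def lie_rep_def by (auto simp: fm_simps fm_mcomm)
  have injf: "inj f" unfolding f_def using assms(3) fm_inj[OF c c] by (metis injD injI)
  have irr: "sym_irr d (range f)" unfolding f_def by (rule sym2_irreducible_fm[OF assms(4) c])
  have d0: "0 < d"
  proof (rule ccontr)
    assume "\<not> 0 < d"
    then have "sym_mats d = {0}" by (auto simp: sym_mats_def gl_def intro!: fmat_eqI)
    then show False using irr by (simp add: sym_irr_def)
  qed
  obtain \<beta> T where \<beta>: "frep d \<beta>" "\<And>x. adj (\<beta> x) = - \<beta> x" and T: "T \<in> gl d" "T \<noteq> 0" "\<And>x. T * f x = \<beta> x * T"
    using ex_unitary_limit[OF f d0] by blast
  \<comment> \<open>The kernel of \<open>T\<close> is invariant and V is irreducible, so a nonzero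
    intertwiner is injective.\<close>
  have "x = 0" if x: "x \<in> vecs d" "T * x = 0" for x
  proof (rule ccontr)
    assume "x \<noteq> 0"
    define W where "W = {x \<in> vecs d. T * x = 0}"
    have "W = vecs d"
    proof (rule sym_irr_vecs[OF irr])
      show "range f \<subseteq> gl d" using frepD(1)[OF f] by blast
      show "csubspace W" by (auto simp: W_def csubspace_def distrib_left)
      show "W \<subseteq> vecs d" by (auto simp: W_def)
      show "W \<noteq> {0}" using x \<open>x \<noteq> 0\<close> by (auto simp: W_def)
      show "X * y \<in> W" if "X \<in> range f" "y \<in> W" for X y
      proof -
        obtain z where z: "X = f z" using \<open>X \<in> range f\<close> by blast
        have "T * (f z * y) = \<beta> z * (T * y)" using T(3)[of z] by (simp flip: mult.assoc)
        then show ?thesis using \<open>y \<in> W\<close> z frepD(1)[OF f] by (simp add: W_def)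
      qed
    qed
    then have "T * y = 0" if "y \<in> vecs d" for y using that unfolding W_def by blast
    then have "T = 0" using T(1) by (intro gl_eqI[of T d 0]) simp_all
    then show False using T(2) by simp
  qed
  then obtain S where S: "S \<in> gl d" "S * T = Idm d" "T * S = Idm d" using inj_inverse[OF T(1)] by blast
  have fS: "f x * S = S * \<beta> x" for x
  proof -
    have "S * (T * f x) * S = S * (\<beta> x * T) * S" by (simp add: T(3))
    then have "(S * T) * f x * S = S * \<beta> x * (T * S)" by (simp add: mult.assoc)
    then show ?thesis using S frepD(1)[OF f] frepD(1)[OF \<beta>(1)] by simp
  qed
  have inj\<beta>: "inj \<beta>"
  proof (rule injI)
    fix x y assume "\<beta> x = \<beta> y"
    then have "f x * S = f y * S" by (simp add: fS)
    then have "f x * (S * T) = f y * (S * T)" by (simp flip: mult.assoc)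
    then show "x = y" using S frepD(1)[OF f] injf by (simp add: injD)
  qed
  have irr\<beta>: "sym_irr d (range \<beta>)"
    by (rule sym_irr_conj[OF irr T(1) S(1,2,3) frepD(1)[OF f] frepD(1)[OF \<beta>(1)] T(3)])
  obtain I where I: "onb_alg d I \<beta>" and span: "\<And>x. \<beta> x = (\<Sum>k\<in>I. cs (ip (\<beta> k) (\<beta> x)) (\<beta> k))"
    and real: "\<And>X. adj X = - X \<Longrightarrow> X = (\<Sum>k\<in>I. cs (ip (\<beta> k) X) (\<beta> k)) \<Longrightarrow> X \<in> range \<beta>"
    using trace_form_onb_alg[OF \<beta>(1) inj\<beta> \<beta>(2) irr\<beta>] by blast
  interpret a: onb_alg d I \<beta> by (rule I)
  obtain k where "star_alg d I \<beta> k" using a.ex_star_alg by blast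
  then interpret s: star_alg d I \<beta> k .
  obtain v where "s.torus d v" using s.ex_torus by blast
  then interpret t: torus_alg d I \<beta> k v by unfold_locales
  have pr\<beta>: "a.pr (\<beta> x) = \<beta> x" for x unfolding a.pr_def by (rule span[symmetric])
  have in_range: "X \<in> range \<beta>" if "adj X = - X" "a.pr X = X" for X
    using that real unfolding a.pr_def by metis
  have tr\<beta>: "tr (\<beta> x) = 0" for x using a.pr_simps(7)[of "\<beta> x"] by (simp add: pr\<beta>)
  from t.D_dichotomy show ?thesis
  proof (elim disjE exE)
    assume D1: "\<forall>i<d. \<forall>j<d. i \<noteq> j \<longrightarrow> t.D i j = 1"
    have "equiv_to_standard br d \<phi> (su_alg d)"
    proof (rule equiv_to_standardI[OF \<beta>(1) inj\<beta> c S(1) T(1) S(2,3)])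
      show "fm d (\<phi> x) * S = S * \<beta> x" for x using fS[of x] by (simp add: f_def)
      show "su_alg d \<subseteq> carrier_mat d d" by (auto simp: su_alg_def)
      show "M \<in> su_alg d \<longleftrightarrow> fm d M \<in> range \<beta>" if "M \<in> carrier_mat d d" for M
        using that \<beta>(2) tr\<beta> in_range t.pr_outer_sl[OF D1 fm_gl] by (auto simp: su_alg_iff)
    qed
    then show ?thesis using s.two_le_d by (intro exI[of _ "d - 1"]) auto
  next
    fix p assume p: "\<forall>i<d. p i < d \<and> p i \<noteq> i \<and> p (p i) = i \<and> t.D i (p i) = 1 \<and> (\<forall>j<d. j \<noteq> i \<and> j \<noteq> p i \<longrightarrow> t.D i j = 1 / 2)"
    interpret q: paired_alg d I \<beta> k v p by unfold_locales (use p in auto)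
    obtain l U where l: "d = 2 * l" "1 \<le> l" and U: "U \<in> gl d" "adj U * U = Idm d" "U * adj U = Idm d"
      and Om: "q.Omega = U * fm (2*l) (symp_J l) * tp U" by (rule q.symplectic_basis)
    define J where "J = fm d (symp_J l)"
    have J: "J \<in> gl d" "J * J = - Idm d" by (simp_all add: J_def l symp_J_square)
    \<comment> \<open>A further unitary change of basis carries \<open>Omega\<close> to
      \<open>symp_J\<close> and keeps skew-Hermitian matrices skew-Hermitian.\<close>
    define \<gamma> where "\<gamma> x = adj U * \<beta> x * U" for x
    have \<gamma>: "frep d \<gamma>" unfolding \<gamma>_def using frep_conj[OF \<beta>(1) U(1) _ U(3)] U(1) by simp
    have conj_inv: "adj U * (U * X * adj U) * U = X" "U * (adj U * X * U) * adj U = X" if "X \<in> gl d" for X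
    proof -
      have "adj U * (U * X * adj U) * U = (adj U * U) * X * (adj U * U)"
        "U * (adj U * X * U) * adj U = (U * adj U) * X * (U * adj U)" by (simp_all add: mult.assoc)
      then show "adj U * (U * X * adj U) * U = X" "U * (adj U * X * U) * adj U = X" using that U by simp_all
    qed
    have inj\<gamma>: "inj \<gamma>"
    proof (rule injI)
      fix x y assume "\<gamma> x = \<gamma> y"
      then have "U * (adj U * \<beta> x * U) * adj U = U * (adj U * \<beta> y * U) * adj U" by (simp add: \<gamma>_def)
      then have "\<beta> x = \<beta> y" by (simp only: conj_inv(2)[OF frepD(1)[OF \<beta>(1)]])
      then show "x = y" by (rule injD[OF inj\<beta>])
    qed
    have actJ: "act X J = 0 \<longleftrightarrow> act (U * X * adj U) q.Omega = 0" if X: "X \<in> gl d" for X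
    proof -
      have "act (U * X * adj U) q.Omega = U * X * (adj U * U) * J * tp U + U * J * tp (U * X * (adj U * U))"
        by (simp add: act_def Om J_def l mult.assoc)
      also have "\<dots> = U * act X J * tp U"
        using U X by (simp add: act_def mult.assoc distrib_left distrib_right)
      finally have e: "act (U * X * adj U) q.Omega = U * act X J * tp U" .
      have "act X J \<in> gl d" using X J by (simp add: act_def)
      then have "act X J = adj U * (U * act X J * tp U) * adj (tp U)"
      proof -
        assume g: "act X J \<in> gl d"
        have "tp U * adj (tp U) = tp (adj U * U)" by simp
        then have "tp U * adj (tp U) = Idm d" using U(2) by (simp del: tp_mult)
        moreover have "adj U * (U * act X J * tp U) * adj (tp U) = (adj U * U) * act X J * (tp U * adj (tp U))"
          by (simp add: mult.assoc)
        ultimately show ?thesis using U(2) g by simp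
      qed
      then show ?thesis using e by auto
    qed
    \<comment> \<open>\<open>act X J = 0\<close> says that \<open>X\<close> annihilates the bivector
      \<open>J\<close>, while \<open>sp_alg\<close> asks it to annihilate the bilinear form
      \<open>J\<close>. Since the square of \<open>J\<close> is -1, multiplying by \<open>J\<close>
      on both sides exchanges the two conditions.\<close>
    have dual: "act X J = 0 \<longleftrightarrow> tp X * J + J * X = 0" if X: "X \<in> gl d" for X
    proof -
      have "J * act X J * J = J * X * (J * J) + (J * J) * tp X * J" by (simp add: act_def algebra_simps)
      then have 1: "J * act X J * J = - (tp X * J + J * X)" using J X by (simp add: mult.assoc)
      have "J * (tp X * J + J * X) * J = J * tp X * (J * J) + (J * J) * X * J" by (simp add: algebra_simps)
      then have 2: "J * (tp X * J + J * X) * J = - act X J" using J X by (simp add: act_def mult.assoc)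
      show ?thesis
      proof
        assume "act X J = 0"
        then have "- (tp X * J + J * X) = 0" using 1 by (simp only: mult_zero_left mult_zero_right)
        then show "tp X * J + J * X = 0" by (simp only: neg_equal_0_iff_equal)
      next
        assume "tp X * J + J * X = 0"
        then show "act X J = 0" using 2 by simp
      qed
    qed
    have "equiv_to_standard br d \<phi> (sp_alg l)"
    proof (rule equiv_to_standardI[OF \<gamma> inj\<gamma> c])
      show "S * U \<in> gl d" "adj U * T \<in> gl d" using S U T by auto
      have "S * U * (adj U * T) = S * (U * adj U) * T" "adj U * T * (S * U) = adj U * (T * S) * U"
        by (simp_all add: mult.assoc)
      then show "S * U * (adj U * T) = Idm d" "adj U * T * (S * U) = Idm d" using S U T by simp_all
      show "fm d (\<phi> x) * (S * U) = S * U * \<gamma> x" for x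
      proof -
        have "fm d (\<phi> x) * (S * U) = S * \<beta> x * U" using fS[of x] by (simp add: f_def flip: mult.assoc)
        also have "\<dots> = S * ((U * adj U) * \<beta> x) * U" using U frepD(1)[OF \<beta>(1)] by simp
        finally show ?thesis by (simp add: \<gamma>_def mult.assoc)
      qed
      show "sp_alg l \<subseteq> carrier_mat d d" by (auto simp: sp_alg_def l)
      show "M \<in> sp_alg l \<longleftrightarrow> fm d M \<in> range \<gamma>" if M: "M \<in> carrier_mat d d" for M
      proof
        assume "M \<in> sp_alg l"
        then have sk: "adj (fm d M) = - fm d M" and "tp (fm d M) * J + J * fm d M = 0"
          by (auto simp: sp_alg_iff su_alg_iff J_def l)
        then have "act (U * fm d M * adj U) q.Omega = 0" using dual actJ by simp
        then have "a.pr (U * fm d M * adj U) = U * fm d M * adj U" using q.pr_fix_iff U(1) by simp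
        moreover have "adj (U * fm d M * adj U) = - (U * fm d M * adj U)" by (simp add: sk mult.assoc)
        ultimately obtain x where "U * fm d M * adj U = \<beta> x" using in_range by blast
        then have "fm d M = \<gamma> x" using conj_inv(1)[of "fm d M"] by (simp add: \<gamma>_def)
        then show "fm d M \<in> range \<gamma>" by blast
      next
        assume "fm d M \<in> range \<gamma>"
        then obtain x where x: "fm d M = \<gamma> x" by blast
        have b: "U * fm d M * adj U = \<beta> x" unfolding x \<gamma>_def by (rule conj_inv(2)[OF frepD(1)[OF \<beta>(1)]])
        have "act (\<beta> x) q.Omega = 0" using q.pr_fix_iff[OF frepD(1)[OF \<beta>(1)]] pr\<beta> by blast
        then have "act (U * fm d M * adj U) q.Omega = 0" by (simp only: b)
        then have "tp (fm d M) * J + J * fm d M = 0" using dual actJ by simp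
        moreover have "adj (fm d M) = - fm d M" unfolding x \<gamma>_def by (simp add: \<beta>(2) mult.assoc)
        moreover have "tr (fm d M) = 0"
        proof -
          have "tr (fm d M) = tr (U * (adj U * \<beta> x))" unfolding x \<gamma>_def by (rule tr_comm)
          also have "\<dots> = tr ((U * adj U) * \<beta> x)" by (simp add: mult.assoc)
          finally show ?thesis using U(3) frepD(1)[OF \<beta>(1)] tr\<beta> by simp
        qed
        ultimately show "M \<in> sp_alg l" using M by (auto simp: sp_alg_iff su_alg_iff J_def l)
      qed
    qed
    then show ?thesis using l by blast
  qed
qed

end
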